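(* The image of the map $$M_{\Omega}(n,\mathfrak e)\to \mathbb C^{n^2},\qquad z\mapsto (r_1(z),\ldots,r_{d(n)}(z),s_1(z),\ldots,s_{d(n-1)}(z))$$ is a Zariski open set $Y$ in $\mathbb C^{n^2}$, and this map is an algebraic isomorphism of $M_{\Omega}(n,\mathfrak e)$ with $Y$. Furthermore one has the following Poisson commutation relations: (1) $[r_i,r_j]=0$ for $i,j\in I_{d(n)}$; (2) $[r_i,s_j]=\delta_{ij}\,s_j$ for $i\in I_{d(n)}$, $j\in I_{d(n-1)}$; (3) $[s_i,s_j]=0$ for $i,j\in I_{d(n-1)}$.
   Context: Fix a positive integer $n$. For $k\ge 0$ put $d(k)=k(k+1)/2$ and $I_k=\{1,\dots,k\}$. $M(n)$ is the space of complex $n\times n$ matrices; for $x\in M(n)$ and $m\in I_n$, $x_m$ is the upper left $m\times m$ block of $x$. $M_\Omega(n)$ is the Zariski open set of all $x\in M(n)$ such that $x_m$ has $m$ distinct eigenvalues for every $m\in I_n$, and $x_m,x_{m+1}$ have no common eigenvalue for every $m\in I_{n-1}$. $\mathfrak e_{\Omega(n)}$ is the set of all $\nu=(\nu(1),\dots,\nu(n))$, $\nu(m)=\mathrm{diag}(\nu_{1\,m},\dots,\nu_{m\,m})$, such that for each $m\in I_n$ the numbers $\nu_{1\,m},\dots,\nu_{m\,m}$ are distinct and $\nu_{i\,m}\ne\nu_{j\,m+1}$ for all $m\in I_{n-1}$, $i\in I_m$, $j\in I_{m+1}$; it is a Zariski open subset of $\mathbb C^{d(n)}$. Let $$M_\Omega(n,\mathfrak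 e)=\{(\nu,x)\in\mathfrak e_{\Omega(n)}\times M_\Omega(n)\mid \nu(m)\text{ is } Gl(m)\text{-conjugate to }x_m\ \forall m\in I_n\},$$ with projection $\pi_n(\nu,x)=x$; it is a nonsingular affine variety of dimension $n^2$. For $m\in I_n$, $k\in I_m$ let $r_{d(m-1)+k}(\nu,x)=\nu_{k\,m}$; this defines regular functions $r_i$ ($i\in I_{d(n)}$) on $M_\Omega(n,\mathfrak e)$. Poisson structure: on $M(n)$, $[f,g](x)=\mathrm{tr}(x[\nabla f(x),\nabla g(x)])$, where $\mathrm{tr}(\nabla f(x)v)=df_x(v)$ (the Lie–Poisson structure, $M(n)$ being identified with its dual by the trace form). Since $\pi_n$ is a local analytic isomorphism onto $M_\Omega(n)$, the structure lifts to $M_\Omega(n,\mathfrak e)$. For a function $\varphi$, $\xi_\varphi$ is the vector field with $\xi_\varphi\psi=[\varphi,\psi]$. Torus: the vector fields $\xi_{r_j}$, $j\in I_{d(n-1)}$, commute and have globally defined complex flows, trivial for times in $2\pi i\,\mathbb Z$. Hence they define an action on $M_\Omega(n,\mathfrak e)$ of the torus $A_{\mathfrak r}\cong(\mathbb C^\times)^{d(n-1)}$ with coordinates $\zeta_1,\dots,\zeta_{d(n-1)}$, normalized as follows: if $b_q$ has $\zeta_j(b_q)=e^q$ and all other coordinates $1$, and $(b\cdot f)(z)=f(b^{-1}\cdot z)$, then $\frac{d}{dq}\big|_{q=0}\,b_q\cdot f=\xi_{r_j}f$. $\mathfrak b_e$ is the set of $x\in M(n)$ with $x_{i+1,i}=1$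 for all $i\in I_{n-1}$ and $x_{i,j}=0$ for $i>j+1$ (Hessenberg matrices). Put $M_\Omega(n,\mathfrak e,\mathfrak b)=\pi_n^{-1}(\mathfrak b_e\cap M_\Omega(n))$. Every $z\in M_\Omega(n,\mathfrak e)$ is uniquely $z=b\cdot y$ with $b\in A_{\mathfrak r}$, $y\in M_\Omega(n,\mathfrak e,\mathfrak b)$; the regular functions $s_j$, $j\in I_{d(n-1)}$, are defined by $s_j(z)=\zeta_j(b^{-1})$. *)

theory Defs
  imports
    "HOL-Analysis.Function_Topology"
    "Jordan_Normal_Form.Spectral_Radius"
begin

text \<open>
  Conventions. Matrices and vectors are those of Jordan_Normal_Form and are indexed from 0, so the
  entry written x(i,j) with 1-based indices is \<open>x $$ (i - 1, j - 1)\<close>. The indices of the functions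
  r and s and of the torus coordinates are 1-based. A point of the eigenvalue variety is a pair
  (nu, x), where the tuple of diagonal matrices nu is stored as a vector of length d(n).
\<close>

type_synonym point = "complex vec \<times> complex mat"

definition tri :: "nat \<Rightarrow> nat" where
  "tri k = k * (k + 1) div 2"


section \<open>Quasi-affine varieties\<close>

text \<open>A subset of an affine space is treated through the set \<open>C\<close> of coordinate functions of
  that affine space.\<close>

inductive_set poly_funs :: "('a \<Rightarrow> complex) set \<Rightarrow> ('a \<Rightarrow> complex) set"
  for C :: "('a \<Rightarrow> complex) set" where
  const: "(\<lambda>_. c) \<in> poly_funs C"
| coord: "f \<in> C \<Longrightarrow> f \<in> poly_funs C"
| add: "f \<in> poly_funs C \<Longrightarrow> g \<in> poly_funs C \<Longrightarrow> (\<lambda>p. f p + g p) \<in> poly_funs C"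
| mult: "f \<in> poly_funs C \<Longrightarrow> g \<in> poly_funs C \<Longrightarrow> (\<lambda>p. f p * g p) \<in> poly_funs C"

text \<open>\<open>A\<close> is the whole affine space.\<close>

definition zariski_open_in :: "('a \<Rightarrow> complex) set \<Rightarrow> 'a set \<Rightarrow> 'a set \<Rightarrow> bool" where
  "zariski_open_in C A Y \<longleftrightarrow> (\<exists>S \<subseteq> poly_funs C. Y = A - {p \<in> A. \<forall>h\<in>S. h p = 0})"

definition regular_on :: "('a \<Rightarrow> complex) set \<Rightarrow> 'a set \<Rightarrow> ('a \<Rightarrow> complex) \<Rightarrow> bool" where
  "regular_on C X f \<longleftrightarrow>
     (\<forall>p\<in>X. \<exists>g\<in>poly_funs C. \<exists>h\<in>poly_funs C.
        h p \<noteq> 0 \<and> (\<forall>q\<in>X. h q \<noteq> 0 \<longrightarrow> f q = g q / h q))"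

definition regular_map ::
  "('a \<Rightarrow> complex) set \<Rightarrow> 'a set \<Rightarrow> ('b \<Rightarrow> complex) set \<Rightarrow> 'b set \<Rightarrow> ('a \<Rightarrow> 'b) \<Rightarrow> bool" where
  "regular_map C X D Y F \<longleftrightarrow> F ` X \<subseteq> Y \<and> (\<forall>c\<in>D. regular_on C X (c \<circ> F))"

definition algebraic_isomorphism ::
  "('a \<Rightarrow> complex) set \<Rightarrow> 'a set \<Rightarrow> ('b \<Rightarrow> complex) set \<Rightarrow> 'b set \<Rightarrow> ('a \<Rightarrow> 'b) \<Rightarrow> bool" where
  "algebraic_isomorphism C X D Y F \<longleftrightarrow>
     bij_betw F X Y \<and> regular_map C X D Y F \<and> regular_map D Y C X (inv_into X F)"

text \<open>The Euclidean topology on a subset \<open>X\<close> of an affine space with coordinates \<open>C\<close>.\<close>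

definition euclid_topology :: "('a \<Rightarrow> complex) set \<Rightarrow> 'a set \<Rightarrow> 'a topology" where
  "euclid_topology C X = topology_generated_by {{p \<in> X. c p \<in> V} |c V. c \<in> C \<and> open V}"

definition vec_coords :: "nat \<Rightarrow> (complex vec \<Rightarrow> complex) set" where
  "vec_coords N = {\<lambda>v. v $ i |i. i < N}"

definition mat_coords :: "nat \<Rightarrow> (complex mat \<Rightarrow> complex) set" where
  "mat_coords n = {\<lambda>x. x $$ (i, j) |i j. i < n \<and> j < n}"

definition point_coords :: "nat \<Rightarrow> (point \<Rightarrow> complex) set" where
  "point_coords n = {c \<circ> fst |c. c \<in> vec_coords (tri n)} \<union> {c \<circ> snd |c. c \<in> mat_coords n}"


section \<open>The eigenvalue variety\<close>

definition ul_block :: "nat \<Rightarrow> complex mat \<Rightarrow> complex mat" where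
  "ul_block m x = mat m m (\<lambda>(i, j). x $$ (i, j))"

definition M_Omega :: "nat \<Rightarrow> complex mat set" where
  "M_Omega n = {x \<in> carrier_mat n n.
     (\<forall>m\<in>{1..n}. card (spectrum (ul_block m x)) = m) \<and>
     (\<forall>m\<in>{1..n - 1}. spectrum (ul_block m x) \<inter> spectrum (ul_block (m + 1) x) = {})}"

text \<open>The number nu(k,m), for 1 \<open>\<le>\<close> k \<open>\<le>\<close> m \<open>\<le>\<close> n, is the coordinate number d(m-1) + k of nu.\<close>

definition nu_entry :: "complex vec \<Rightarrow> nat \<Rightarrow> nat \<Rightarrow> complex" where
  "nu_entry \<nu> k m = \<nu> $ (tri (m - 1) + k - 1)"

definition nu_diag :: "complex vec \<Rightarrow> nat \<Rightarrow> complex mat" where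
  "nu_diag \<nu> m = mat m m (\<lambda>(i, j). if i = j then nu_entry \<nu> (i + 1) m else 0)"

definition e_Omega :: "nat \<Rightarrow> complex vec set" where
  "e_Omega n = {\<nu> \<in> carrier_vec (tri n).
     (\<forall>m\<in>{1..n}. \<forall>i\<in>{1..m}. \<forall>j\<in>{1..m}. i \<noteq> j \<longrightarrow> nu_entry \<nu> i m \<noteq> nu_entry \<nu> j m) \<and>
     (\<forall>m\<in>{1..n - 1}. \<forall>i\<in>{1..m}. \<forall>j\<in>{1..m + 1}. nu_entry \<nu> i m \<noteq> nu_entry \<nu> j (m + 1))}"

definition M_Omega_e :: "nat \<Rightarrow> point set" where
  "M_Omega_e n = {(\<nu>, x). \<nu> \<in> e_Omega n \<and> x \<in> M_Omega n \<and>
     (\<forall>m\<in>{1..n}. similar_mat (nu_diag \<nu> m) (ul_block m x))}"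

definition r_fun :: "nat \<Rightarrow> point \<Rightarrow> complex" where
  "r_fun i z = fst z $ (i - 1)"


section \<open>Poisson structure\<close>

definition mat_trace :: "complex mat \<Rightarrow> complex" where
  "mat_trace A = (\<Sum>i<dim_row A. A $$ (i, i))"

definition gradient :: "nat \<Rightarrow> (complex mat \<Rightarrow> complex) \<Rightarrow> complex mat \<Rightarrow> complex mat" where
  "gradient n f x = (THE G. G \<in> carrier_mat n n \<and>
     (\<forall>v\<in>carrier_mat n n.
        ((\<lambda>t. f (x + t \<cdot>\<^sub>m v)) has_field_derivative mat_trace (G * v)) (at 0)))"

definition lie_poisson ::
  "nat \<Rightarrow> (complex mat \<Rightarrow> complex) \<Rightarrow> (complex mat \<Rightarrow> complex) \<Rightarrow> complex mat \<Rightarrow> complex" where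
  "lie_poisson n f g x =
     (let A = gradient n f x; B = gradient n g x in mat_trace (x * (A * B - B * A)))"

text \<open>The projection to the second component is a local analytic isomorphism onto its image. A
  continuous local section through \<open>z\<close> is therefore a local inverse of it, is
  analytic, and has a germ determined by \<open>z\<close>; so the choice made below is immaterial.\<close>

definition local_section :: "nat \<Rightarrow> point \<Rightarrow> (complex mat \<Rightarrow> point) \<Rightarrow> bool" where
  "local_section n z \<sigma> \<longleftrightarrow> \<sigma> (snd z) = z \<and>
     (\<exists>U. openin (euclid_topology (mat_coords n) (carrier_mat n n)) U \<and> snd z \<in> U \<and>
        (\<forall>x\<in>U. snd (\<sigma> x) = x) \<and>
        continuous_map
          (subtopology (euclid_topology (mat_coords n) (carrier_mat n n)) U)
          (euclid_topology (point_coords n) (M_Omega_e n)) \<sigma>)"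

definition bracket ::
  "nat \<Rightarrow> (point \<Rightarrow> complex) \<Rightarrow> (point \<Rightarrow> complex) \<Rightarrow> point \<Rightarrow> complex" where
  "bracket n f g z =
     (let \<sigma> = (SOME \<sigma>. local_section n z \<sigma>) in lie_poisson n (f \<circ> \<sigma>) (g \<circ> \<sigma>) (snd z))"


section \<open>The torus action\<close>

text \<open>Entire integral curves of the vector field \<open>\<psi> \<mapsto> bracket n \<phi> \<psi>\<close>, whose components in the
  ambient affine space are its values on the coordinate functions.\<close>

definition integral_curve :: "nat \<Rightarrow> (point \<Rightarrow> complex) \<Rightarrow> (complex \<Rightarrow> point) \<Rightarrow> bool" where
  "integral_curve n \<phi> \<gamma> \<longleftrightarrow> (\<forall>q. \<gamma> q \<in> M_Omega_e n) \<and>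
     (\<forall>c\<in>point_coords n. \<forall>q.
        ((\<lambda>t. c (\<gamma> t)) has_field_derivative bracket n \<phi> c (\<gamma> q)) (at q))"

definition flow :: "nat \<Rightarrow> (point \<Rightarrow> complex) \<Rightarrow> complex \<Rightarrow> point \<Rightarrow> point" where
  "flow n \<phi> q z = (THE \<gamma>. integral_curve n \<phi> \<gamma> \<and> \<gamma> 0 = z) q"

text \<open>The coordinate zeta(j) of a torus element \<open>b\<close> is \<open>b j\<close>.\<close>

definition torus :: "nat \<Rightarrow> (nat \<Rightarrow> complex) set" where
  "torus n = {1..tri (n - 1)} \<rightarrow>\<^sub>E - {0}"

definition torus_inv :: "nat \<Rightarrow> (nat \<Rightarrow> complex) \<Rightarrow> nat \<Rightarrow> complex" where
  "torus_inv n b = (\<lambda>j\<in>{1..tri (n - 1)}. inverse (b j))"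

text \<open>The element with j-th coordinate exp q and all others 1 acts by the flow of the j-th vector
  field at time -q. The sign comes from the normalization: the derivative at q = 0 of
  f(inverse(b(q)) z) has to be the j-th vector field applied to f. The choice of logarithm is
  immaterial as the flows are trivial at times in 2 pi i Z; the order of composition is immaterial
  as they commute.\<close>

definition torus_act :: "nat \<Rightarrow> (nat \<Rightarrow> complex) \<Rightarrow> point \<Rightarrow> point" where
  "torus_act n b z =
     fold (\<lambda>j w. flow n (r_fun j) (- (SOME q. exp q = b j)) w) [1..<tri (n - 1) + 1] z"


section \<open>The functions s\<close>

definition hessenberg :: "nat \<Rightarrow> complex mat set" where
  "hessenberg n = {x \<in> carrier_mat n n.
     (\<forall>i\<in>{1..n - 1}. x $$ (i, i - 1) = 1) \<and>
     (\<forall>i<n. \<forall>j<n. i > j + 1 \<longrightarrow> x $$ (i, j) = 0)}"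

definition M_Omega_e_b :: "nat \<Rightarrow> point set" where
  "M_Omega_e_b n = {z \<in> M_Omega_e n. snd z \<in> hessenberg n \<inter> M_Omega n}"

definition s_fun :: "nat \<Rightarrow> nat \<Rightarrow> point \<Rightarrow> complex" where
  "s_fun n j z =
     torus_inv n (THE b. b \<in> torus n \<and> (\<exists>y\<in>M_Omega_e_b n. z = torus_act n b y)) j"

definition rs_map :: "nat \<Rightarrow> point \<Rightarrow> complex vec" where
  "rs_map n z =
     vec (n\<^sup>2) (\<lambda>i. if i < tri n then r_fun (i + 1) z else s_fun n (i + 1 - tri n) z)"

end

(* The function s with index d(m-1) + k is the value of the row (x_{m+1,1}, ..., x_{m+1,m}) on the
   eigenvector of x_m for nu_{k m} whose last coordinate is 1: this number never vanishes, is 1 on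
   the Hessenberg slice, is multiplied by e^t by its own flow (conjugation by exp(-t P), with P the
   spectral projection) and is invariant under the other flows.  Given nu and the block x_m, these
   numbers determine the new row of x_{m+1}; the new column and corner are then the solution of a
   Cauchy linear system, so x is recovered rationally from (r, s), level by level.

   All gradients have rank one: if phi, psi are the right and left eigenvectors, the gradient of nu_{k m}
   is phi psi^T, and that of its s is phi rho^T for a row rho with
   rho x alpha = nu_{k m} (rho alpha) + s alpha_m for all alpha supported on the first m coordinates.
   The Lie-Poisson bracket of alpha beta^T and alpha' beta'^T is
   (beta alpha') (beta' x alpha) - (beta' alpha) (beta x alpha'), and the relations follow. *)

theory Submission
  imports Defs
begin

section \<open>Linear systems and eigenvectors\<close>

text \<open>The definitions go through choices: \<open>bracket\<close> uses an arbitrary local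
  section, \<open>flow\<close> a unique entire integral curve, \<open>s_fun\<close> a unique torus
  element. Gradients must therefore be computed along every continuous section, without knowing
  beforehand that eigenvectors depend differentiably on the matrix. The remedy is to pair a covector
  fixed at the base point with the eigenvector at the moved point: the difference quotients of
  eigenvalues and coefficients become exact expressions in the moved eigenvector, and continuity of
  that vector, which Cramer's rule supplies, is enough to pass to the limit. The row
  \<open>rho\<close> is designed so that this also works for the coefficients. Uniqueness of the
  flows is obtained by hand: along an integral curve the spectra and one leading block are frozen,
  so that the equation becomes linear with constant coefficients. The torus element in
  \<open>s_fun\<close> exists and is unique because spectra and coefficients together separate
  points.\<close>

lemma inj_imp_det_nonzero:
  fixes A :: "nat \<Rightarrow> nat \<Rightarrow> complex"
  assumes "\<And>y. (\<forall>i<k. (\<Sum>j<k. A i j * y j) = 0) \<Longrightarrow> \<forall>j<k. y j = 0"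
  shows "det (mat k k (\<lambda>(i, j). A i j)) \<noteq> 0"
proof
  assume "det (mat k k (\<lambda>(i, j). A i j)) = 0"
  then obtain v where v: "v \<in> carrier_vec k" "v \<noteq> 0\<^sub>v k"
      "mat k k (\<lambda>(i, j). A i j) *\<^sub>v v = 0\<^sub>v k"
    using det_0_iff_vec_prod_zero[of _ k] by (meson mat_carrier)
  have "\<forall>i<k. (\<Sum>j<k. A i j * v $ j) = 0"
  proof (intro allI impI)
    fix i assume i: "i < k"
    then have "(mat k k (\<lambda>(i, j). A i j) *\<^sub>v v) $ i = (\<Sum>j<k. A i j * v $ j)"
      using v(1) by (auto simp: scalar_prod_def atLeast0LessThan intro!: sum.cong)
    with v(3) i show "(\<Sum>j<k. A i j * v $ j) = 0" by simp
  qed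
  then have "\<forall>j<k. v $ j = 0" by (rule assms)
  then have "v = 0\<^sub>v k" using v(1) by (intro eq_vecI) auto
  with v(2) show False by simp
qed

text \<open>The inverse is written with adjugate and determinant because both are polynomial in the
  entries; \<open>regular_on_solve\<close> uses this form to get regular solutions.\<close>

lemma adj_mat_inverse:
  fixes A :: "nat \<Rightarrow> nat \<Rightarrow> complex" and k :: nat
  defines "M \<equiv> mat k k (\<lambda>(i, j). A i j)"
  assumes "det M \<noteq> 0" and i: "i < k" and j: "j < k"
  shows "(\<Sum>l<k. A i l * (adj_mat M $$ (l, j) / det M)) = (if i = j then 1 else 0)"
    and "(\<Sum>l<k. (adj_mat M $$ (i, l) / det M) * A l j) = (if i = j then 1 else 0)"
proof -
  have M: "M \<in> carrier_mat k k" unfolding M_def by simp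
  note adj = adj_mat[OF M]
  have "(M * adj_mat M) $$ (i, j) = (\<Sum>l<k. A i l * adj_mat M $$ (l, j))"
    using i j adj(1) unfolding M_def
    by (auto simp: scalar_prod_def atLeast0LessThan intro!: sum.cong)
  then have "(\<Sum>l<k. A i l * adj_mat M $$ (l, j)) = (if i = j then det M else 0)"
    using i j by (auto simp: adj(2) split: if_splits)
  then show "(\<Sum>l<k. A i l * (adj_mat M $$ (l, j) / det M)) = (if i = j then 1 else 0)"
    using assms(2) by (simp add: sum_divide_distrib[symmetric] split: if_splits)
  have "(adj_mat M * M) $$ (i, j) = (\<Sum>l<k. adj_mat M $$ (i, l) * A l j)"
    using i j adj(1) unfolding M_def
    by (auto simp: scalar_prod_def atLeast0LessThan intro!: sum.cong)
  then have "(\<Sum>l<k. adj_mat M $$ (i, l) * A l j) = (if i = j then det M else 0)"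
    using i j by (auto simp: adj(3) split: if_splits)
  then show "(\<Sum>l<k. (adj_mat M $$ (i, l) / det M) * A l j) = (if i = j then 1 else 0)"
    using assms(2) by (simp add: sum_divide_distrib[symmetric] split: if_splits)
qed

lemma two_sided_inverse:
  fixes A :: "nat \<Rightarrow> nat \<Rightarrow> complex"
  assumes "\<And>y. (\<forall>i<k. (\<Sum>j<k. A i j * y j) = 0) \<Longrightarrow> \<forall>j<k. y j = 0"
  shows "\<exists>W. (\<forall>i<k. \<forall>j<k. (\<Sum>l<k. A i l * W l j) = (if i = j then 1 else 0)) \<and>
    (\<forall>i<k. \<forall>j<k. (\<Sum>l<k. W i l * A l j) = (if i = j then 1 else 0))"
proof -
  have "det (mat k k (\<lambda>(i, j). A i j)) \<noteq> 0" using assms by (rule inj_imp_det_nonzero)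
  from adj_mat_inverse[OF this] show ?thesis
    by (intro exI[of _ "\<lambda>i j. adj_mat (mat k k (\<lambda>(i, j). A i j)) $$ (i, j) /
        det (mat k k (\<lambda>(i, j). A i j))"] conjI allI impI)
qed

lemma left_inverse_solve:
  fixes A W :: "nat \<Rightarrow> nat \<Rightarrow> complex"
  assumes W: "\<And>i j. i < k \<Longrightarrow> j < k \<Longrightarrow> (\<Sum>l<k. W i l * A l j) = (if i = j then 1 else 0)"
    and y: "\<And>i. i < k \<Longrightarrow> (\<Sum>j<k. A i j * y j) = b i" and j: "j < k"
  shows "y j = (\<Sum>i<k. W j i * b i)"
proof -
  have "(\<Sum>i<k. W j i * b i) = (\<Sum>i<k. \<Sum>l<k. W j i * A i l * y l)"
    by (intro sum.cong refl) (simp add: y[symmetric] sum_distrib_left mult.assoc)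
  also have "\<dots> = (\<Sum>l<k. (\<Sum>i<k. W j i * A i l) * y l)"
    by (subst sum.swap) (simp add: sum_distrib_right)
  also have "\<dots> = (\<Sum>l<k. (if j = l then 1 else 0) * y l)"
    by (intro sum.cong refl) (use W j in simp)
  also have "\<dots> = y j" using j by (simp add: if_distrib[of "\<lambda>x. x * _"] cong: if_cong)
  finally show ?thesis by simp
qed

lemma right_inverse_solve:
  fixes A W :: "nat \<Rightarrow> nat \<Rightarrow> complex"
  assumes W: "\<And>i j. i < k \<Longrightarrow> j < k \<Longrightarrow> (\<Sum>l<k. A i l * W l j) = (if i = j then 1 else 0)"
    and i: "i < k"
  shows "(\<Sum>j<k. A i j * (\<Sum>l<k. W j l * b l)) = b i"
proof -
  have "(\<Sum>j<k. A i j * (\<Sum>l<k. W j l * b l)) = (\<Sum>l<k. (\<Sum>j<k. A i j * W j l) * b l)"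
    by (simp add: sum_distrib_left sum_distrib_right mult.assoc) (subst sum.swap, simp)
  also have "\<dots> = (\<Sum>l<k. (if i = l then 1 else 0) * b l)"
    by (intro sum.cong refl) (use W i in simp)
  also have "\<dots> = b i" using i by (simp add: if_distrib[of "\<lambda>x. x * _"] cong: if_cong)
  finally show ?thesis .
qed

section \<open>Eigenvectors of leading blocks\<close>

definition eigvec :: "nat \<Rightarrow> (nat \<Rightarrow> nat \<Rightarrow> complex) \<Rightarrow> complex \<Rightarrow> (nat \<Rightarrow> complex) \<Rightarrow> bool" where
  "eigvec m X c f \<longleftrightarrow> (\<forall>i<m. (\<Sum>j<m. X i j * f j) = c * f i)"

lemma eigvec_cong:
  assumes "\<And>i j. i < m \<Longrightarrow> j < m \<Longrightarrow> X i j = Y i j"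
  shows "eigvec m X c f = eigvec m Y c f"
  using assms by (simp add: eigvec_def)

lemma eigvec_Suc:
  "eigvec (Suc m) X c f \<longleftrightarrow>
     (\<forall>i<m. (\<Sum>j<m. X i j * f j) + X i m * f m = c * f i) \<and>
     (\<Sum>j<m. X m j * f j) + X m m * f m = c * f m"
  by (auto simp: eigvec_def less_Suc_eq)

text \<open>Applying X to a vanishing combination and subtracting \<open>c s\<close> times it
  removes the vector of \<open>s\<close> and multiplies each other coefficient by the nonzero number
  \<open>c k - c s\<close>; the rest is induction on the index set.\<close>

lemma eigvecs_indep:
  assumes "finite S" "inj_on c S"
    and "\<And>k. k \<in> S \<Longrightarrow> eigvec m X (c k) (f k)" "\<And>k. k \<in> S \<Longrightarrow> \<exists>i<m. f k i \<noteq> 0"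
    and "\<And>i. i < m \<Longrightarrow> (\<Sum>k\<in>S. y k * f k i) = 0" and "k \<in> S"
  shows "y k = 0"
  using assms
proof (induction S arbitrary: y k rule: finite_induct)
  case (insert s S)
  have E: "(\<Sum>k\<in>S. y k * f k i) = - (y s * f s i)" if "i < m" for i
    using insert.prems(4)[OF that] insert.hyps by (simp add: add_eq_0_iff)
  have "(\<Sum>k\<in>S. (y k * (c k - c s)) * f k i) = 0" if i: "i < m" for i
  proof -
    have ev: "c k * f k i = (\<Sum>j<m. X i j * f k j)" if "k \<in> insert s S" for k
      using insert.prems(2)[OF that] i by (simp add: eigvec_def)
    have "(\<Sum>k\<in>S. y k * (c k * f k i)) = (\<Sum>k\<in>S. \<Sum>j<m. X i j * (y k * f k j))"
      using ev by (intro sum.cong refl) (simp add: sum_distrib_left mult_ac)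
    also have "\<dots> = (\<Sum>j<m. X i j * (\<Sum>k\<in>S. y k * f k j))"
      by (subst sum.swap) (simp add: sum_distrib_left)
    also have "\<dots> = (\<Sum>j<m. - y s * (X i j * f s j))"
      by (intro sum.cong refl) (simp add: E)
    also have "\<dots> = - y s * (c s * f s i)"
      using ev[of s] by (simp only: sum_distrib_left[symmetric] insertI1)
    finally have "(\<Sum>k\<in>S. y k * (c k * f k i)) = c s * (\<Sum>k\<in>S. y k * f k i)"
      using E[OF i] by simp
    then show ?thesis
      by (simp add: algebra_simps sum_subtractf sum_distrib_left)
  qed
  moreover have "inj_on c S" using insert.prems(1) by (simp add: inj_on_insert)
  ultimately have "y k * (c k - c s) = 0" if "k \<in> S" for k
    by (intro insert.IH[of "\<lambda>k. y k * (c k - c s)" k]) (use insert.prems(2,3) that in auto)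
  moreover have "c k \<noteq> c s" if "k \<in> S" for k
    using insert.prems(1) insert.hyps(2) that by (auto simp: inj_on_def)
  ultimately have z: "y k = 0" if "k \<in> S" for k using that by force
  obtain i where i: "i < m" "f s i \<noteq> 0" using insert.prems(3) by auto
  have "(\<Sum>k\<in>S. y k * f k i) = 0" by (rule sum.neutral) (use z in simp)
  then have "y s = 0" using E[OF i(1)] i(2) by simp
  with z insert.prems(5) show ?case by auto
qed simp

text \<open>Independence makes the matrix with columns \<open>f k\<close> invertible, and the rows
  of its inverse form the dual basis. Since \<open>f l i\<close> is coordinate i of vector l, the
  indices appear swapped.\<close>

lemma eigvecs_dual:
  assumes "inj_on c {..<m}"
    and "\<And>k. k < m \<Longrightarrow> eigvec m X (c k) (f k)" "\<And>k. k < m \<Longrightarrow> \<exists>i<m. f k i \<noteq> 0"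
  shows "\<exists>W. (\<forall>i<m. \<forall>j<m. (\<Sum>l<m. f l i * W l j) = (if i = j then 1 else 0)) \<and>
    (\<forall>i<m. \<forall>j<m. (\<Sum>l<m. W i l * f j l) = (if i = j then 1 else 0))"
proof (rule two_sided_inverse[of m "\<lambda>i k. f k i"], intro allI impI)
  fix y j
  assume "\<forall>i<m. (\<Sum>j<m. f j i * y j) = 0" and "j < m"
  then show "y j = 0"
    by (intro eigvecs_indep[of "{..<m}" c m X f y]) (use assms in \<open>auto simp: mult.commute\<close>)
qed

text \<open>The m given eigenvectors span, so a nonzero eigenvector for a further eigenvalue would
  be a combination of them and independent of them at once.\<close>

lemma eigvecs_complete:
  assumes "inj_on c {..<m}"
    and "\<And>k. k < m \<Longrightarrow> eigvec m X (c k) (f k)" "\<And>k. k < m \<Longrightarrow> \<exists>i<m. f k i \<noteq> 0"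
    and g: "eigvec m X d g" "\<And>k. k < m \<Longrightarrow> c k \<noteq> d" and i: "i < m"
  shows "g i = 0"
proof (rule ccontr)
  assume "g i \<noteq> 0"
  obtain W where W: "\<forall>i<m. \<forall>j<m. (\<Sum>l<m. f l i * W l j) = (if i = j then 1 else 0)"
    using eigvecs_dual[OF assms(1-3)] by blast
  \<comment> \<open>Index m stands for \<open>g\<close>, with coefficient - 1 and eigenvalue
    \<open>d\<close>; the vanishing combination says that \<open>g\<close> equals its expansion in
    the \<open>f k\<close>.\<close>
  define y where "y k = (if k < m then \<Sum>j<m. W k j * g j else - 1)" for k
  define h where "h k = (if k < m then f k else g)" for k
  define e where "e k = (if k < m then c k else d)" for k
  have "(\<Sum>k\<in>{..m}. y k * h k i) = 0" if "i < m" for i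
  proof -
    have "(\<Sum>k<m. y k * h k i) = (\<Sum>k<m. f k i * (\<Sum>j<m. W k j * g j))"
      by (intro sum.cong refl) (simp add: y_def h_def)
    also have "\<dots> = g i" by (rule right_inverse_solve[where A = "\<lambda>i k. f k i"]) (use W that in auto)
    finally show ?thesis by (simp add: lessThan_Suc_atMost[symmetric] y_def h_def)
  qed
  moreover have "inj_on e {..m}"
    using assms(1) g(2) by (fastforce simp: inj_on_def e_def)
  ultimately have "y m = 0"
    using assms(2,3) g(1) i \<open>g i \<noteq> 0\<close>
    by (intro eigvecs_indep[of "{..m}" e m X h y]) (auto simp: h_def e_def)
  then show False by (simp add: y_def)
qed

text \<open>Extended by zero beyond the block, so that pairings over all n coordinates reduce to the
  block. Under \<open>gz\<close> the choice is unique, by \<open>phi_unique\<close>.\<close>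

definition phi :: "(nat \<Rightarrow> nat \<Rightarrow> complex) \<Rightarrow> complex \<Rightarrow> nat \<Rightarrow> nat \<Rightarrow> complex" where
  "phi X c m = (SOME f. eigvec m X c f \<and> f (m - 1) = 1 \<and> (\<forall>i\<ge>m. f i = 0))"

text \<open>The basis dual to the vectors \<open>phi\<close>, that is, the left eigenvectors of the
  block scaled to pair to 1 with them; \<open>psi_col\<close> proves the eigenvector
  property.\<close>

definition psi :: "(nat \<Rightarrow> nat \<Rightarrow> complex) \<Rightarrow> (nat \<Rightarrow> nat \<Rightarrow> complex) \<Rightarrow> nat \<Rightarrow> nat \<Rightarrow> nat \<Rightarrow> complex" where
  "psi X N m = (SOME W.
     (\<forall>i<m. \<forall>j<m. (\<Sum>l<m. phi X (N m l) m i * W l j) = (if i = j then 1 else 0)) \<and>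
     (\<forall>i<m. \<forall>j<m. (\<Sum>l<m. W i l * phi X (N m j) m l) = (if i = j then 1 else 0)) \<and>
     (\<forall>k. \<forall>j\<ge>m. W k j = 0))"

definition coef :: "(nat \<Rightarrow> nat \<Rightarrow> complex) \<Rightarrow> (nat \<Rightarrow> nat \<Rightarrow> complex) \<Rightarrow> nat \<Rightarrow> nat \<Rightarrow> complex" where
  "coef X N m k = (\<Sum>i<m. X m i * phi X (N m k) m i)"

text \<open>Put rho = e_m + sum of c_l psi_l, with e_m the unit row. The demand rho X phi_l = N_k
  (rho phi_l) + a_k reads a_l + c_l N_l = N_k c_l + a_k. It yields the stated c_l for l different
  from k and leaves c_k free; the choice c_k = 0 makes rho annihilate phi_k.\<close>

definition rho :: "(nat \<Rightarrow> nat \<Rightarrow> complex) \<Rightarrow> (nat \<Rightarrow> nat \<Rightarrow> complex) \<Rightarrow> nat \<Rightarrow> nat \<Rightarrow> nat \<Rightarrow> complex" where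
  "rho X N m k j = (if j = m then 1 else
     (\<Sum>l\<in>{..<m} - {k}. (coef X N m l - coef X N m k) / (N m k - N m l) * psi X N m l j))"

lemma phi_cong:
  assumes "\<And>i j. i < m \<Longrightarrow> j < m \<Longrightarrow> X i j = Y i j"
  shows "phi X c m = phi Y c m"
  using eigvec_cong[of m X Y] assms by (simp add: phi_def)

lemma psi_cong:
  assumes "\<And>i j. i < m \<Longrightarrow> j < m \<Longrightarrow> X i j = Y i j" "\<And>k. k < m \<Longrightarrow> N m k = N' m k"
  shows "psi X N m = psi Y N' m"
  using phi_cong[of m X Y] assms by (simp add: psi_def)

section \<open>Pairings and the calculus of separated spectra\<close>

definition dot :: "nat \<Rightarrow> (nat \<Rightarrow> complex) \<Rightarrow> (nat \<Rightarrow> complex) \<Rightarrow> complex" where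
  "dot n a b = (\<Sum>i<n. a i * b i)"

definition bil :: "nat \<Rightarrow> (nat \<Rightarrow> nat \<Rightarrow> complex) \<Rightarrow> (nat \<Rightarrow> complex) \<Rightarrow> (nat \<Rightarrow> complex) \<Rightarrow> complex" where
  "bil n X b a = (\<Sum>i<n. b i * (\<Sum>j<n. X i j * a j))"

lemma bil_alt: "bil n X b a = (\<Sum>j<n. (\<Sum>i<n. b i * X i j) * a j)"
  by (simp add: bil_def sum_distrib_left sum_distrib_right mult.assoc) (rule sum.swap)

lemma dot_commute: "dot n a b = dot n b a"
  by (simp add: dot_def mult.commute)

lemma sum_supp:
  fixes f :: "nat \<Rightarrow> complex"
  assumes "m \<le> n" "\<And>i. m \<le> i \<Longrightarrow> f i = 0"
  shows "(\<Sum>i<n. f i) = (\<Sum>i<m. f i)"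
  by (rule sum.mono_neutral_right) (use assms in auto)

text \<open>Membership in the eigenvalue variety, phrased for index functions: \<open>N m k\<close>
  is the eigenvalue number k, counted from 0, of the leading m by m block (see
  \<open>mem_M_Omega_e\<close>). Functions carry no dimension, so one X can be studied at every
  size, as the induction in \<open>coef_realize\<close> requires.\<close>

locale gz =
  fixes n :: nat and X N :: "nat \<Rightarrow> nat \<Rightarrow> complex"
  assumes inj: "m \<le> n \<Longrightarrow> inj_on (N m) {..<m}"
    and ev: "m \<le> n \<Longrightarrow> k < m \<Longrightarrow> \<exists>f. eigvec m X (N m k) f \<and> (\<exists>i<m. f i \<noteq> 0)"
    and sep: "m < n \<Longrightarrow> k < m \<Longrightarrow> l \<le> m \<Longrightarrow> N m k \<noteq> N (Suc m) l"
begin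

abbreviation "\<phi> m k \<equiv> phi X (N m k) m"
abbreviation "\<psi> m k \<equiv> psi X N m k"
abbreviation "\<rho> m k \<equiv> rho X N m k"
abbreviation "a m k \<equiv> coef X N m k"

lemma complete:
  assumes "m \<le> n" "eigvec m X d g" "\<And>k. k < m \<Longrightarrow> N m k \<noteq> d" "i < m"
  shows "g i = 0"
proof -
  obtain f where f: "\<And>k. k < m \<Longrightarrow> eigvec m X (N m k) (f k) \<and> (\<exists>i<m. f k i \<noteq> 0)"
    using ev[OF assms(1)] by metis
  show ?thesis
    by (rule eigvecs_complete[OF inj[OF assms(1)], of X f d g i]) (simp_all add: assms f)
qed

text \<open>With vanishing last coordinate, the first m - 1 coordinates satisfy the eigenvector
  equation of the preceding block for the same value, and adjacent blocks share no eigenvalue. This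
  is what permits the normalization of \<open>phi\<close>.\<close>

lemma last_zero:
  assumes m: "m \<le> n" "k < m" and g: "eigvec m X (N m k) g" "g (m - 1) = 0" and i: "i < m"
  shows "g i = 0"
proof -
  obtain m' where m': "m = Suc m'" using m(2) by (cases m) auto
  have "eigvec m' X (N m k) g" using g by (simp add: m' eigvec_Suc) (simp add: eigvec_def)
  then have "g i = 0" if "i < m'" for i
    by (intro complete[of m' "N m k" g]) (use sep[of m'] m that in \<open>auto simp: m'\<close>)
  then show ?thesis using g(2) i by (cases "i = m'") (auto simp: m')
qed

lemma phi_ex:
  assumes "m \<le> n" "k < m"
  shows "\<exists>f. eigvec m X (N m k) f \<and> f (m - 1) = 1 \<and> (\<forall>i\<ge>m. f i = 0)"
proof -
  obtain g where g: "eigvec m X (N m k) g" "\<exists>i<m. g i \<noteq> 0" using ev[OF assms] by auto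
  then have nz: "g (m - 1) \<noteq> 0" using last_zero[OF assms g(1)] by blast
  let ?f = "\<lambda>i. if i < m then g i / g (m - 1) else 0"
  have "eigvec m X (N m k) ?f"
    using g(1) by (simp add: eigvec_def sum_divide_distrib[symmetric])
  moreover have "?f (m - 1) = 1" using nz assms by simp
  ultimately show ?thesis by (intro exI[of _ ?f]) auto
qed

lemma
  assumes "m \<le> n" "k < m"
  shows phi_eigvec: "eigvec m X (N m k) (\<phi> m k)"
    and phi_last: "\<phi> m k (m - 1) = 1"
    and phi_supp: "m \<le> i \<Longrightarrow> \<phi> m k i = 0"
  using someI_ex[OF phi_ex[OF assms]] unfolding phi_def[symmetric] by auto

text \<open>Two candidates differ by a solution of the eigenvector equation whose last coordinate is
  0.\<close>

lemma phi_unique: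
  assumes m: "m \<le> n" "k < m" and g: "eigvec m X (N m k) g" "g (m - 1) = 1" "\<And>i. m \<le> i \<Longrightarrow> g i = 0"
  shows "g = \<phi> m k"
proof
  fix i
  have "eigvec m X (N m k) (\<lambda>i. g i - \<phi> m k i)"
    using g(1) phi_eigvec[OF m] by (simp add: eigvec_def algebra_simps sum_subtractf)
  from last_zero[OF m this, of i] show "g i = \<phi> m k i"
    using g phi_last[OF m] phi_supp[OF m] by (cases "i < m") auto
qed

lemma phi_row: "m \<le> n \<Longrightarrow> k < m \<Longrightarrow> i < m \<Longrightarrow> (\<Sum>j<m. X i j * \<phi> m k j) = N m k * \<phi> m k i"
  using phi_eigvec by (simp add: eigvec_def)

lemma psi_ex:
  assumes "m \<le> n"
  shows "\<exists>W. (\<forall>i<m. \<forall>j<m. (\<Sum>l<m. \<phi> m l i * W l j) = (if i = j then 1 else 0)) \<and>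
     (\<forall>i<m. \<forall>j<m. (\<Sum>l<m. W i l * \<phi> m j l) = (if i = j then 1 else 0)) \<and>
     (\<forall>k::nat. \<forall>j\<ge>m. W k j = 0)"
proof -
  have "\<exists>i<m. \<phi> m k i \<noteq> 0" if "k < m" for k
    using phi_last[OF assms that] that by (intro exI[of _ "m - 1"]) auto
  from eigvecs_dual[OF inj[OF assms], of X "\<phi> m", OF phi_eigvec[OF assms] this]
  obtain W where "\<forall>i<m. \<forall>j<m. (\<Sum>l<m. \<phi> m l i * W l j) = (if i = j then 1 else 0)"
      "\<forall>i<m. \<forall>j<m. (\<Sum>l<m. W i l * \<phi> m j l) = (if i = j then 1 else 0)"
    by blast
  then show ?thesis
    by (intro exI[of _ "\<lambda>k j. if j < m then W k j else 0"]) auto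
qed

lemma
  assumes "m \<le> n"
  shows psi_right: "i < m \<Longrightarrow> j < m \<Longrightarrow> (\<Sum>l<m. \<phi> m l i * \<psi> m l j) = (if i = j then 1 else 0)"
    and psi_left: "i < m \<Longrightarrow> j < m \<Longrightarrow> (\<Sum>l<m. \<psi> m i l * \<phi> m j l) = (if i = j then 1 else 0)"
    and psi_supp: "m \<le> j \<Longrightarrow> \<psi> m k j = 0"
  using someI_ex[OF psi_ex[OF assms]] unfolding psi_def[symmetric] by auto

lemma expand:
  assumes "m \<le> n" "i < m"
  shows "g i = (\<Sum>k<m. \<phi> m k i * (\<Sum>j<m. \<psi> m k j * g j))"
  by (rule right_inverse_solve[where A = "\<lambda>i k. \<phi> m k i", symmetric]) (use psi_right assms in auto)

text \<open>Duality of the bases gives the spectral decomposition of the block as the sum of the N_l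
  phi_l psi_l; multiplying by psi_k from the left leaves one term.\<close>

lemma psi_col:
  assumes m: "m \<le> n" "k < m" and j: "j < m"
  shows "(\<Sum>i<m. \<psi> m k i * X i j) = N m k * \<psi> m k j"
proof -
  have X: "X i j = (\<Sum>l<m. N m l * \<phi> m l i * \<psi> m l j)" if "i < m" for i
  proof -
    have "X i j = (\<Sum>j'<m. X i j' * (if j' = j then 1 else 0))"
      using j by (simp add: if_distrib cong: if_cong)
    also have "\<dots> = (\<Sum>j'<m. \<Sum>l<m. X i j' * \<phi> m l j' * \<psi> m l j)"
      by (intro sum.cong refl) (simp add: psi_right[OF m(1) _ j, symmetric] sum_distrib_left mult.assoc)
    also have "\<dots> = (\<Sum>l<m. (\<Sum>j'<m. X i j' * \<phi> m l j') * \<psi> m l j)"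
      by (subst sum.swap) (simp add: sum_distrib_right)
    also have "\<dots> = (\<Sum>l<m. N m l * \<phi> m l i * \<psi> m l j)"
      by (intro sum.cong refl) (simp add: phi_row[OF m(1) _ that])
    finally show ?thesis .
  qed
  have "(\<Sum>i<m. \<psi> m k i * X i j) = (\<Sum>i<m. \<Sum>l<m. \<psi> m k i * \<phi> m l i * (N m l * \<psi> m l j))"
    by (intro sum.cong refl) (simp add: X sum_distrib_left mult_ac)
  also have "\<dots> = (\<Sum>l<m. (\<Sum>i<m. \<psi> m k i * \<phi> m l i) * (N m l * \<psi> m l j))"
    by (subst sum.swap) (simp add: sum_distrib_right)
  also have "\<dots> = (\<Sum>l<m. (if k = l then 1 else 0) * (N m l * \<psi> m l j))"
    by (intro sum.cong refl) (simp add: psi_left[OF m(1,2)])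
  also have "\<dots> = N m k * \<psi> m k j"
    using m(2) by (simp add: if_distrib[of "\<lambda>x. x * _"] cong: if_cong)
  finally show ?thesis .
qed

text \<open>A zero value would make \<open>\<phi> m k\<close>, extended by zero, an eigenvector of
  the next block for \<open>N m k\<close>, against the separation of adjacent spectra.\<close>

lemma coef_nonzero:
  assumes "m < n" "k < m"
  shows "a m k \<noteq> 0"
proof
  assume "a m k = 0"
  have k: "m \<le> n" "k < m" using assms by auto
  have "eigvec (Suc m) X (N m k) (\<phi> m k)"
    using \<open>a m k = 0\<close> phi_row[OF k] phi_supp[OF k, of m] by (simp add: eigvec_Suc coef_def)
  then have "\<phi> m k (m - 1) = 0"
    by (intro complete[of "Suc m" "N m k" "\<phi> m k" "m - 1"])
      (use sep[OF assms] assms in \<open>auto simp: less_Suc_eq_le eq_commute[of "N (Suc m) _"]\<close>)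
  then show False using phi_last[OF k] by simp
qed

text \<open>The covector need only live on the first m coordinates and may come from a lower level.
  Brackets across levels can thus be evaluated with the eigenvalue of the larger one.\<close>

lemma bil_phi:
  assumes m: "m \<le> n" "k < m" and b: "\<And>i. m \<le> i \<Longrightarrow> b i = 0"
  shows "bil n X b (\<phi> m k) = N m k * dot n b (\<phi> m k)"
proof -
  have s: "(\<Sum>j<n. X i j * \<phi> m k j) = (\<Sum>j<m. X i j * \<phi> m k j)" for i
    by (rule sum_supp) (use m phi_supp in auto)
  have "bil n X b (\<phi> m k) = (\<Sum>i<m. b i * (\<Sum>j<m. X i j * \<phi> m k j))"
    unfolding bil_def s by (rule sum_supp) (use m b in auto)
  also have "\<dots> = N m k * (\<Sum>i<m. b i * \<phi> m k i)"
    by (simp add: phi_row[OF m] sum_distrib_left mult_ac)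
  also have "(\<Sum>i<m. b i * \<phi> m k i) = dot n b (\<phi> m k)"
    unfolding dot_def by (rule sum_supp[symmetric]) (use m b in auto)
  finally show ?thesis .
qed

lemma bil_psi:
  assumes m: "m \<le> n" "k < m" and b: "\<And>i. m \<le> i \<Longrightarrow> b i = 0"
  shows "bil n X (\<psi> m k) b = N m k * dot n (\<psi> m k) b"
proof -
  have s: "(\<Sum>i<n. \<psi> m k i * X i j) = (\<Sum>i<m. \<psi> m k i * X i j)" for j
    by (rule sum_supp) (use m psi_supp in auto)
  have "bil n X (\<psi> m k) b = (\<Sum>j<m. (\<Sum>i<m. \<psi> m k i * X i j) * b j)"
    unfolding bil_alt s by (rule sum_supp) (use m b in auto)
  also have "\<dots> = N m k * (\<Sum>i<m. \<psi> m k i * b i)"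
    unfolding sum_distrib_left by (intro sum.cong refl) (simp add: psi_col[OF m])
  also have "(\<Sum>i<m. \<psi> m k i * b i) = dot n (\<psi> m k) b"
    unfolding dot_def by (rule sum_supp[symmetric]) (use m b in auto)
  finally show ?thesis .
qed

lemma dot_psi_phi: "m \<le> n \<Longrightarrow> k < m \<Longrightarrow> l < m \<Longrightarrow> dot n (\<psi> m k) (\<phi> m l) = (if k = l then 1 else 0)"
  unfolding dot_def by (subst sum_supp[of m]) (auto simp: psi_left phi_supp)

lemma dot_rho:
  assumes m: "m < n" "k < m" and b: "\<And>i. m \<le> i \<Longrightarrow> b i = 0"
  shows "dot n (\<rho> m k) b =
    (\<Sum>l\<in>{..<m} - {k}. (a m l - a m k) / (N m k - N m l) * dot n (\<psi> m l) b)"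
proof -
  have "dot n (\<rho> m k) b = (\<Sum>j<m. \<rho> m k j * b j)"
    unfolding dot_def by (rule sum_supp) (use m b in auto)
  also have "\<dots> = (\<Sum>j<m. \<Sum>l\<in>{..<m} - {k}. (a m l - a m k) / (N m k - N m l) * (\<psi> m l j * b j))"
    by (intro sum.cong refl) (simp add: rho_def sum_distrib_right mult.assoc)
  also have "\<dots> = (\<Sum>l\<in>{..<m} - {k}. (a m l - a m k) / (N m k - N m l) * (\<Sum>j<m. \<psi> m l j * b j))"
    by (subst sum.swap) (simp add: sum_distrib_left)
  also have "(\<lambda>l. \<Sum>j<m. \<psi> m l j * b j) = (\<lambda>l. dot n (\<psi> m l) b)"
    unfolding dot_def by (intro ext sum_supp[symmetric]) (use m b in auto)
  finally show ?thesis .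
qed

lemma dot_rho_phi:
  assumes m: "m < n" "k < m" "l < m"
  shows "dot n (\<rho> m k) (\<phi> m l) = (if l = k then 0 else (a m l - a m k) / (N m k - N m l))"
proof -
  have "dot n (\<rho> m k) (\<phi> m l) = (\<Sum>l'\<in>{..<m} - {k}. (a m l' - a m k) / (N m k - N m l') *
      (if l' = l then 1 else 0))"
    by (subst dot_rho) (use m in \<open>auto simp: phi_supp dot_psi_phi intro!: sum.cong\<close>)
  also have "\<dots> = (if l = k then 0 else (a m l - a m k) / (N m k - N m l))"
    using m by (simp add: if_distrib cong: if_cong)
  finally show ?thesis .
qed

lemma rho_supp: "m \<le> n \<Longrightarrow> m < j \<Longrightarrow> \<rho> m k j = 0"
  by (simp add: rho_def psi_supp)

lemma N_distinct: "m \<le> n \<Longrightarrow> k < m \<Longrightarrow> l < m \<Longrightarrow> k \<noteq> l \<Longrightarrow> N m k \<noteq> N m l"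
  using inj[of m] by (auto simp: inj_on_def)

text \<open>The entry 1 of \<open>\<rho> m k\<close> at position m contributes \<open>a m l\<close>;
  the coefficients in \<open>rho\<close> are made to trade \<open>N m l\<close> and
  \<open>a m l\<close> for \<open>N m k\<close> and \<open>a m k\<close>.\<close>

lemma bil_rho_phi:
  assumes m: "m < n" "k < m" "l < m"
  shows "bil n X (\<rho> m k) (\<phi> m l) = N m k * dot n (\<rho> m k) (\<phi> m l) + a m k"
proof -
  have s: "(\<Sum>j<n. X i j * \<phi> m l j) = (\<Sum>j<m. X i j * \<phi> m l j)" for i
    by (rule sum_supp) (use m phi_supp in auto)
  have "bil n X (\<rho> m k) (\<phi> m l) = (\<Sum>i<Suc m. \<rho> m k i * (\<Sum>j<m. X i j * \<phi> m l j))"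
    unfolding bil_def s by (rule sum_supp) (use m rho_supp in auto)
  also have "\<dots> = (\<Sum>i<m. \<rho> m k i * (N m l * \<phi> m l i)) + a m l"
    using m by (simp add: phi_row coef_def) (simp add: rho_def)
  also have "(\<Sum>i<m. \<rho> m k i * (N m l * \<phi> m l i)) = N m l * (\<Sum>i<m. \<rho> m k i * \<phi> m l i)"
    by (simp add: sum_distrib_left mult_ac)
  also have "(\<Sum>i<m. \<rho> m k i * \<phi> m l i) = dot n (\<rho> m k) (\<phi> m l)"
    unfolding dot_def by (rule sum_supp[symmetric]) (use m phi_supp in auto)
  finally show ?thesis
    using m N_distinct[of m k l] by (simp add: dot_rho_phi divide_simps) (simp add: algebra_simps)
qed

text \<open>Linear extension of \<open>bil_rho_phi\<close> over the basis of eigenvectors. Since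
  every eigenvector ends in 1, the coordinates of \<open>b\<close> in this basis add up to its last
  entry \<open>b (m - 1)\<close>.\<close>

lemma bil_rho:
  assumes m: "m < n" "k < m" and b: "\<And>i. m \<le> i \<Longrightarrow> b i = 0"
  shows "bil n X (\<rho> m k) b = N m k * dot n (\<rho> m k) b + a m k * b (m - 1)"
proof -
  define c where "c l = (\<Sum>j<m. \<psi> m l j * b j)" for l
  have be: "b i = (\<Sum>l<m. c l * \<phi> m l i)" for i
  proof (cases "i < m")
    case True
    then show ?thesis using expand[of m i b] m by (simp add: c_def mult.commute)
  next
    case False
    then have "\<phi> m l i = 0" if "l < m" for l using phi_supp[of m l i] m that by simp
    with b False show ?thesis by simp
  qed
  have "bil n X (\<rho> m k) b = (\<Sum>l<m. c l * bil n X (\<rho> m k) (\<phi> m l))"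
    unfolding bil_alt be sum_distrib_left by (subst sum.swap) (simp add: mult_ac)
  also have "\<dots> = N m k * (\<Sum>l<m. c l * dot n (\<rho> m k) (\<phi> m l)) + a m k * (\<Sum>l<m. c l)"
    unfolding sum_distrib_left sum.distrib[symmetric]
    by (intro sum.cong refl) (simp add: bil_rho_phi m algebra_simps)
  also have "(\<Sum>l<m. c l) = b (m - 1)"
    unfolding be by (intro sum.cong refl) (use m phi_last in auto)
  also have "(\<Sum>l<m. c l * dot n (\<rho> m k) (\<phi> m l)) = dot n (\<rho> m k) b"
    unfolding dot_def be sum_distrib_left by (subst sum.swap) (simp add: mult_ac)
  finally show ?thesis .
qed

section \<open>Brackets of rank one gradients\<close>

definition rank1_bracket :: "(nat \<Rightarrow> complex) \<Rightarrow> (nat \<Rightarrow> complex) \<Rightarrow> (nat \<Rightarrow> complex) \<Rightarrow> (nat \<Rightarrow> complex) \<Rightarrow> complex" where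
  "rank1_bracket p q p' q' = dot n q p' * bil n X q' p - dot n q' p * bil n X q p'"

lemma rank1_bracket_antisym: "rank1_bracket p' q' p q = - rank1_bracket p q p' q'"
  by (simp add: rank1_bracket_def)

text \<open>By antisymmetry let m \<le> m'. Both bilinear forms are then the corresponding pairing
  times the same number \<open>N m' k'\<close>, so the two products cancel.\<close>

lemma rank1_bracket_phi_phi:
  assumes "m \<le> n" "k < m" "m' \<le> n" "k' < m'"
  shows "rank1_bracket (\<phi> m k) (\<psi> m k) (\<phi> m' k') (\<psi> m' k') = 0"
proof -
  have *: "rank1_bracket (\<phi> m k) (\<psi> m k) (\<phi> m' k') (\<psi> m' k') = 0"
    if "m \<le> m'" "m' \<le> n" "k < m" "k' < m'" for m k m' k'
    using that by (simp add: rank1_bracket_def bil_phi bil_psi psi_supp phi_supp)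
  show ?thesis
    using *[of m m' k k'] *[of m' m k' k] assms rank1_bracket_antisym[of "\<phi> m k" "\<psi> m k"]
    by (cases "m \<le> m'") auto
qed

text \<open>If m < m', the row \<open>\<rho> m k\<close> fits into the first m' coordinates and both
  forms carry the factor \<open>N m' k'\<close>. Otherwise both carry \<open>N m k\<close>, and what
  remains is the extra term of \<open>bil_rho\<close>: it contains coordinate m - 1 of
  \<open>\<phi> m' k'\<close>, which is 0 for m' < m and 1 for m' = m.\<close>

lemma rank1_bracket_phi_rho:
  assumes "m' \<le> n" "k' < m'" "m < n" "k < m"
  shows "rank1_bracket (\<phi> m' k') (\<psi> m' k') (\<phi> m k) (\<rho> m k) =
    (if m' = m \<and> k' = k then a m k else 0)"
proof (cases "m < m'")
  case True
  then show ?thesis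
    using assms by (simp add: rank1_bracket_def bil_phi bil_psi rho_supp phi_supp)
next
  case False
  then have "bil n X (\<psi> m' k') (\<phi> m k) = N m k * dot n (\<psi> m' k') (\<phi> m k)"
    using assms by (intro bil_phi) (auto simp: psi_supp)
  moreover have "bil n X (\<rho> m k) (\<phi> m' k') = N m k * dot n (\<rho> m k) (\<phi> m' k') + a m k * \<phi> m' k' (m - 1)"
    using assms False by (intro bil_rho) (auto simp: phi_supp)
  moreover have "\<phi> m' k' (m - 1) = 0" if "m' \<noteq> m"
    using assms False that by (intro phi_supp) auto
  ultimately show ?thesis
    using assms
    by (cases "m' = m") (auto simp: rank1_bracket_def algebra_simps dot_psi_phi phi_last simp del: One_nat_def)
qed

text \<open>For different levels the forms share the eigenvalue of the larger level, and the extra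
  term of \<open>bil_rho\<close> vanishes because the eigenvector of the smaller level ends too
  early.\<close>

lemma rank1_bracket_rho_rho:
  assumes "m < n" "k < m" "m' < n" "k' < m'"
  shows "rank1_bracket (\<phi> m k) (\<rho> m k) (\<phi> m' k') (\<rho> m' k') = 0"
proof -
  have lt: "rank1_bracket (\<phi> m k) (\<rho> m k) (\<phi> m' k') (\<rho> m' k') = 0"
    if "m < n" "m' < m" "k < m" "k' < m'" for m k m' k'
  proof -
    have "bil n X (\<rho> m k) (\<phi> m' k') = N m k * dot n (\<rho> m k) (\<phi> m' k') + a m k * \<phi> m' k' (m - 1)"
      using that by (intro bil_rho) (auto simp: phi_supp)
    moreover have "\<phi> m' k' (m - 1) = 0" using that by (intro phi_supp) auto
    moreover have "bil n X (\<rho> m' k') (\<phi> m k) = N m k * dot n (\<rho> m' k') (\<phi> m k)"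
      using that by (intro bil_phi) (auto simp: rho_supp)
    ultimately show ?thesis by (simp add: rank1_bracket_def)
  qed
  \<comment> \<open>For k different from l both pairings equal D = (a_l - a_k) / (N_k - N_l), and
    the bracket is D (a_l - a_k - (N_k - N_l) D) = 0.\<close>
  have eq: "rank1_bracket (\<phi> m k) (\<rho> m k) (\<phi> m l) (\<rho> m l) = 0"
    if "m < n" "k < m" "l < m" for m k l
    using that N_distinct[of m k l]
    by (simp add: rank1_bracket_def bil_rho_phi dot_rho_phi divide_simps) (simp add: algebra_simps)
  consider "m' < m" | "m' = m" | "m < m'" by linarith
  then show ?thesis
    using lt[of m m' k k'] lt[of m' m k' k] eq[of m k k'] assms
      rank1_bracket_antisym[of "\<phi> m k" "\<rho> m k"]
    by cases auto
qed

end

section \<open>The eigenvalue variety in coordinates\<close>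

definition entry :: "complex mat \<Rightarrow> nat \<Rightarrow> nat \<Rightarrow> complex" where
  "entry x i j = x $$ (i, j)"

text \<open>The index k counts from 0 while the size m counts from 1, so this is nu(k + 1,
  m).\<close>

definition level :: "complex vec \<Rightarrow> nat \<Rightarrow> nat \<Rightarrow> complex" where
  "level \<nu> m k = \<nu> $ (tri (m - 1) + k)"

lemma ul_block_carrier [simp]: "ul_block m x \<in> carrier_mat m m"
  by (simp add: ul_block_def)

lemma eigenvalue_ul_block:
  "eigenvalue (ul_block m x) c \<longleftrightarrow> (\<exists>f. eigvec m (entry x) c f \<and> (\<exists>i<m. f i \<noteq> 0))"
proof
  assume "eigenvalue (ul_block m x) c"
  then obtain v where v: "v \<in> carrier_vec m" "v \<noteq> 0\<^sub>v m" "ul_block m x *\<^sub>v v = c \<cdot>\<^sub>v v"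
    by (auto simp: eigenvalue_def eigenvector_def ul_block_def)
  have "(\<Sum>j<m. entry x i j * v $ j) = c * v $ i" if "i < m" for i
  proof -
    have "(ul_block m x *\<^sub>v v) $ i = (\<Sum>j<m. entry x i j * v $ j)"
      using that v(1) by (auto simp: ul_block_def scalar_prod_def atLeast0LessThan entry_def intro!: sum.cong)
    with v(1,3) that show ?thesis by simp
  qed
  moreover have "\<exists>i<m. v $ i \<noteq> 0"
  proof (rule ccontr)
    assume "\<not> ?thesis"
    then have "v = 0\<^sub>v m" using v(1) by (intro eq_vecI) auto
    with v(2) show False by simp
  qed
  ultimately show "\<exists>f. eigvec m (entry x) c f \<and> (\<exists>i<m. f i \<noteq> 0)"
    unfolding eigvec_def by (intro exI[of _ "\<lambda>i. v $ i"]) simp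
next
  assume "\<exists>f. eigvec m (entry x) c f \<and> (\<exists>i<m. f i \<noteq> 0)"
  then obtain f i where f: "eigvec m (entry x) c f" and i: "i < m" "f i \<noteq> 0" by auto
  have "ul_block m x *\<^sub>v vec m f = c \<cdot>\<^sub>v vec m f"
  proof (rule eq_vecI)
    fix i assume "i < dim_vec (c \<cdot>\<^sub>v vec m f)"
    then have i: "i < m" by simp
    then have "(ul_block m x *\<^sub>v vec m f) $ i = (\<Sum>j<m. entry x i j * f j)"
      by (auto simp: ul_block_def scalar_prod_def atLeast0LessThan entry_def intro!: sum.cong)
    then show "(ul_block m x *\<^sub>v vec m f) $ i = (c \<cdot>\<^sub>v vec m f) $ i"
      using f i by (simp add: eigvec_def)
  qed (simp add: ul_block_def)
  moreover have "vec m f \<noteq> 0\<^sub>v m" using i by (metis index_vec index_zero_vec(1))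
  ultimately have "eigenvector (ul_block m x) (vec m f) c"
    by (simp add: eigenvector_def ul_block_def)
  then show "eigenvalue (ul_block m x) c" unfolding eigenvalue_def by blast
qed

lemma spectrum_ul_block:
  assumes "inj_on c {..<m}" "\<And>k. k < m \<Longrightarrow> eigenvalue (ul_block m x) (c k)"
  shows "spectrum (ul_block m x) = c ` {..<m}"
proof (rule card_seteq[symmetric])
  show "finite (spectrum (ul_block m x))" by (rule card_finite_spectrum(1)[OF ul_block_carrier])
  show "c ` {..<m} \<subseteq> spectrum (ul_block m x)" using assms(2) by (auto simp: spectrum_def)
  show "card (spectrum (ul_block m x)) \<le> card (c ` {..<m})"
    using card_finite_spectrum(2)[of "ul_block m x" m] assms(1) by (simp add: card_image)
qed

lemma nu_entry_level: "nu_entry \<nu> (Suc k) m = level \<nu> m k"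
  by (simp add: nu_entry_def level_def)

lemma similar_imp_eigenvalue:
  assumes "similar_mat (nu_diag \<nu> m) (ul_block m x)" "k < m"
  shows "eigenvalue (ul_block m x) (level \<nu> m k)"
proof -
  have c: "nu_diag \<nu> m \<in> carrier_mat m m" by (simp add: nu_diag_def)
  have "upper_triangular (nu_diag \<nu> m)" by (auto simp: nu_diag_def)
  then have "char_poly (nu_diag \<nu> m) = (\<Prod>a\<leftarrow>diag_mat (nu_diag \<nu> m). [:- a, 1:])"
    using char_poly_upper_triangular[OF c] by simp
  moreover have "level \<nu> m k \<in> set (diag_mat (nu_diag \<nu> m))"
    using assms(2) by (auto simp: diag_mat_def nu_diag_def nu_entry_level intro!: image_eqI[of _ _ k])
  ultimately have "poly (char_poly (nu_diag \<nu> m)) (level \<nu> m k) = 0"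
    by (simp add: linear_poly_root)
  then show ?thesis
    using char_poly_similar[OF assms(1)] eigenvalue_root_char_poly[of "ul_block m x" m] by simp
qed

text \<open>The eigenvectors form the columns of Q and the dual basis the rows of its inverse P;
  then A Q = Q D turns into D = P A Q.\<close>

lemma eigenvalues_imp_similar:
  assumes inj: "inj_on (level \<nu> m) {..<m}"
    and ev: "\<And>k. k < m \<Longrightarrow> eigenvalue (ul_block m x) (level \<nu> m k)"
  shows "similar_mat (nu_diag \<nu> m) (ul_block m x)"
proof -
  let ?A = "ul_block m x" and ?D = "nu_diag \<nu> m"
  obtain f where f: "\<And>k. k < m \<Longrightarrow> eigvec m (entry x) (level \<nu> m k) (f k)"
      "\<And>k. k < m \<Longrightarrow> \<exists>i<m. f k i \<noteq> 0"
    using ev unfolding eigenvalue_ul_block by metis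
  from eigvecs_dual[OF inj f] obtain W where
    W: "\<forall>i<m. \<forall>j<m. (\<Sum>l<m. f l i * W l j) = (if i = j then 1 else 0)"
       "\<forall>i<m. \<forall>j<m. (\<Sum>l<m. W i l * f j l) = (if i = j then 1 else 0)" by blast
  define P where "P = mat m m (\<lambda>(k, i). W k i)"
  define Q where "Q = mat m m (\<lambda>(i, k). f k i)"
  have PQ: "P * Q = 1\<^sub>m m" "Q * P = 1\<^sub>m m"
    using W by (auto simp: P_def Q_def scalar_prod_def atLeast0LessThan)
  have AQ: "?A * Q = Q * ?D"
  proof (rule eq_matI)
    fix i k assume "i < dim_row (Q * ?D)" "k < dim_col (Q * ?D)"
    then have ik: "i < m" "k < m" by (auto simp: Q_def nu_diag_def)
    have "(?A * Q) $$ (i, k) = (\<Sum>j<m. entry x i j * f k j)"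
      using ik by (auto simp: Q_def ul_block_def scalar_prod_def atLeast0LessThan entry_def intro!: sum.cong)
    also have "\<dots> = f k i * level \<nu> m k" using f(1)[OF ik(2)] ik(1) by (simp add: eigvec_def)
    also have "\<dots> = (\<Sum>j<m. f j i * (if j = k then level \<nu> m k else 0))"
      using ik by (simp add: if_distrib cong: if_cong)
    also have "\<dots> = (Q * ?D) $$ (i, k)"
      using ik by (auto simp: Q_def nu_diag_def scalar_prod_def atLeast0LessThan nu_entry_level intro!: sum.cong)
    finally show "(?A * Q) $$ (i, k) = (Q * ?D) $$ (i, k)" .
  qed (auto simp: Q_def nu_diag_def ul_block_def)
  have c: "?A \<in> carrier_mat m m" "?D \<in> carrier_mat m m" "P \<in> carrier_mat m m" "Q \<in> carrier_mat m m"
    by (auto simp: P_def Q_def nu_diag_def)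
  have "?D = P * Q * ?D" using c by (simp add: PQ)
  also have "\<dots> = P * (?A * Q)" using assoc_mult_mat[OF c(3,4,2)] by (simp add: AQ)
  also have "\<dots> = P * ?A * Q" using assoc_mult_mat[OF c(3,1,4)] by simp
  finally have D: "?D = P * ?A * Q" .
  show ?thesis by (rule similar_matI[OF _ PQ D]) (use c in auto)
qed

text \<open>The bridge to \<open>gz\<close>. From right to left, m distinct eigenvalues exhaust the
  spectrum of an m by m block, so the conditions on the spectra of x become conditions on
  nu.\<close>

lemma mem_M_Omega_e:
  "(\<nu>, x) \<in> M_Omega_e n \<longleftrightarrow>
     \<nu> \<in> carrier_vec (tri n) \<and> x \<in> carrier_mat n n \<and> gz n (entry x) (level \<nu>)"
proof
  assume L: "(\<nu>, x) \<in> M_Omega_e n"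
  then have e: "\<nu> \<in> e_Omega n" and sim: "\<And>m. m \<in> {1..n} \<Longrightarrow> similar_mat (nu_diag \<nu> m) (ul_block m x)"
    and carr: "\<nu> \<in> carrier_vec (tri n)" "x \<in> carrier_mat n n"
    by (auto simp: M_Omega_e_def M_Omega_def e_Omega_def)
  have "gz n (entry x) (level \<nu>)"
  proof
    fix m assume m: "m \<le> n"
    show "inj_on (level \<nu> m) {..<m}"
    proof (rule inj_onI, rule ccontr)
      fix k l assume *: "k \<in> {..<m}" "l \<in> {..<m}" "level \<nu> m k = level \<nu> m l" "k \<noteq> l"
      then have "m \<in> {1..n}" "Suc k \<in> {1..m}" "Suc l \<in> {1..m}" "Suc k \<noteq> Suc l" using m by auto
      then have "nu_entry \<nu> (Suc k) m \<noteq> nu_entry \<nu> (Suc l) m"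
        using e unfolding e_Omega_def by blast
      with * show False by (simp add: nu_entry_level)
    qed
    fix k assume "k < m"
    with m show "\<exists>f. eigvec m (entry x) (level \<nu> m k) f \<and> (\<exists>i<m. f i \<noteq> 0)"
      using similar_imp_eigenvalue[OF sim[of m], of k] by (simp add: eigenvalue_ul_block)
  next
    fix m k l assume "m < n" "k < m" "l \<le> m"
    then have "m \<in> {1..n - 1}" "Suc k \<in> {1..m}" "Suc l \<in> {1..m + 1}" by auto
    then have "nu_entry \<nu> (Suc k) m \<noteq> nu_entry \<nu> (Suc l) (m + 1)"
      using e unfolding e_Omega_def by blast
    then show "level \<nu> m k \<noteq> level \<nu> (Suc m) l" by (simp add: nu_entry_level)
  qed
  with carr show "\<nu> \<in> carrier_vec (tri n) \<and> x \<in> carrier_mat n n \<and> gz n (entry x) (level \<nu>)" by simp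
next
  assume R: "\<nu> \<in> carrier_vec (tri n) \<and> x \<in> carrier_mat n n \<and> gz n (entry x) (level \<nu>)"
  then interpret gz n "entry x" "level \<nu>" by simp
  have evl: "eigenvalue (ul_block m x) (level \<nu> m k)" if "m \<le> n" "k < m" for m k
    using ev[OF that] by (simp add: eigenvalue_ul_block)
  have spec: "spectrum (ul_block m x) = level \<nu> m ` {..<m}" if "m \<le> n" for m
    using inj evl that by (intro spectrum_ul_block) auto
  have "nu_entry \<nu> i m \<noteq> nu_entry \<nu> j m" if "m \<in> {1..n}" "i \<in> {1..m}" "j \<in> {1..m}" "i \<noteq> j" for m i j
  proof -
    from that obtain k l where "i = Suc k" "j = Suc l" by (cases i; cases j) auto
    then show ?thesis using that N_distinct[of m k l] by (simp add: nu_entry_level)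
  qed
  moreover have "nu_entry \<nu> i m \<noteq> nu_entry \<nu> j (m + 1)"
    if "m \<in> {1..n - 1}" "i \<in> {1..m}" "j \<in> {1..m + 1}" for m i j
  proof -
    from that obtain k l where "i = Suc k" "j = Suc l" by (cases i; cases j) auto
    then show ?thesis using that sep[of m k l] by (simp add: nu_entry_level)
  qed
  ultimately have "\<nu> \<in> e_Omega n" using R by (simp add: e_Omega_def)
  moreover have "x \<in> M_Omega n"
  proof -
    have "card (spectrum (ul_block m x)) = m" if "m \<in> {1..n}" for m
      using that spec[of m] inj[of m] by (simp add: card_image)
    moreover have "spectrum (ul_block m x) \<inter> spectrum (ul_block (m + 1) x) = {}" if "m \<in> {1..n - 1}" for m
      using that spec[of m] spec[of "Suc m"] sep[of m] by (auto simp: less_Suc_eq_le)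
    ultimately show ?thesis using R by (simp add: M_Omega_def)
  qed
  moreover have "similar_mat (nu_diag \<nu> m) (ul_block m x)" if "m \<in> {1..n}" for m
    using that inj evl by (intro eigenvalues_imp_similar) auto
  ultimately show "(\<nu>, x) \<in> M_Omega_e n" by (simp add: M_Omega_e_def)
qed

section \<open>Regular functions\<close>

lemma regular_on_poly: "f \<in> poly_funs C \<Longrightarrow> regular_on C X f"
  unfolding regular_on_def
  by (intro ballI bexI[of _ f] bexI[of _ "\<lambda>_. 1"]) (auto intro: poly_funs.const)

lemma regular_on_const: "regular_on C X (\<lambda>_. c)"
  by (rule regular_on_poly, rule poly_funs.const)

lemma regular_on_coord: "c \<in> C \<Longrightarrow> regular_on C X c"
  by (rule regular_on_poly, rule poly_funs.coord)

lemma regular_on_cong: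
  assumes "regular_on C X f" "\<And>p. p \<in> X \<Longrightarrow> g p = f p"
  shows "regular_on C X g"
  using assms unfolding regular_on_def by metis

lemma regular_onE:
  assumes "regular_on C X f" "p \<in> X"
  obtains g h where "g \<in> poly_funs C" "h \<in> poly_funs C" "h p \<noteq> 0"
    "\<And>q. q \<in> X \<Longrightarrow> h q \<noteq> 0 \<Longrightarrow> f q = g q / h q"
  using assms unfolding regular_on_def by metis

lemma regular_onI:
  assumes "\<And>p. p \<in> X \<Longrightarrow> \<exists>g\<in>poly_funs C. \<exists>h\<in>poly_funs C. h p \<noteq> 0 \<and> (\<forall>q\<in>X. h q \<noteq> 0 \<longrightarrow> f q = g q / h q)"
  shows "regular_on C X f"
  using assms unfolding regular_on_def by blast

lemma regular_on_add:
  assumes "regular_on C X f" "regular_on C X f'"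
  shows "regular_on C X (\<lambda>p. f p + f' p)"
proof (rule regular_onI)
  fix p assume p: "p \<in> X"
  obtain g h where 1: "g \<in> poly_funs C" "h \<in> poly_funs C" "h p \<noteq> 0"
    "\<And>q. q \<in> X \<Longrightarrow> h q \<noteq> 0 \<Longrightarrow> f q = g q / h q" using regular_onE[OF assms(1) p] by metis
  obtain g' h' where 2: "g' \<in> poly_funs C" "h' \<in> poly_funs C" "h' p \<noteq> 0"
    "\<And>q. q \<in> X \<Longrightarrow> h' q \<noteq> 0 \<Longrightarrow> f' q = g' q / h' q" using regular_onE[OF assms(2) p] by metis
  show "\<exists>G\<in>poly_funs C. \<exists>H\<in>poly_funs C. H p \<noteq> 0 \<and> (\<forall>q\<in>X. H q \<noteq> 0 \<longrightarrow> f q + f' q = G q / H q)"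
    by (intro bexI[of _ "\<lambda>q. g q * h' q + g' q * h q"] bexI[of _ "\<lambda>q. h q * h' q"])
      (use 1 2 in \<open>auto intro: poly_funs.add poly_funs.mult simp: add_divide_distrib\<close>)
qed

lemma regular_on_mult:
  assumes "regular_on C X f" "regular_on C X f'"
  shows "regular_on C X (\<lambda>p. f p * f' p)"
proof (rule regular_onI)
  fix p assume p: "p \<in> X"
  obtain g h where 1: "g \<in> poly_funs C" "h \<in> poly_funs C" "h p \<noteq> 0"
    "\<And>q. q \<in> X \<Longrightarrow> h q \<noteq> 0 \<Longrightarrow> f q = g q / h q" using regular_onE[OF assms(1) p] by metis
  obtain g' h' where 2: "g' \<in> poly_funs C" "h' \<in> poly_funs C" "h' p \<noteq> 0"
    "\<And>q. q \<in> X \<Longrightarrow> h' q \<noteq> 0 \<Longrightarrow> f' q = g' q / h' q" using regular_onE[OF assms(2) p] by metis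
  show "\<exists>G\<in>poly_funs C. \<exists>H\<in>poly_funs C. H p \<noteq> 0 \<and> (\<forall>q\<in>X. H q \<noteq> 0 \<longrightarrow> f q * f' q = G q / H q)"
    by (intro bexI[of _ "\<lambda>q. g q * g' q"] bexI[of _ "\<lambda>q. h q * h' q"])
      (use 1 2 in \<open>auto intro: poly_funs.mult\<close>)
qed

lemma regular_on_inverse:
  assumes "regular_on C X f" "\<And>p. p \<in> X \<Longrightarrow> f p \<noteq> 0"
  shows "regular_on C X (\<lambda>p. inverse (f p))"
proof (rule regular_onI)
  fix p assume p: "p \<in> X"
  obtain g h where 1: "g \<in> poly_funs C" "h \<in> poly_funs C" "h p \<noteq> 0"
    "\<And>q. q \<in> X \<Longrightarrow> h q \<noteq> 0 \<Longrightarrow> f q = g q / h q" using regular_onE[OF assms(1) p] by metis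
  then have "g p \<noteq> 0" using assms(2)[OF p] p by force
  \<comment> \<open>The fraction h / g is expanded by h: its denominator g h is nonzero only where h
    is, and there f = g / h is known.\<close>
  then show "\<exists>G\<in>poly_funs C. \<exists>H\<in>poly_funs C. H p \<noteq> 0 \<and> (\<forall>q\<in>X. H q \<noteq> 0 \<longrightarrow> inverse (f q) = G q / H q)"
    by (intro bexI[of _ "\<lambda>q. h q * h q"] bexI[of _ "\<lambda>q. g q * h q"])
      (use 1 in \<open>auto intro: poly_funs.mult\<close>)
qed

lemma regular_on_divide:
  assumes "regular_on C X f" "regular_on C X g" "\<And>p. p \<in> X \<Longrightarrow> g p \<noteq> 0"
  shows "regular_on C X (\<lambda>p. f p / g p)"
  unfolding divide_inverse by (intro regular_on_mult regular_on_inverse assms)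

lemma regular_on_diff:
  assumes "regular_on C X f" "regular_on C X g"
  shows "regular_on C X (\<lambda>p. f p - g p)"
  using regular_on_add[OF assms(1) regular_on_mult[OF regular_on_const[of _ _ "- 1"] assms(2)]] by simp

lemma regular_on_sum:
  "(\<And>i. i \<in> I \<Longrightarrow> regular_on C X (f i)) \<Longrightarrow> regular_on C X (\<lambda>p. \<Sum>i\<in>I. f i p)"
  by (induction I rule: infinite_finite_induct) (auto intro: regular_on_const regular_on_add)

lemma regular_on_prod:
  "(\<And>i. i \<in> I \<Longrightarrow> regular_on C X (f i)) \<Longrightarrow> regular_on C X (\<lambda>p. \<Prod>i\<in>I. f i p)"
  by (induction I rule: infinite_finite_induct) (auto intro: regular_on_const regular_on_mult)

lemma regular_on_det:
  assumes "\<And>i j. i < k \<Longrightarrow> j < k \<Longrightarrow> regular_on C X (\<lambda>p. A p i j)"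
  shows "regular_on C X (\<lambda>p. det (mat k k (\<lambda>(i, j). A p i j)))"
proof -
  have "det (mat k k (\<lambda>(i, j). A p i j)) =
      (\<Sum>\<pi>\<in>{\<pi>. \<pi> permutes {0..<k}}. signof \<pi> * (\<Prod>i = 0..<k. A p i (\<pi> i)))" for p
    by (subst det_def'[of _ k]) (auto intro!: sum.cong prod.cong dest: permutes_in_image)
  then show ?thesis
    by (simp only:) (intro regular_on_sum regular_on_mult regular_on_prod regular_on_const assms,
      auto dest: permutes_in_image)
qed

lemma regular_on_adj_mat:
  assumes A: "\<And>i j. i < k \<Longrightarrow> j < k \<Longrightarrow> regular_on C X (\<lambda>p. A p i j)" and ij: "i < k" "j < k"
  shows "regular_on C X (\<lambda>p. adj_mat (mat k k (\<lambda>(i, j). A p i j)) $$ (i, j))"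
proof -
  have "mat_delete (mat k k (\<lambda>(i, j). A p i j)) j i = mat (k - 1) (k - 1) (\<lambda>(i', j').
      A p (if i' < j then i' else Suc i') (if j' < i then j' else Suc j'))" for p
    unfolding mat_delete_def by (rule eq_matI) auto
  then have "adj_mat (mat k k (\<lambda>(i, j). A p i j)) $$ (i, j) = (- 1) ^ (j + i) *
      det (mat (k - 1) (k - 1) (\<lambda>(i', j'). A p (if i' < j then i' else Suc i') (if j' < i then j' else Suc j')))" for p
    using ij by (simp add: adj_mat_def cofactor_def)
  then show ?thesis
    by (simp only:) (intro regular_on_mult regular_on_const regular_on_det A, auto)
qed

text \<open>Cramer's rule with parameters. A function is shown to be regular by exhibiting a
  uniquely solvable linear system with regular coefficients of which it is a component of the
  solution.\<close>

lemma regular_on_solve: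
  fixes A :: "'a \<Rightarrow> nat \<Rightarrow> nat \<Rightarrow> complex" and k :: nat
  assumes A: "\<And>i j. i < k \<Longrightarrow> j < k \<Longrightarrow> regular_on C X (\<lambda>p. A p i j)"
    and b: "\<And>i. i < k \<Longrightarrow> regular_on C X (\<lambda>p. b p i)"
    and inj: "\<And>p y. p \<in> X \<Longrightarrow> (\<forall>i<k. (\<Sum>j<k. A p i j * y j) = 0) \<Longrightarrow> \<forall>j<k. y j = 0"
    and y: "\<And>p i. p \<in> X \<Longrightarrow> i < k \<Longrightarrow> (\<Sum>j<k. A p i j * y p j) = b p i"
    and j: "j < k"
  shows "regular_on C X (\<lambda>p. y p j)"
proof (rule regular_on_cong)
  let ?M = "\<lambda>p. mat k k (\<lambda>(i, j). A p i j)"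
  have det: "det (?M p) \<noteq> 0" if "p \<in> X" for p
    by (rule inj_imp_det_nonzero) (use inj[OF that] in blast)
  then show "regular_on C X (\<lambda>p. \<Sum>i<k. adj_mat (?M p) $$ (j, i) / det (?M p) * b p i)"
    by (intro regular_on_sum regular_on_mult regular_on_divide regular_on_adj_mat regular_on_det A b j) auto
  fix p assume p: "p \<in> X"
  show "y p j = (\<Sum>i<k. adj_mat (?M p) $$ (j, i) / det (?M p) * b p i)"
    by (rule left_inverse_solve[where A = "A p" and W = "\<lambda>i j. adj_mat (?M p) $$ (i, j) / det (?M p)"])
      (use adj_mat_inverse(2)[OF det[OF p]] y[OF p] j in auto)
qed

lemma poly_funs_tendsto:
  assumes "f \<in> poly_funs C" "\<And>c. c \<in> C \<Longrightarrow> ((\<lambda>t. c (\<gamma> t)) \<longlongrightarrow> c p) F"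
  shows "((\<lambda>t. f (\<gamma> t)) \<longlongrightarrow> f p) F"
  using assms(1) by induction (auto intro: tendsto_intros assms(2))

text \<open>An arbitrary filter and path allow two uses: continuity in the Euclidean topology, and
  limits of difference quotients along lifted lines.\<close>

lemma regular_on_tendsto:
  assumes f: "regular_on C X f" and c: "\<And>c. c \<in> C \<Longrightarrow> ((\<lambda>t. c (\<gamma> t)) \<longlongrightarrow> c p) F"
    and p: "p \<in> X" "\<forall>\<^sub>F t in F. \<gamma> t \<in> X"
  shows "((\<lambda>t. f (\<gamma> t)) \<longlongrightarrow> f p) F"
proof -
  obtain g h where 1: "g \<in> poly_funs C" "h \<in> poly_funs C" "h p \<noteq> 0"
    "\<And>q. q \<in> X \<Longrightarrow> h q \<noteq> 0 \<Longrightarrow> f q = g q / h q" using regular_onE[OF f p(1)] by metis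
  have h: "((\<lambda>t. h (\<gamma> t)) \<longlongrightarrow> h p) F" by (rule poly_funs_tendsto[OF 1(2) c])
  have "((\<lambda>t. g (\<gamma> t) / h (\<gamma> t)) \<longlongrightarrow> g p / h p) F"
    by (intro tendsto_divide poly_funs_tendsto[OF 1(1) c] h 1(3))
  moreover have "\<forall>\<^sub>F t in F. g (\<gamma> t) / h (\<gamma> t) = f (\<gamma> t)"
    using p(2) tendsto_imp_eventually_ne[OF h 1(3)] by eventually_elim (simp add: 1(4))
  ultimately show ?thesis using 1(3,4) p(1) by (simp add: tendsto_cong)
qed

section \<open>The Euclidean topology\<close>

lemma topspace_euclid: "C \<noteq> {} \<Longrightarrow> topspace (euclid_topology C X) = X"
  unfolding euclid_topology_def topology_generated_by_topspace by auto

lemma continuous_map_coord: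
  assumes "c \<in> C"
  shows "continuous_map (euclid_topology C X) euclidean c"
proof -
  have "topspace (euclid_topology C X) = X" using assms by (intro topspace_euclid) auto
  then show ?thesis
    using assms unfolding continuous_map_def
    by (auto simp: euclid_topology_def intro!: topology_generated_by_Basis)
qed

lemma continuous_map_regular:
  assumes f: "regular_on C X f" and C: "C \<noteq> {}"
  shows "continuous_map (euclid_topology C X) euclidean f"
  unfolding continuous_map_atin limitin_canonical_iff topspace_euclid[OF C]
proof
  fix p assume p: "p \<in> X"
  show "(f \<longlongrightarrow> f p) (atin (euclid_topology C X) p)"
  proof (rule regular_on_tendsto[OF f])
    show "(c \<longlongrightarrow> c p) (atin (euclid_topology C X) p)" if "c \<in> C" for c
      using continuous_map_coord[OF that, of X] p C
      unfolding continuous_map_atin limitin_canonical_iff topspace_euclid[OF C] by simp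
    show "\<forall>\<^sub>F t in atin (euclid_topology C X) p. t \<in> X"
      unfolding eventually_atin using openin_topspace[of "euclid_topology C X"] p
      by (auto simp: topspace_euclid[OF C] intro!: exI[of _ X])
  qed (use p in auto)
qed

lemma continuous_map_into_euclid:
  assumes "\<And>p. p \<in> topspace T \<Longrightarrow> \<sigma> p \<in> X"
    and "\<And>c. c \<in> C \<Longrightarrow> continuous_map T euclidean (c \<circ> \<sigma>)" and C: "C \<noteq> {}"
  shows "continuous_map T (euclid_topology C X) \<sigma>"
  unfolding euclid_topology_def
proof (rule continuous_on_generated_topo)
  fix U assume "U \<in> {{p \<in> X. c p \<in> V} |c V. c \<in> C \<and> open V}"
  then obtain c V where cV: "c \<in> C" "open V" "U = {p \<in> X. c p \<in> V}" by auto
  then have "\<sigma> -` U \<inter> topspace T = {p \<in> topspace T. (c \<circ> \<sigma>) p \<in> V}"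
    using assms(1) by auto
  also have "openin T \<dots>"
    using assms(2)[OF cV(1)] cV(2) by (auto simp: continuous_map_def)
  finally show "openin T (\<sigma> -` U \<inter> topspace T)" .
next
  show "\<sigma> ` topspace T \<subseteq> \<Union> {{p \<in> X. c p \<in> V} |c V. c \<in> C \<and> open V}"
    using assms(1) C by (auto intro!: exI[of _ UNIV])
qed

section \<open>Indexing by levels\<close>

lemma tri_0 [simp]: "tri 0 = 0"
  by (simp add: tri_def)

lemma tri_Suc: "tri (Suc m) = tri m + Suc m"
  by (simp add: tri_def)

lemma tri_mono: "m \<le> m' \<Longrightarrow> tri m \<le> tri m'"
  unfolding tri_def by (intro div_le_mono mult_le_mono) auto

lemma tri_pred: "0 < m \<Longrightarrow> tri m = tri (m - 1) + m"
  by (cases m) (simp_all add: tri_Suc)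

lemma tri_index_less: "m \<le> n \<Longrightarrow> k < m \<Longrightarrow> tri (m - 1) + k < tri n"
  using tri_mono[of m n] tri_pred[of m] by simp

lemma tri_index_ex: "i < tri n \<Longrightarrow> \<exists>m k. m \<le> n \<and> k < m \<and> i = tri (m - 1) + k"
proof (induction n)
  case (Suc n)
  show ?case
  proof (cases "i < tri n")
    case True
    then show ?thesis using Suc.IH by (meson le_SucI)
  next
    case False
    then show ?thesis using Suc.prems
      by (intro exI[of _ "Suc n"] exI[of _ "i - tri n"]) (auto simp: tri_Suc)
  qed
qed simp

lemma tri_index_unique:
  assumes "k < m" "k' < m'" "tri (m - 1) + k = tri (m' - 1) + k'"
  shows "m = m' \<and> k = k'"
proof -
  have "\<not> m < m'" if "k < m" "k' < m'" "tri (m - 1) + k = tri (m' - 1) + k'" for m m' k k'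
  proof
    assume "m < m'"
    then have "tri m \<le> tri (m' - 1)" by (intro tri_mono) simp
    with that tri_pred[of m] show False by linarith
  qed
  from this[of k m k' m'] this[of k' m' k m] assms have "m = m'" by auto
  with assms show ?thesis by simp
qed

text \<open>The inverse of the numbering (m, k) -> tri(m - 1) + k is taken by choice;
  \<open>tri_index_unique\<close> shows that the choice is forced.\<close>

definition of_levels :: "nat \<Rightarrow> (nat \<Rightarrow> nat \<Rightarrow> complex) \<Rightarrow> complex vec" where
  "of_levels n f = vec (tri n)
     (\<lambda>i. case SOME p. snd p < fst p \<and> i = tri (fst p - 1) + snd p of (m, k) \<Rightarrow> f m k)"

lemma of_levels_carrier [simp]: "of_levels n f \<in> carrier_vec (tri n)"
  by (simp add: of_levels_def)

lemma level_of_levels: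
  assumes "m \<le> n" "k < m"
  shows "level (of_levels n f) m k = f m k"
proof -
  let ?P = "\<lambda>p. snd p < fst p \<and> tri (m - 1) + k = tri (fst p - 1) + snd p"
  have "?P (m, k)" using assms by simp
  then have "?P (SOME p. ?P p)" by (rule someI)
  moreover obtain m' k' where "(SOME p. ?P p) = (m', k')" by (cases "SOME p. ?P p")
  ultimately have "(SOME p. ?P p) = (m, k)"
    using tri_index_unique[OF assms(2), of k' m'] by simp
  then show ?thesis
    using tri_index_less[OF assms] by (simp add: level_def of_levels_def)
qed

lemma levels_eqI:
  assumes "\<nu> \<in> carrier_vec (tri n)" "\<nu>' \<in> carrier_vec (tri n)"
    and "\<And>m k. m \<le> n \<Longrightarrow> k < m \<Longrightarrow> level \<nu> m k = level \<nu>' m k"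
  shows "\<nu> = \<nu>'"
proof (rule eq_vecI)
  fix i assume "i < dim_vec \<nu>'"
  then obtain m k where "m \<le> n" "k < m" "i = tri (m - 1) + k"
    using tri_index_ex[of i n] assms(2) by auto
  then show "\<nu> $ i = \<nu>' $ i" using assms(3)[of m k] by (simp add: level_def)
qed (use assms in auto)

lemma gz_cong:
  assumes "gz n X N" "\<And>i j. i < n \<Longrightarrow> j < n \<Longrightarrow> X i j = Y i j"
    "\<And>m k. m \<le> n \<Longrightarrow> k < m \<Longrightarrow> N m k = N' m k"
  shows "gz n Y N'"
proof -
  interpret gz n X N by fact
  show ?thesis
  proof
    fix m assume m: "m \<le> n"
    show "inj_on (N' m) {..<m}"
      using inj[OF m] assms(3)[OF m] by (auto simp: inj_on_def)
    fix k assume "k < m"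
    then show "\<exists>f. eigvec m Y (N' m k) f \<and> (\<exists>i<m. f i \<noteq> 0)"
      using ev[OF m, of k] eigvec_cong[of m X Y] assms(2) m assms(3)[OF m, of k] by auto
  next
    fix m k l assume "m < n" "k < m" "l \<le> m"
    then show "N' m k \<noteq> N' (Suc m) l" using sep[of m k l] assms(3) by simp
  qed
qed

lemma entry_mat_coord: "i < n \<Longrightarrow> j < n \<Longrightarrow> (\<lambda>x. entry x i j) \<in> mat_coords n"
  unfolding mat_coords_def entry_def by fastforce

lemma mat_coords_nonempty: "1 \<le> n \<Longrightarrow> mat_coords n \<noteq> {}"
  using entry_mat_coord[of 0 n 0] by auto

lemma point_coords_nonempty: "1 \<le> n \<Longrightarrow> point_coords n \<noteq> {}"
  using mat_coords_nonempty by (auto simp: point_coords_def)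

lemma level_coord: "m \<le> n \<Longrightarrow> k < m \<Longrightarrow> (\<lambda>z. level (fst z) m k) \<in> point_coords n"
  unfolding point_coords_def vec_coords_def level_def comp_def using tri_index_less by fastforce

lemma entry_coord: "i < n \<Longrightarrow> j < n \<Longrightarrow> (\<lambda>z. entry (snd z) i j) \<in> point_coords n"
  unfolding point_coords_def mat_coords_def entry_def comp_def by fastforce

lemma point_coords_cases:
  assumes "c \<in> point_coords n"
  obtains m k where "m \<le> n" "k < m" "c = (\<lambda>z. level (fst z) m k)"
  | i j where "i < n" "j < n" "c = (\<lambda>z. entry (snd z) i j)"
proof -
  from assms consider i where "i < tri n" "c = (\<lambda>z. fst z $ i)"
    | i j where "i < n" "j < n" "c = (\<lambda>z. snd z $$ (i, j))"
    unfolding point_coords_def vec_coords_def mat_coords_def comp_def by blast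
  then show ?thesis
  proof cases
    case (1 i)
    then obtain m k where "m \<le> n" "k < m" "i = tri (m - 1) + k" using tri_index_ex by blast
    with 1 show ?thesis by (intro that(1)[of m k]) (auto simp: level_def)
  next
    case (2 i j)
    then show ?thesis by (intro that(2)[of i j]) (auto simp: entry_def)
  qed
qed

section \<open>Local sections\<close>

definition chp :: "nat \<Rightarrow> complex mat \<Rightarrow> complex \<Rightarrow> complex" where
  "chp m x c = det (mat m m (\<lambda>(i, j). (if i = j then c else 0) - entry x i j))"

lemma chp_poly: "chp m x c = poly (char_poly (ul_block m x)) c"
proof -
  have "- char_matrix (ul_block m x) c = mat m m (\<lambda>(i, j). (if i = j then c else 0) - entry x i j)"
    by (rule eq_matI) (auto simp: char_matrix_def ul_block_def entry_def)
  then show ?thesis by (simp add: chp_def char_poly_matrix[of _ m])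
qed

lemma chp_eigenvalue: "eigenvalue (ul_block m x) c \<longleftrightarrow> chp m x c = 0"
  by (simp add: chp_poly eigenvalue_root_char_poly[of _ m])

text \<open>The value of the characteristic polynomial at c is the product of m differences between
  c and its roots, so they cannot all have norm at least \<delta>.\<close>

lemma eigenvalue_near:
  assumes "norm (chp m x c) < \<delta> ^ m" "0 < \<delta>"
  shows "\<exists>\<mu>. eigenvalue (ul_block m x) \<mu> \<and> norm (c - \<mu>) < \<delta>"
proof (rule ccontr)
  assume no: "\<not> ?thesis"
  obtain as where as: "char_poly (ul_block m x) = (\<Prod>a\<leftarrow>as. [:- a, 1:])" "length as = m"
    using char_poly_factorized[of "ul_block m x" m] by auto
  have "\<delta> \<le> norm (c - a)" if "a \<in> set as" for a
  proof -
    have "eigenvalue (ul_block m x) a"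
      using that as(1) by (simp add: chp_eigenvalue chp_poly linear_poly_root)
    with no show ?thesis by force
  qed
  then have "\<delta> ^ length as \<le> norm (poly (\<Prod>a\<leftarrow>as. [:- a, 1:]) c)"
  proof (induction as)
    case (Cons a as)
    then have "\<delta> * \<delta> ^ length as \<le> norm (c - a) * norm (poly (\<Prod>a\<leftarrow>as. [:- a, 1:]) c)"
      using assms(2) by (intro mult_mono) auto
    moreover have "poly (\<Prod>a\<leftarrow>a # as. [:- a, 1:]) c = (c - a) * poly (\<Prod>a\<leftarrow>as. [:- a, 1:]) c"
      by (simp add: algebra_simps)
    ultimately show ?case by (simp add: norm_mult)
  qed simp
  then show False using assms(1) as by (simp add: chp_poly)
qed

lemma regular_on_chp:
  assumes "m \<le> n"
  shows "regular_on (mat_coords n) X (\<lambda>x. chp m x c)"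
  unfolding chp_def
proof (rule regular_on_det)
  fix i j assume "i < m" "j < m"
  then have "(\<lambda>x. entry x i j) \<in> mat_coords n" using assms by (intro entry_mat_coord) auto
  then show "regular_on (mat_coords n) X (\<lambda>x. (if i = j then c else 0) - entry x i j)"
    by (intro regular_on_diff regular_on_const regular_on_coord)
qed

lemma finite_separated:
  assumes "finite S"
  shows "\<exists>\<epsilon>>0. \<forall>a\<in>S. \<forall>b\<in>S. a \<noteq> b \<longrightarrow> 2 * \<epsilon> \<le> norm (a - b :: complex)"
proof -
  \<comment> \<open>The element 1 keeps the minimum meaningful when S has at most one point.\<close>
  define D where "D = insert 1 ((\<lambda>(a, b). norm (a - b)) ` {p \<in> S \<times> S. fst p \<noteq> snd p})"
  have D: "finite D" "D \<noteq> {}" using assms by (auto simp: D_def)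
  have "0 < Min D" using D by (subst Min_gr_iff) (auto simp: D_def)
  moreover have "Min D \<le> norm (a - b)" if "a \<in> S" "b \<in> S" "a \<noteq> b" for a b
    by (rule Min_le[OF D(1)]) (use that in \<open>auto simp: D_def intro!: image_eqI[of _ _ "(a, b)"]\<close>)
  ultimately show ?thesis by (intro exI[of _ "Min D / 2"]) auto
qed

text \<open>Near x each eigenvalue of a block stays close to exactly one eigenvalue of the
  corresponding block of x, and the section sends x' to these nearby values. Their continuity
  follows from that uniqueness together with \<open>eigenvalue_near\<close>.\<close>

lemma local_section_exists:
  assumes n: "1 \<le> n" and z: "z \<in> M_Omega_e n"
  shows "\<exists>\<sigma>. local_section n z \<sigma>"
proof -
  obtain \<nu> x where zz: "z = (\<nu>, x)" by (cases z)
  have \<nu>: "\<nu> \<in> carrier_vec (tri n)" and x: "x \<in> carrier_mat n n"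
    and gz: "gz n (entry x) (level \<nu>)" using z by (auto simp: zz mem_M_Omega_e)
  interpret gz n "entry x" "level \<nu>" by fact
  let ?T = "euclid_topology (mat_coords n) (carrier_mat n n)"
  have T: "topspace ?T = carrier_mat n n" by (rule topspace_euclid[OF mat_coords_nonempty[OF n]])
  define I where "I = (SIGMA m:{..n}. {..<m})"
  have I: "finite I" "I \<noteq> {}" using n by (auto simp: I_def intro!: exI[of _ 1])
  \<comment> \<open>Different numbers among the eigenvalues of all levels are at least 2 \<epsilon>
    apart, so discs of radius \<epsilon> around them are disjoint.\<close>
  obtain \<epsilon> where \<epsilon>: "\<epsilon> > 0" "\<And>m k m' k'. m \<le> n \<Longrightarrow> k < m \<Longrightarrow> m' \<le> n \<Longrightarrow> k' < m' \<Longrightarrow>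
      level \<nu> m k \<noteq> level \<nu> m' k' \<Longrightarrow> 2 * \<epsilon> \<le> norm (level \<nu> m k - level \<nu> m' k')"
    using finite_separated[of "(\<lambda>(m, k). level \<nu> m k) ` I"] I(1)
    by (force simp: I_def)
  \<comment> \<open>On this set \<open>eigenvalue_near\<close> gives, for every level and index, an
    eigenvalue of x' within \<epsilon> of the one of x.\<close>
  define U where "U = (\<Inter>p\<in>I. {x' \<in> topspace ?T. chp (fst p) x' (level \<nu> (fst p) (snd p)) \<in> {w. norm w < \<epsilon> ^ fst p}})"
  have U_iff: "x' \<in> U \<longleftrightarrow> x' \<in> carrier_mat n n \<and> (\<forall>m k. m \<le> n \<longrightarrow> k < m \<longrightarrow>
      norm (chp m x' (level \<nu> m k)) < \<epsilon> ^ m)" for x'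
    using I(2) by (auto simp: U_def T I_def)
  have "openin ?T U" unfolding U_def
    by (intro openin_INT2 I openin_continuous_map_preimage[where Y = euclidean]
        continuous_map_regular mat_coords_nonempty n regular_on_chp)
      (auto simp: I_def intro!: open_Collect_less continuous_intros)
  define lam where "lam x' m k = (SOME \<mu>. eigenvalue (ul_block m x') \<mu> \<and> norm (level \<nu> m k - \<mu>) < \<epsilon>)" for x' m k
  have lam: "eigenvalue (ul_block m x') (lam x' m k)" "norm (level \<nu> m k - lam x' m k) < \<epsilon>"
    if "x' \<in> U" "m \<le> n" "k < m" for x' m k
  proof -
    have "norm (chp m x' (level \<nu> m k)) < \<epsilon> ^ m" using that by (simp add: U_iff)
    from someI_ex[OF eigenvalue_near[OF this \<epsilon>(1)]]
    show "eigenvalue (ul_block m x') (lam x' m k)" "norm (level \<nu> m k - lam x' m k) < \<epsilon>"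
      unfolding lam_def by auto
  qed
  have lam_neq: "lam x' m k \<noteq> lam x' m' k'"
    if "x' \<in> U" "m \<le> n" "k < m" "m' \<le> n" "k' < m'" "level \<nu> m k \<noteq> level \<nu> m' k'" for x' m k m' k'
  proof
    assume eq: "lam x' m k = lam x' m' k'"
    have "norm (level \<nu> m k - level \<nu> m' k') < 2 * \<epsilon>"
      using lam(2)[OF that(1-3)] lam(2)[OF that(1,4,5)] eq
        norm_triangle_ineq4[of "level \<nu> m k - lam x' m k" "level \<nu> m' k' - lam x' m' k'"] by simp
    with \<epsilon>(2)[OF that(2-6)] show False by simp
  qed
  have gz_lam: "gz n (entry x') (lam x')" if x': "x' \<in> U" for x'
  proof
    fix m assume m: "m \<le> n"
    show "inj_on (lam x' m) {..<m}"
      using lam_neq[OF x' m _ m] N_distinct[OF m] by (auto simp: inj_on_def)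
    fix k assume "k < m"
    then show "\<exists>f. eigvec m (entry x') (lam x' m k) f \<and> (\<exists>i<m. f i \<noteq> 0)"
      using lam(1)[OF x' m] by (simp add: eigenvalue_ul_block)
  next
    fix m k l assume "m < n" "k < m" "l \<le> m"
    then show "lam x' m k \<noteq> lam x' (Suc m) l"
      using sep[of m k l] by (intro lam_neq[OF x']) auto
  qed
  have lam_unique: "\<mu> = lam x' m k"
    if "x' \<in> U" "m \<le> n" "k < m" and \<mu>: "eigenvalue (ul_block m x') \<mu>" "norm (level \<nu> m k - \<mu>) < \<epsilon>" for x' m k \<mu>
  proof -
    have "spectrum (ul_block m x') = lam x' m ` {..<m}"
      using gz.inj[OF gz_lam[OF that(1)] that(2)] lam(1)[OF that(1,2)] by (rule spectrum_ul_block)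
    then obtain l where l: "l < m" "\<mu> = lam x' m l" using \<mu>(1) by (auto simp: spectrum_def)
    have "norm (level \<nu> m k - level \<nu> m l) < 2 * \<epsilon>"
      using \<mu>(2) lam(2)[OF that(1,2) l(1)] l(2)
        norm_triangle_ineq4[of "level \<nu> m k - \<mu>" "level \<nu> m l - \<mu>"] by simp
    then have "level \<nu> m k = level \<nu> m l" using \<epsilon>(2)[OF that(2,3,2) l(1)] by force
    then show ?thesis using N_distinct[OF that(2,3) l(1)] l(2) by auto
  qed
  define \<sigma> where "\<sigma> x' = (of_levels n (lam x'), x')" for x'
  have \<sigma>_in: "\<sigma> x' \<in> M_Omega_e n" if "x' \<in> U" for x'
    unfolding \<sigma>_def mem_M_Omega_e
    using gz_cong[OF gz_lam[OF that], of "entry x'" "level (of_levels n (lam x'))"] that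
    by (auto simp: level_of_levels U_iff)
  have lev_ev: "eigenvalue (ul_block m x) (level \<nu> m k)" if "m \<le> n" "k < m" for m k
    using ev[OF that] by (simp add: eigenvalue_ul_block)
  have xU: "x \<in> U" using x lev_ev \<epsilon>(1) by (auto simp: U_iff chp_eigenvalue)
  have \<sigma>x: "\<sigma> x = z" unfolding \<sigma>_def zz
    using lam_unique[OF xU _ _ lev_ev] \<epsilon>(1)
    by (auto intro!: levels_eqI[OF _ \<nu>] simp: level_of_levels)
  have top: "topspace (subtopology ?T U) = U"
    using openin_subset[OF \<open>openin ?T U\<close>] by auto
  have "continuous_map (subtopology ?T U) (euclid_topology (point_coords n) (M_Omega_e n)) \<sigma>"
  proof (rule continuous_map_into_euclid)
    show "\<sigma> p \<in> M_Omega_e n" if "p \<in> topspace (subtopology ?T U)" for p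
      using \<sigma>_in that top by simp
    show "point_coords n \<noteq> {}" by (rule point_coords_nonempty[OF n])
    fix c assume "c \<in> point_coords n"
    then show "continuous_map (subtopology ?T U) euclidean (c \<circ> \<sigma>)"
    proof (cases rule: point_coords_cases)
      case (1 m k)
      have c: "(c \<circ> \<sigma>) x' = lam x' m k" for x' using 1 by (simp add: \<sigma>_def level_of_levels)
      show ?thesis unfolding continuous_map_atin limitin_canonical_iff top
      proof (intro ballI tendstoI)
        fix y and e :: real assume y: "y \<in> U" and e: "e > 0"
        let ?F = "atin (subtopology ?T U) y"
        \<comment> \<open>An eigenvalue of x' within \<delta> of \<open>lam y m k\<close> is also
          within \<epsilon> of \<open>level \<nu> m k\<close>, hence it must be
          \<open>lam x' m k\<close>.\<close>
        define \<delta> where "\<delta> = min e (\<epsilon> - norm (level \<nu> m k - lam y m k))"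
        have \<delta>: "\<delta> > 0" using e lam(2)[OF y 1(1,2)] by (simp add: \<delta>_def)
        have "continuous_map (subtopology ?T U) euclidean (\<lambda>x'. chp m x' (lam y m k))"
          by (intro continuous_map_from_subtopology continuous_map_regular mat_coords_nonempty n
              regular_on_chp 1)
        then have "((\<lambda>x'. chp m x' (lam y m k)) \<longlongrightarrow> chp m y (lam y m k)) ?F"
          using y unfolding continuous_map_atin limitin_canonical_iff top by blast
        then have "((\<lambda>x'. chp m x' (lam y m k)) \<longlongrightarrow> 0) ?F"
          using lam(1)[OF y 1(1,2)] by (simp add: chp_eigenvalue)
        then have ev0: "\<forall>\<^sub>F x' in ?F. norm (chp m x' (lam y m k)) < \<delta> ^ m"
          using \<delta> by (auto dest!: tendstoD[where e = "\<delta> ^ m"])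
        have evU: "\<forall>\<^sub>F x' in ?F. x' \<in> U"
          unfolding eventually_atin using openin_topspace[of "subtopology ?T U"] y top by auto
        from ev0 evU show "\<forall>\<^sub>F x' in ?F. dist ((c \<circ> \<sigma>) x') ((c \<circ> \<sigma>) y) < e"
        proof eventually_elim
          case (elim x')
          obtain \<mu> where \<mu>: "eigenvalue (ul_block m x') \<mu>" "norm (lam y m k - \<mu>) < \<delta>"
            using eigenvalue_near[OF elim(1) \<delta>] by auto
          have "norm (level \<nu> m k - \<mu>) < \<epsilon>"
            using \<mu>(2) norm_triangle_ineq[of "level \<nu> m k - lam y m k" "lam y m k - \<mu>"]
            by (simp add: \<delta>_def)
          then have "\<mu> = lam x' m k" by (rule lam_unique[OF elim(2) 1(1,2) \<mu>(1)])
          then show ?case unfolding c using \<mu>(2) by (simp add: \<delta>_def dist_norm norm_minus_commute)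
        qed
      qed
    next
      case (2 i j)
      have "continuous_map ?T euclidean (\<lambda>x. entry x i j)"
        by (intro continuous_map_coord entry_mat_coord 2)
      then show ?thesis by (simp add: 2 \<sigma>_def comp_def continuous_map_from_subtopology)
    qed
  qed
  then show ?thesis
    unfolding local_section_def
    using \<open>openin ?T U\<close> xU \<sigma>x by (intro exI[of _ \<sigma>] conjI exI[of _ U]) (auto simp: zz \<sigma>_def)
qed

text \<open>The section used in \<open>bracket\<close> is known only through
  \<open>local_section\<close>. Its domain U is open, so the line x + t v stays in U for small t,
  and the section can be composed with this line.\<close>

lemma local_section_path:
  assumes n: "1 \<le> n" and z: "z \<in> M_Omega_e n" and \<sigma>: "local_section n z \<sigma>" and v: "v \<in> carrier_mat n n"
  shows "\<forall>\<^sub>F t in at 0. \<sigma> (snd z + t \<cdot>\<^sub>m v) \<in> M_Omega_e n \<and> snd (\<sigma> (snd z + t \<cdot>\<^sub>m v)) = snd z + t \<cdot>\<^sub>m v"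
    and "c \<in> point_coords n \<Longrightarrow> ((\<lambda>t. c (\<sigma> (snd z + t \<cdot>\<^sub>m v))) \<longlongrightarrow> c z) (at 0)"
proof -
  let ?T = "euclid_topology (mat_coords n) (carrier_mat n n)"
  let ?E = "euclid_topology (point_coords n) (M_Omega_e n)"
  obtain U where U: "openin ?T U" "snd z \<in> U" "\<And>x. x \<in> U \<Longrightarrow> snd (\<sigma> x) = x"
      "continuous_map (subtopology ?T U) ?E \<sigma>" and \<sigma>z: "\<sigma> (snd z) = z"
    using \<sigma> unfolding local_section_def by blast
  define g where "g t = snd z + t \<cdot>\<^sub>m v" for t
  have x: "snd z \<in> carrier_mat n n" using z by (cases z) (auto simp: mem_M_Omega_e)
  have g0: "g 0 = snd z" unfolding g_def using x v by (intro eq_matI) auto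
  have g: "continuous_map euclidean ?T g"
  proof (rule continuous_map_into_euclid)
    show "g t \<in> carrier_mat n n" for t using x v by (simp add: g_def)
    show "mat_coords n \<noteq> {}" by (rule mat_coords_nonempty[OF n])
    fix c assume "c \<in> mat_coords n"
    then obtain i j where ij: "i < n" "j < n" "c = (\<lambda>x. x $$ (i, j))" by (auto simp: mat_coords_def)
    then have "c \<circ> g = (\<lambda>t. snd z $$ (i, j) + t * v $$ (i, j))" using x v by (auto simp: g_def)
    then show "continuous_map euclidean euclidean (c \<circ> g)"
      by (simp add: continuous_intros)
  qed
  define W where "W = {t. g t \<in> U}"
  have W: "open W" "0 \<in> W"
    using openin_continuous_map_preimage[OF g U(1)] U(2) g0 by (auto simp: W_def)
  have "continuous_map (top_of_set W) (subtopology ?T U) g"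
    using continuous_map_from_subtopology[OF g] by (auto simp: continuous_map_in_subtopology W_def)
  then have \<sigma>g: "continuous_map (top_of_set W) ?E (\<sigma> \<circ> g)"
    by (rule continuous_map_compose[OF _ U(4)])
  then have in_M: "\<sigma> (g t) \<in> M_Omega_e n" if "t \<in> W" for t
    using that topspace_euclid[OF point_coords_nonempty[OF n]] by (auto simp: continuous_map_def)
  have "\<forall>\<^sub>F t in at 0. t \<in> W" by (rule eventually_at_in_open'[OF W])
  then show "\<forall>\<^sub>F t in at 0. \<sigma> (snd z + t \<cdot>\<^sub>m v) \<in> M_Omega_e n \<and> snd (\<sigma> (snd z + t \<cdot>\<^sub>m v)) = snd z + t \<cdot>\<^sub>m v"
    by eventually_elim (use in_M U(3) in \<open>auto simp: W_def g_def\<close>)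
  assume "c \<in> point_coords n"
  then have "continuous_map (top_of_set W) euclidean (c \<circ> (\<sigma> \<circ> g))"
    by (intro continuous_map_compose[OF \<sigma>g] continuous_map_coord)
  then have "isCont (c \<circ> (\<sigma> \<circ> g)) 0"
    using W by (auto simp: continuous_map_iff_continuous continuous_on_eq_continuous_at comp_def)
  then show "((\<lambda>t. c (\<sigma> (snd z + t \<cdot>\<^sub>m v))) \<longlongrightarrow> c z) (at 0)"
    by (simp add: isCont_def comp_def g0 \<sigma>z g_def[symmetric])
qed

lemma
  assumes "z \<in> M_Omega_e n"
  shows M_Omega_e_gz: "gz n (entry (snd z)) (level (fst z))"
    and M_Omega_e_mat: "snd z \<in> carrier_mat n n"
    and M_Omega_e_vec: "fst z \<in> carrier_vec (tri n)"
  using assms mem_M_Omega_e[of "fst z" "snd z" n] by simp_all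

text \<open>The additional coordinate \<open>b m\<close> meets row m of X, whose value on the
  eigenvector is the coefficient. This is applied at the moved point, with \<open>b\<close> the row
  \<open>rho\<close> of the base point.\<close>

lemma (in gz) bil_phi_Suc:
  assumes m: "m < n" "k < m" and b: "\<And>i. m < i \<Longrightarrow> b i = 0"
  shows "bil n X b (\<phi> m k) = N m k * dot n b (\<phi> m k) + a m k * b m"
proof -
  have s: "(\<Sum>j<n. X i j * \<phi> m k j) = (\<Sum>j<m. X i j * \<phi> m k j)" for i
    by (rule sum_supp) (use m phi_supp in auto)
  have "bil n X b (\<phi> m k) = (\<Sum>i<Suc m. b i * (\<Sum>j<m. X i j * \<phi> m k j))"
    unfolding bil_def s by (rule sum_supp) (use m b in auto)
  also have "\<dots> = (\<Sum>i<m. b i * (N m k * \<phi> m k i)) + a m k * b m"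
    using m by (simp add: phi_row coef_def)
  also have "(\<Sum>i<m. b i * (N m k * \<phi> m k i)) = N m k * (\<Sum>i<m. b i * \<phi> m k i)"
    by (simp add: sum_distrib_left mult_ac)
  also have "(\<Sum>i<m. b i * \<phi> m k i) = dot n b (\<phi> m k)"
    unfolding dot_def by (rule sum_supp[symmetric]) (use m phi_supp in auto)
  finally show ?thesis .
qed

text \<open>Moving the last coordinate 1 to the right side, the other m - 1 coordinates solve a
  system whose matrix is the preceding block minus the eigenvalue; it is invertible since adjacent
  blocks share no eigenvalue.\<close>

lemma regular_on_phi:
  assumes m: "m \<le> n" "k < m"
  shows "regular_on (point_coords n) (M_Omega_e n) (\<lambda>z. phi (entry (snd z)) (level (fst z) m k) m i)"
proof -
  obtain m' where m': "m = Suc m'" using m(2) by (cases m) auto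
  have lev: "regular_on (point_coords n) (M_Omega_e n) (\<lambda>z. level (fst z) m k)"
    by (intro regular_on_coord level_coord m)
  have ent: "regular_on (point_coords n) (M_Omega_e n) (\<lambda>z. entry (snd z) i j)" if "i < m" "j < m" for i j
    by (intro regular_on_coord entry_coord) (use that m in auto)
  consider "i < m'" | "i = m'" | "m \<le> i" using m' by linarith
  then show ?thesis
  proof cases
    case 1
    show ?thesis
    proof (rule regular_on_solve[where k = m' and X = "M_Omega_e n" and
          A = "\<lambda>z i j. entry (snd z) i j - (if i = j then level (fst z) m k else 0)" and
          b = "\<lambda>z i. 0 - entry (snd z) i m'"])
      show "regular_on (point_coords n) (M_Omega_e n)
          (\<lambda>z. entry (snd z) i j - (if i = j then level (fst z) m k else 0))" if "i < m'" "j < m'" for i j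
        using that by (cases "i = j") (auto simp: m' intro!: regular_on_diff ent lev[unfolded m'] regular_on_const)
      show "regular_on (point_coords n) (M_Omega_e n) (\<lambda>z. 0 - entry (snd z) i m')" if "i < m'" for i
        by (intro regular_on_diff ent regular_on_const) (use that m' in auto)
      show "\<forall>j<m'. y j = 0"
        if z: "z \<in> M_Omega_e n" and y: "\<forall>i<m'. (\<Sum>j<m'. (entry (snd z) i j -
            (if i = j then level (fst z) m k else 0)) * y j) = 0" for z y
      proof (intro allI impI)
        interpret gz n "entry (snd z)" "level (fst z)" by (rule M_Omega_e_gz[OF z])
        fix j assume "j < m'"
        have "eigvec m' (entry (snd z)) (level (fst z) m k) y"
          using y by (auto simp: eigvec_def left_diff_distrib sum_subtractf if_distrib[of "\<lambda>x. x * _"] cong: if_cong)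
        then show "y j = 0"
          by (rule complete[rotated]) (use m m' sep[of m'] \<open>j < m'\<close> in auto)
      qed
      show "(\<Sum>j<m'. (entry (snd z) i j - (if i = j then level (fst z) m k else 0)) *
          phi (entry (snd z)) (level (fst z) m k) m j) = 0 - entry (snd z) i m'"
        if z: "z \<in> M_Omega_e n" and i: "i < m'" for z i
      proof -
        interpret gz n "entry (snd z)" "level (fst z)" by (rule M_Omega_e_gz[OF z])
        have "(\<Sum>j<m'. entry (snd z) i j * \<phi> m k j) + entry (snd z) i m' = level (fst z) m k * \<phi> m k i"
          using phi_row[OF m, of i] phi_last[OF m] i by (simp add: m')
        then have "(\<Sum>j<m'. entry (snd z) i j * \<phi> m k j) - level (fst z) m k * \<phi> m k i = - entry (snd z) i m'"
          by (simp add: algebra_simps)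
        then show ?thesis using i
          by (simp add: left_diff_distrib sum_subtractf if_distrib[of "\<lambda>x. x * _"] cong: if_cong)
      qed
    qed (use 1 in auto)
  next
    case 2
    show ?thesis
      by (rule regular_on_cong[OF regular_on_const[of _ _ 1]])
        (use gz.phi_last[OF M_Omega_e_gz m] 2 m' in simp)
  next
    case 3
    show ?thesis
      by (rule regular_on_cong[OF regular_on_const[of _ _ 0]])
        (use gz.phi_supp[OF M_Omega_e_gz m 3] in simp)
  qed
qed

definition scoef :: "nat \<Rightarrow> nat \<Rightarrow> point \<Rightarrow> complex" where
  "scoef m k z = coef (entry (snd z)) (level (fst z)) m k"

lemma regular_on_scoef:
  assumes "m < n" "k < m"
  shows "regular_on (point_coords n) (M_Omega_e n) (scoef m k)"
  unfolding scoef_def[abs_def] coef_def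
  by (intro regular_on_sum regular_on_mult regular_on_phi regular_on_coord entry_coord) (use assms in auto)

section \<open>Gradients\<close>

text \<open>The gradient of \<open>f\<close> at \<open>x\<close> is the rank one matrix \<open>\<alpha> \<beta>\<^sup>T\<close>.\<close>

definition has_grad :: "nat \<Rightarrow> (complex mat \<Rightarrow> complex) \<Rightarrow> complex mat \<Rightarrow> (nat \<Rightarrow> complex) \<Rightarrow> (nat \<Rightarrow> complex) \<Rightarrow> bool" where
  "has_grad n f x \<alpha> \<beta> \<longleftrightarrow> (\<forall>v\<in>carrier_mat n n.
     ((\<lambda>t. f (x + t \<cdot>\<^sub>m v)) has_field_derivative bil n (entry v) \<beta> \<alpha>) (at 0))"

lemma mat_trace_mult:
  assumes "A \<in> carrier_mat n n" "B \<in> carrier_mat n n"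
  shows "mat_trace (A * B) = (\<Sum>i<n. \<Sum>j<n. A $$ (i, j) * B $$ (j, i))"
  using assms by (auto simp: mat_trace_def scalar_prod_def atLeast0LessThan intro!: sum.cong)

lemma bil_rank1: "bil n (entry v) \<beta> \<alpha> = (\<Sum>i<n. \<Sum>j<n. (\<alpha> i * \<beta> j) * v $$ (j, i))"
  by (subst sum.swap) (simp add: bil_def entry_def sum_distrib_left mult_ac)

text \<open>The trace form is nondegenerate, so directional derivatives determine the gradient and
  the definite description is justified.\<close>

lemma gradient_eqI:
  assumes "has_grad n f x \<alpha> \<beta>"
  shows "gradient n f x = mat n n (\<lambda>(i, j). \<alpha> i * \<beta> j)"
proof -
  let ?G = "mat n n (\<lambda>(i, j). \<alpha> i * \<beta> j)"
  have tr: "mat_trace (?G * v) = bil n (entry v) \<beta> \<alpha>" if "v \<in> carrier_mat n n" for v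
    using that by (simp add: mat_trace_mult[of _ n] bil_rank1)
  show ?thesis unfolding gradient_def
  proof (rule the_equality)
    show "?G \<in> carrier_mat n n \<and> (\<forall>v\<in>carrier_mat n n.
        ((\<lambda>t. f (x + t \<cdot>\<^sub>m v)) has_field_derivative mat_trace (?G * v)) (at 0))"
      using assms by (simp add: tr has_grad_def)
    fix G assume G: "G \<in> carrier_mat n n \<and> (\<forall>v\<in>carrier_mat n n.
        ((\<lambda>t. f (x + t \<cdot>\<^sub>m v)) has_field_derivative mat_trace (G * v)) (at 0))"
    have eq: "mat_trace (G * v) = mat_trace (?G * v)" if "v \<in> carrier_mat n n" for v
      by (rule DERIV_unique[of "\<lambda>t. f (x + t \<cdot>\<^sub>m v)" _ 0])
        (use G assms that in \<open>auto simp: has_grad_def tr\<close>)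
    show "G = ?G"
    proof (rule eq_matI)
      fix i j assume "i < dim_row ?G" "j < dim_col ?G"
      then have ij: "i < n" "j < n" by auto
      \<comment> \<open>The elementary matrix with its 1 at (j, i): pairing with it reads off entry
        (i, j).\<close>
      let ?v = "mat n n (\<lambda>(a, b). if a = j \<and> b = i then 1 else 0) :: complex mat"
      have "mat_trace (H * ?v) = H $$ (i, j)" if "H \<in> carrier_mat n n" for H
      proof -
        have "mat_trace (H * ?v) = (\<Sum>a<n. \<Sum>b<n. if a = i \<and> b = j then H $$ (i, j) else 0)"
          using that by (auto simp: mat_trace_mult[of _ n] intro!: sum.cong)
        also have "\<dots> = (\<Sum>a<n. if a = i then H $$ (i, j) else 0)"
          using ij by (intro sum.cong) auto
        also have "\<dots> = H $$ (i, j)" using ij by simp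
        finally show ?thesis .
      qed
      from this[of G] this[of ?G] eq[of ?v] G show "G $$ (i, j) = ?G $$ (i, j)" by simp
    qed (use G in auto)
  qed
qed

lemma lie_poisson_rank1:
  assumes f: "has_grad n f x \<alpha> \<beta>" and g: "has_grad n g x \<alpha>' \<beta>'" and x: "x \<in> carrier_mat n n"
  shows "lie_poisson n f g x =
    dot n \<beta> \<alpha>' * bil n (entry x) \<beta>' \<alpha> - dot n \<beta>' \<alpha> * bil n (entry x) \<beta> \<alpha>'"
proof -
  let ?G = "\<lambda>\<alpha> \<beta>. mat n n (\<lambda>(i, j). \<alpha> i * \<beta> j) :: complex mat"
  have prod: "(?G \<alpha> \<beta> * ?G \<alpha>' \<beta>') $$ (i, j) = dot n \<beta> \<alpha>' * (\<alpha> i * \<beta>' j)"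
    if "i < n" "j < n" for i j \<alpha> \<beta> \<alpha>' \<beta>'
    using that by (simp add: scalar_prod_def atLeast0LessThan dot_def sum_distrib_left sum_distrib_right mult_ac)
  have "lie_poisson n f g x = (\<Sum>i<n. \<Sum>j<n. x $$ (i, j) *
      (dot n \<beta> \<alpha>' * (\<alpha> j * \<beta>' i) - dot n \<beta>' \<alpha> * (\<alpha>' j * \<beta> i)))"
    using x unfolding lie_poisson_def Let_def gradient_eqI[OF f] gradient_eqI[OF g]
    by (subst mat_trace_mult[of _ n]) (auto simp: prod simp del: index_mult_mat(1) intro!: sum.cong)
  also have "\<dots> = dot n \<beta> \<alpha>' * bil n (entry x) \<beta>' \<alpha> - dot n \<beta>' \<alpha> * bil n (entry x) \<beta> \<alpha>'"
    by (simp add: bil_def entry_def sum_distrib_left sum_subtractf right_diff_distrib mult_ac)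
  finally show ?thesis .
qed

text \<open>The gradients are assumed for all local sections, since the one inside
  \<open>bracket\<close> is an arbitrary choice.\<close>

lemma bracket_rank1:
  assumes "1 \<le> n" and z: "z \<in> M_Omega_e n"
    and f: "\<And>\<sigma>. local_section n z \<sigma> \<Longrightarrow> has_grad n (f \<circ> \<sigma>) (snd z) \<alpha> \<beta>"
    and g: "\<And>\<sigma>. local_section n z \<sigma> \<Longrightarrow> has_grad n (g \<circ> \<sigma>) (snd z) \<alpha>' \<beta>'"
  shows "bracket n f g z = dot n \<beta> \<alpha>' * bil n (entry (snd z)) \<beta>' \<alpha> -
    dot n \<beta>' \<alpha> * bil n (entry (snd z)) \<beta> \<alpha>'"
proof -
  have "local_section n z (SOME \<sigma>. local_section n z \<sigma>)"
    by (rule someI_ex[OF local_section_exists[OF assms(1,2)]])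
  from lie_poisson_rank1[OF f[OF this] g[OF this] M_Omega_e_mat[OF z]]
  show ?thesis by (simp add: bracket_def Let_def)
qed

section \<open>Difference quotients along a lifted line\<close>

lemma tendsto_bil:
  assumes "\<And>i. ((\<lambda>t. \<alpha> t i) \<longlongrightarrow> \<alpha>' i) F"
  shows "((\<lambda>t. bil n X \<beta> (\<alpha> t)) \<longlongrightarrow> bil n X \<beta> \<alpha>') F"
  unfolding bil_def by (intro tendsto_intros assms)

lemma tendsto_dot:
  assumes "\<And>i. ((\<lambda>t. \<alpha> t i) \<longlongrightarrow> \<alpha>' i) F"
  shows "((\<lambda>t. dot n \<beta> (\<alpha> t)) \<longlongrightarrow> dot n \<beta> \<alpha>') F"
  unfolding dot_def by (intro tendsto_intros assms)

lemma bil_add_smult: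
  assumes "x \<in> carrier_mat n n" "v \<in> carrier_mat n n"
  shows "bil n (entry (x + t \<cdot>\<^sub>m v)) \<beta> \<alpha> = bil n (entry x) \<beta> \<alpha> + t * bil n (entry v) \<beta> \<alpha>"
  using assms by (simp add: bil_def entry_def sum_distrib_left sum.distrib distrib_left distrib_right mult_ac)

lemma add_zero_smult:
  assumes "x \<in> carrier_mat n n" "v \<in> carrier_mat n n"
  shows "x + (0 :: complex) \<cdot>\<^sub>m v = x"
  using assms by (intro eq_matI) auto

locale section_path =
  fixes n z \<sigma> and v :: "complex mat"
  assumes n: "1 \<le> n" and z: "z \<in> M_Omega_e n" and \<sigma>: "local_section n z \<sigma>" and v: "v \<in> carrier_mat n n"
begin

sublocale gz n "entry (snd z)" "level (fst z)"
  by (rule M_Omega_e_gz[OF z])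

definition "path t = \<sigma> (snd z + t \<cdot>\<^sub>m v)"

lemma eventually_path: "\<forall>\<^sub>F t in at 0. path t \<in> M_Omega_e n \<and> snd (path t) = snd z + t \<cdot>\<^sub>m v"
  unfolding path_def by (rule local_section_path(1)[OF n z \<sigma> v])

lemma path_tendsto_coord: "c \<in> point_coords n \<Longrightarrow> ((\<lambda>t. c (path t)) \<longlongrightarrow> c z) (at 0)"
  unfolding path_def by (rule local_section_path(2)[OF n z \<sigma> v])

lemma path_tendsto:
  assumes "regular_on (point_coords n) (M_Omega_e n) f"
  shows "((\<lambda>t. f (path t)) \<longlongrightarrow> f z) (at 0)"
  by (rule regular_on_tendsto[OF assms, of path z])
    (use eventually_path path_tendsto_coord z in \<open>auto elim: eventually_mono\<close>)

lemma path_0: "path 0 = z"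
  using \<sigma> unfolding path_def local_section_def add_zero_smult[OF M_Omega_e_mat[OF z] v] by simp

lemma path_DERIV:
  assumes "((\<lambda>t. (f (path t) - f z) / t) \<longlongrightarrow> D) (at 0)"
  shows "((\<lambda>t. (f \<circ> \<sigma>) (snd z + t \<cdot>\<^sub>m v)) has_field_derivative D) (at 0)"
  using assms by (simp add: DERIV_def path_def[symmetric] path_0)

definition "phit m k t = phi (entry (snd (path t))) (level (fst (path t)) m k) m"

lemma phit_tendsto: "m \<le> n \<Longrightarrow> k < m \<Longrightarrow> ((\<lambda>t. phit m k t i) \<longlongrightarrow> \<phi> m k i) (at 0)"
  unfolding phit_def by (intro path_tendsto regular_on_phi)

lemma phit_supp: "path t \<in> M_Omega_e n \<Longrightarrow> m \<le> n \<Longrightarrow> k < m \<Longrightarrow> m \<le> i \<Longrightarrow> phit m k t i = 0"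
  unfolding phit_def by (rule gz.phi_supp[OF M_Omega_e_gz])

lemma phit_last: "path t \<in> M_Omega_e n \<Longrightarrow> m \<le> n \<Longrightarrow> k < m \<Longrightarrow> phit m k t (m - 1) = 1"
  unfolding phit_def by (rule gz.phi_last[OF M_Omega_e_gz])

text \<open>Evaluate psi X_t phi_t with psi fixed at the base point and phi_t moving. The right
  eigenvector gives N_t (psi phi_t), and expanding X_t = X + t v gives N_0 (psi phi_t) + t (psi v
  phi_t). Hence the quotient is exactly (psi v phi_t) / (psi phi_t), with denominator tending to
  1.\<close>

lemma level_tendsto:
  assumes m: "m \<le> n" "k < m"
  shows "((\<lambda>t. (level (fst (path t)) m k - level (fst z) m k) / t) \<longlongrightarrow>
    bil n (entry v) (\<psi> m k) (\<phi> m k)) (at 0)"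
proof -
  have d1: "((\<lambda>t. dot n (\<psi> m k) (phit m k t)) \<longlongrightarrow> 1) (at 0)"
    using tendsto_dot[of "phit m k", OF phit_tendsto[OF m], of n "\<psi> m k"] dot_psi_phi[OF m m(2)] by simp
  have "((\<lambda>t. bil n (entry v) (\<psi> m k) (phit m k t) / dot n (\<psi> m k) (phit m k t)) \<longlongrightarrow>
      bil n (entry v) (\<psi> m k) (\<phi> m k) / 1) (at 0)"
    by (intro tendsto_divide tendsto_bil phit_tendsto m d1) simp
  moreover have "\<forall>\<^sub>F t in at 0. bil n (entry v) (\<psi> m k) (phit m k t) / dot n (\<psi> m k) (phit m k t) =
      (level (fst (path t)) m k - level (fst z) m k) / t"
    using eventually_path tendsto_imp_eventually_ne[OF d1 one_neq_zero] eventually_neq_at_within[of 0 0 UNIV]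
  proof eventually_elim
    case (elim t)
    then interpret t: gz n "entry (snd (path t))" "level (fst (path t))" by (intro M_Omega_e_gz) simp
    have "level (fst (path t)) m k * dot n (\<psi> m k) (phit m k t) =
        bil n (entry (snd (path t))) (\<psi> m k) (phit m k t)"
      unfolding phit_def by (rule t.bil_phi[OF m, symmetric]) (use psi_supp m in auto)
    also have "\<dots> = bil n (entry (snd z)) (\<psi> m k) (phit m k t) + t * bil n (entry v) (\<psi> m k) (phit m k t)"
      using elim by (simp add: bil_add_smult[OF M_Omega_e_mat[OF z] v])
    also have "bil n (entry (snd z)) (\<psi> m k) (phit m k t) = level (fst z) m k * dot n (\<psi> m k) (phit m k t)"
      by (rule bil_psi[OF m]) (use phit_supp elim m in auto)
    finally show ?case using elim by (simp add: field_simps)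
  qed
  ultimately show ?thesis by (simp add: tendsto_cong)
qed

text \<open>The same double evaluation, of rho X_t phi_t: \<open>bil_phi_Suc\<close> at the moved
  point produces the moved coefficient, \<open>bil_rho\<close> at the base point the old
  one.\<close>

lemma scoef_tendsto:
  assumes m: "m < n" "k < m"
  shows "((\<lambda>t. (scoef m k (path t) - scoef m k z) / t) \<longlongrightarrow>
    bil n (entry v) (\<rho> m k) (\<phi> m k)) (at 0)"
proof -
  have m': "m \<le> n" using m by simp
  have "((\<lambda>t. bil n (entry v) (\<rho> m k) (phit m k t) -
      (level (fst (path t)) m k - level (fst z) m k) / t * dot n (\<rho> m k) (phit m k t)) \<longlongrightarrow>
      bil n (entry v) (\<rho> m k) (\<phi> m k) - bil n (entry v) (\<psi> m k) (\<phi> m k) * dot n (\<rho> m k) (\<phi> m k)) (at 0)"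
    by (intro tendsto_intros tendsto_bil tendsto_dot phit_tendsto level_tendsto m m')
  \<comment> \<open>The derivative of the eigenvalue drops out because \<open>\<rho> m k\<close>
    annihilates \<open>\<phi> m k\<close>.\<close>
  then have "((\<lambda>t. bil n (entry v) (\<rho> m k) (phit m k t) -
      (level (fst (path t)) m k - level (fst z) m k) / t * dot n (\<rho> m k) (phit m k t)) \<longlongrightarrow>
      bil n (entry v) (\<rho> m k) (\<phi> m k)) (at 0)"
    by (simp add: dot_rho_phi m)
  moreover have "\<forall>\<^sub>F t in at 0. bil n (entry v) (\<rho> m k) (phit m k t) -
      (level (fst (path t)) m k - level (fst z) m k) / t * dot n (\<rho> m k) (phit m k t) =
      (scoef m k (path t) - scoef m k z) / t"
    using eventually_path eventually_neq_at_within[of 0 0 UNIV]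
  proof eventually_elim
    case (elim t)
    then interpret t: gz n "entry (snd (path t))" "level (fst (path t))" by (intro M_Omega_e_gz) simp
    have "level (fst (path t)) m k * dot n (\<rho> m k) (phit m k t) + scoef m k (path t) * \<rho> m k m =
        bil n (entry (snd (path t))) (\<rho> m k) (phit m k t)"
      unfolding phit_def scoef_def by (rule t.bil_phi_Suc[OF m, symmetric]) (use rho_supp m' in auto)
    also have "\<dots> = bil n (entry (snd z)) (\<rho> m k) (phit m k t) + t * bil n (entry v) (\<rho> m k) (phit m k t)"
      using elim by (simp add: bil_add_smult[OF M_Omega_e_mat[OF z] v])
    also have "bil n (entry (snd z)) (\<rho> m k) (phit m k t) =
        level (fst z) m k * dot n (\<rho> m k) (phit m k t) + a m k * phit m k t (m - 1)"
      by (rule bil_rho[OF m]) (use phit_supp elim m in auto)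
    moreover have "\<rho> m k m = 1" by (simp add: rho_def)
    ultimately show ?case using elim phit_last[of t, OF _ m' m(2)]
      by (simp add: scoef_def field_simps)
  qed
  ultimately show ?thesis by (simp add: tendsto_cong)
qed

lemma entry_tendsto:
  assumes ij: "i < n" "j < n"
  shows "((\<lambda>t. (entry (snd (path t)) i j - entry (snd z) i j) / t) \<longlongrightarrow>
    bil n (entry v) (\<lambda>k. if k = i then 1 else 0) (\<lambda>k. if k = j then 1 else 0)) (at 0)"
proof (rule tendsto_eventually)
  have "bil n (entry v) (\<lambda>k. if k = i then 1 else 0) (\<lambda>k. if k = j then 1 else 0) = v $$ (i, j)"
    using ij by (simp add: bil_def entry_def if_distrib[of "\<lambda>x. _ * x"] if_distrib[of "\<lambda>x. x * _"] cong: if_cong)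
  with eventually_path eventually_neq_at_within[of 0 0 UNIV]
  show "\<forall>\<^sub>F t in at 0. (entry (snd (path t)) i j - entry (snd z) i j) / t =
      bil n (entry v) (\<lambda>k. if k = i then 1 else 0) (\<lambda>k. if k = j then 1 else 0)"
    by (auto elim!: eventually_elim2) (use ij v M_Omega_e_mat[OF z] in \<open>auto simp: entry_def\<close>)
qed

end

section \<open>Brackets of eigenvalues, coefficients and matrix entries\<close>

lemma grad_level:
  assumes "1 \<le> n" "z \<in> M_Omega_e n" "m \<le> n" "k < m" "local_section n z \<sigma>"
  shows "has_grad n ((\<lambda>z. level (fst z) m k) \<circ> \<sigma>) (snd z)
    (phi (entry (snd z)) (level (fst z) m k) m) (psi (entry (snd z)) (level (fst z)) m k)"
  unfolding has_grad_def
proof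
  fix v :: "complex mat" assume "v \<in> carrier_mat n n"
  then interpret section_path n z \<sigma> v by unfold_locales (use assms in auto)
  show "((\<lambda>t. ((\<lambda>z. level (fst z) m k) \<circ> \<sigma>) (snd z + t \<cdot>\<^sub>m v)) has_field_derivative
      bil n (entry v) (\<psi> m k) (\<phi> m k)) (at 0)"
    by (rule path_DERIV) (rule level_tendsto[OF assms(3,4)])
qed

lemma grad_entry:
  assumes "1 \<le> n" "z \<in> M_Omega_e n" "i < n" "j < n" "local_section n z \<sigma>"
  shows "has_grad n ((\<lambda>z. entry (snd z) i j) \<circ> \<sigma>) (snd z)
    (\<lambda>k. if k = j then 1 else 0) (\<lambda>k. if k = i then 1 else 0)"
  unfolding has_grad_def
proof
  fix v :: "complex mat" assume "v \<in> carrier_mat n n"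
  then interpret section_path n z \<sigma> v by unfold_locales (use assms in auto)
  show "((\<lambda>t. ((\<lambda>z. entry (snd z) i j) \<circ> \<sigma>) (snd z + t \<cdot>\<^sub>m v)) has_field_derivative
      bil n (entry v) (\<lambda>k. if k = i then 1 else 0) (\<lambda>k. if k = j then 1 else 0)) (at 0)"
    by (rule path_DERIV) (rule entry_tendsto[OF assms(3,4)])
qed

lemma grad_scoef:
  assumes "1 \<le> n" "z \<in> M_Omega_e n" "m < n" "k < m" "local_section n z \<sigma>"
    and f: "\<And>w. w \<in> M_Omega_e n \<Longrightarrow> f w = scoef m k w"
  shows "has_grad n (f \<circ> \<sigma>) (snd z)
    (phi (entry (snd z)) (level (fst z) m k) m) (rho (entry (snd z)) (level (fst z)) m k)"
  unfolding has_grad_def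
proof
  fix v :: "complex mat" assume "v \<in> carrier_mat n n"
  then interpret section_path n z \<sigma> v by unfold_locales (use assms in auto)
  have "\<forall>\<^sub>F t in at 0. (scoef m k (path t) - scoef m k z) / t = (f (path t) - f z) / t"
    using eventually_path by eventually_elim (simp add: f z)
  from tendsto_cong[OF this, of "bil n (entry v) (\<rho> m k) (\<phi> m k)"] scoef_tendsto[OF assms(3,4)]
  have "((\<lambda>t. (f (path t) - f z) / t) \<longlongrightarrow> bil n (entry v) (\<rho> m k) (\<phi> m k)) (at 0)"
    by blast
  then show "((\<lambda>t. (f \<circ> \<sigma>) (snd z + t \<cdot>\<^sub>m v)) has_field_derivative
      bil n (entry v) (\<rho> m k) (\<phi> m k)) (at 0)" by (rule path_DERIV)
qed

lemma bracket_level_level: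
  assumes "1 \<le> n" "z \<in> M_Omega_e n" "m \<le> n" "k < m" "m' \<le> n" "k' < m'"
  shows "bracket n (\<lambda>z. level (fst z) m k) (\<lambda>z. level (fst z) m' k') z = 0"
proof -
  interpret gz n "entry (snd z)" "level (fst z)" by (rule M_Omega_e_gz[OF assms(2)])
  show ?thesis
    using bracket_rank1[OF assms(1,2) grad_level[OF assms(1-4)] grad_level[OF assms(1,2,5,6)]]
      rank1_bracket_phi_phi[OF assms(3-6)] by (simp add: rank1_bracket_def)
qed

lemma bracket_level_scoef:
  assumes "1 \<le> n" "z \<in> M_Omega_e n" "m' \<le> n" "k' < m'" "m < n" "k < m"
    and "\<And>w. w \<in> M_Omega_e n \<Longrightarrow> f w = scoef m k w"
  shows "bracket n (\<lambda>z. level (fst z) m' k') f z = (if m' = m \<and> k' = k then scoef m k z else 0)"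
proof -
  interpret gz n "entry (snd z)" "level (fst z)" by (rule M_Omega_e_gz[OF assms(2)])
  show ?thesis
    using bracket_rank1[OF assms(1,2) grad_level[OF assms(1-4)] grad_scoef[OF assms(1,2,5,6) _ assms(7)]]
      rank1_bracket_phi_rho[OF assms(3-6)] by (simp add: rank1_bracket_def scoef_def)
qed

lemma bracket_scoef_scoef:
  assumes "1 \<le> n" "z \<in> M_Omega_e n" "m < n" "k < m" "m' < n" "k' < m'"
    and "\<And>w. w \<in> M_Omega_e n \<Longrightarrow> f w = scoef m k w" "\<And>w. w \<in> M_Omega_e n \<Longrightarrow> g w = scoef m' k' w"
  shows "bracket n f g z = 0"
proof -
  interpret gz n "entry (snd z)" "level (fst z)" by (rule M_Omega_e_gz[OF assms(2)])
  show ?thesis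
    using bracket_rank1[OF assms(1,2) grad_scoef[OF assms(1-4) _ assms(7)] grad_scoef[OF assms(1,2,5,6) _ assms(8)]]
      rank1_bracket_rho_rho[OF assms(3-6)] by (simp add: rank1_bracket_def)
qed

text \<open>The right side is entry (i, j) of X P - P X for the spectral projection P = phi psi^T.
  So the vector field of an eigenvalue is an infinitesimal conjugation by P.\<close>

lemma bracket_level_entry:
  assumes "1 \<le> n" "z \<in> M_Omega_e n" "m \<le> n" "k < m" "i < n" "j < n"
  defines "X \<equiv> entry (snd z)" and "N \<equiv> level (fst z)"
  shows "bracket n (\<lambda>z. level (fst z) m k) (\<lambda>z. entry (snd z) i j) z =
    (\<Sum>l<m. X i l * phi X (N m k) m l) * psi X N m k j -
    phi X (N m k) m i * (\<Sum>l<m. psi X N m k l * X l j)"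
proof -
  interpret gz n X N unfolding X_def N_def by (rule M_Omega_e_gz[OF assms(2)])
  have d: "dot n b (\<lambda>k. if k = j then 1 else 0) = b j" if "j < n" for b j
    using that by (simp add: dot_def if_distrib[of "\<lambda>x. _ * x"] cong: if_cong)
  have l: "bil n X (\<lambda>k. if k = i then 1 else 0) (\<phi> m k) = (\<Sum>l<m. X i l * \<phi> m k l)"
    unfolding bil_def using assms(5) phi_supp[OF assms(3,4)]
    by (simp add: if_distrib[of "\<lambda>x. x * _"] sum_supp[OF assms(3)] cong: if_cong)
  have r: "bil n X (\<psi> m k) (\<lambda>k. if k = j then 1 else 0) = (\<Sum>l<m. \<psi> m k l * X l j)"
    unfolding bil_alt using assms(6) psi_supp[OF assms(3)]
    by (simp add: if_distrib[of "\<lambda>x. _ * x"] sum_supp[OF assms(3)] cong: if_cong)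
  show ?thesis
    using bracket_rank1[OF assms(1,2) grad_level[OF assms(1-4)] grad_entry[OF assms(1,2,5,6)]]
    by (simp add: X_def[symmetric] N_def[symmetric] l r d assms(5,6) dot_commute[of n "\<lambda>k. if k = i then 1 else 0"])
qed

section \<open>Conjugation by the torus\<close>

context gz begin

text \<open>For \<open>P = \<phi> m k \<otimes> \<psi> m k\<close> and \<open>c + d + c d = 0\<close> this is \<open>(1 + c P) X (1 + d P)\<close>,
  the conjugate of \<open>X\<close> by \<open>1 + c P\<close>.\<close>

definition tw :: "nat \<Rightarrow> nat \<Rightarrow> complex \<Rightarrow> complex \<Rightarrow> nat \<Rightarrow> nat \<Rightarrow> complex" where
  "tw m k c d i j = X i j + c * \<phi> m k i * (\<Sum>l<m. \<psi> m k l * X l j)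
     + d * (\<Sum>l<m. X i l * \<phi> m k l) * \<psi> m k j + c * d * N m k * \<phi> m k i * \<psi> m k j"

lemma psi_phi_sum: "m \<le> n \<Longrightarrow> k < m \<Longrightarrow> (\<Sum>l<m. \<psi> m k l * \<phi> m k l) = 1"
  using psi_left[of m k k] by simp

text \<open>Inside the block X P = P X = N P, so the three correction terms are N P times c + d + c
  d.\<close>

lemma tw_block:
  assumes "m \<le> n" "k < m" "c + d + c * d = 0" "i < m" "j < m"
  shows "tw m k c d i j = X i j"
proof -
  have "tw m k c d i j = X i j + (c + d + c * d) * (N m k * \<phi> m k i * \<psi> m k j)"
    unfolding tw_def phi_row[OF assms(1,2,4)] psi_col[OF assms(1,2,5)] by (simp add: algebra_simps)
  then show ?thesis by (simp add: assms(3))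
qed

text \<open>The vector is (1 + c P) applied to \<open>\<phi> m' k'\<close>, on which 1 + d P cancels
  1 + c P. The row i is arbitrary: rows i < m' give the eigenvector equation of the conjugate, and
  row m' gives its coefficient.\<close>

lemma tw_apply:
  assumes m: "m \<le> n" "k < m" and c: "c + d + c * d = 0" and m': "m < m'" "m' \<le> n" "k' < m'"
  defines "e \<equiv> (\<Sum>l<m. \<psi> m k l * \<phi> m' k' l)"
  shows "(\<Sum>j<m'. tw m k c d i j * (\<phi> m' k' j + c * e * \<phi> m k j)) =
    (\<Sum>j<m'. X i j * \<phi> m' k' j) + c * e * N m' k' * \<phi> m k i"
proof -
  let ?y = "\<lambda>j. \<phi> m' k' j + c * e * \<phi> m k j"
  let ?u = "\<Sum>l<m. X i l * \<phi> m k l" and ?l = "\<lambda>j. \<Sum>l<m. \<psi> m k l * X l j"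
  have "(\<Sum>j<m'. X i j * \<phi> m k j) = ?u"
    by (rule sum_supp) (use m m' phi_supp in auto)
  then have Xy: "(\<Sum>j<m'. X i j * ?y j) = (\<Sum>j<m'. X i j * \<phi> m' k' j) + c * e * ?u"
    by (simp add: distrib_left sum.distrib sum_distrib_left[of "c * e", symmetric] mult.left_commute[of _ "c * e"])
  have "(\<Sum>j<m'. \<psi> m k j * ?y j) = (\<Sum>j<m. \<psi> m k j * ?y j)"
    by (rule sum_supp) (use m m' psi_supp in auto)
  also have "\<dots> = e + c * e * (\<Sum>j<m. \<psi> m k j * \<phi> m k j)"
    by (simp add: distrib_left sum.distrib sum_distrib_left[of "c * e", symmetric]
        mult.left_commute[of _ "c * e"] e_def[symmetric])
  finally have py: "(\<Sum>j<m'. \<psi> m k j * ?y j) = e + c * e" by (simp add: psi_phi_sum[OF m])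
  have "(\<Sum>j<m'. ?l j * \<phi> m' k' j) = (\<Sum>l<m. \<psi> m k l * (\<Sum>j<m'. X l j * \<phi> m' k' j))"
    unfolding sum_distrib_left sum_distrib_right by (subst sum.swap) (simp add: mult_ac)
  also have "\<dots> = N m' k' * e"
    unfolding e_def sum_distrib_left[of "N m' k'"]
    by (intro sum.cong refl) (use phi_row[OF m'(2,3)] m'(1) in simp)
  finally have l1: "(\<Sum>j<m'. ?l j * \<phi> m' k' j) = N m' k' * e" .
  have "(\<Sum>j<m'. ?l j * \<phi> m k j) = (\<Sum>j<m. ?l j * \<phi> m k j)"
    by (rule sum_supp) (use m m' phi_supp in auto)
  also have "\<dots> = (\<Sum>j<m. N m k * (\<psi> m k j * \<phi> m k j))"
    by (intro sum.cong refl) (use psi_col[OF m] in simp)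
  also have "\<dots> = N m k" by (simp add: sum_distrib_left[symmetric] psi_phi_sum[OF m])
  finally have "(\<Sum>j<m'. ?l j * \<phi> m k j) = N m k" .
  with l1 have ly: "(\<Sum>j<m'. ?l j * ?y j) = N m' k' * e + c * e * N m k"
    by (simp add: distrib_left sum.distrib sum_distrib_left[of "c * e", symmetric] mult.left_commute[of _ "c * e"])
  have "(\<Sum>j<m'. tw m k c d i j * ?y j) = (\<Sum>j<m'. X i j * ?y j) + c * \<phi> m k i * (\<Sum>j<m'. ?l j * ?y j)
      + (d * ?u + c * d * N m k * \<phi> m k i) * (\<Sum>j<m'. \<psi> m k j * ?y j)"
    unfolding sum_distrib_left[of "c * \<phi> m k i"] sum_distrib_left[of "d * ?u + c * d * N m k * \<phi> m k i"]
      sum.distrib[symmetric]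
    by (intro sum.cong refl) (simp add: tw_def algebra_simps)
  also have "\<dots> = (\<Sum>j<m'. X i j * \<phi> m' k' j) + c * e * N m' k' * \<phi> m k i
      + (c + d + c * d) * (e * ?u + c * e * N m k * \<phi> m k i)"
    unfolding Xy py ly by (simp add: algebra_simps)
  finally show ?thesis by (simp add: c)
qed

text \<open>Up to level m the leading blocks are unchanged. Above it the eigenvectors are moved by 1
  + c P and still end in 1, since \<open>\<phi> m k\<close> vanishes from position m on. At level m
  only the new row changes, by the factor 1 + d P on the right, which scales its value on
  \<open>\<phi> m k\<close> alone.\<close>

lemma
  assumes m: "m \<le> n" "k < m" and c: "c + d + c * d = 0"
  shows tw_gz: "gz n (tw m k c d) N"
    and tw_coef: "m' < n \<Longrightarrow> k' < m' \<Longrightarrow>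
      coef (tw m k c d) N m' k' = (if m' = m \<and> k' = k then (1 + d) * a m k else a m' k')"
proof -
  define y where "y m' k' j = \<phi> m' k' j + c * (\<Sum>l<m. \<psi> m k l * \<phi> m' k' l) * \<phi> m k j" for m' k' j
  have low: "eigvec m' (tw m k c d) e f = eigvec m' X e f" if "m' \<le> m" for m' e f
    by (rule eigvec_cong) (use tw_block[OF m c] that in auto)
  have yev: "eigvec m' (tw m k c d) (N m' k') (y m' k')" if m': "m < m'" "m' \<le> n" "k' < m'" for m' k'
    unfolding eigvec_def y_def tw_apply[OF m c m'] using phi_row[OF m'(2,3)] by (simp add: algebra_simps)
  have ylast: "y m' k' (m' - 1) = 1" if m': "m < m'" "m' \<le> n" "k' < m'" for m' k'
  proof -
    have "\<phi> m k (m' - 1) = 0" by (rule phi_supp[OF m]) (use m' in simp)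
    then show ?thesis using phi_last[OF m'(2,3)] by (simp add: y_def)
  qed
  show G: "gz n (tw m k c d) N"
  proof
    fix m' assume m': "m' \<le> n"
    show "inj_on (N m') {..<m'}" by (rule inj[OF m'])
    fix k' assume k': "k' < m'"
    show "\<exists>f. eigvec m' (tw m k c d) (N m' k') f \<and> (\<exists>i<m'. f i \<noteq> 0)"
    proof (cases "m' \<le> m")
      case True
      with ev[OF m' k'] show ?thesis by (simp add: low)
    next
      case False
      then show ?thesis using yev[of m' k'] ylast[of m' k'] m' k'
        by (intro exI[of _ "y m' k'"] conjI exI[of _ "m' - 1"]) auto
    qed
  qed (use sep in auto)
  interpret t: gz n "tw m k c d" N by (rule G)
  assume m': "m' < n" and k': "k' < m'"
  \<comment> \<open>Row i of P is 0 for i \<ge> m, so such rows see only the right factor.\<close>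
  have tw_row: "tw m k c d m' j = X m' j + d * (\<Sum>l<m. X m' l * \<phi> m k l) * \<psi> m k j" if "m \<le> m'" for j
    using phi_supp[OF m that] by (simp add: tw_def)
  show "coef (tw m k c d) N m' k' = (if m' = m \<and> k' = k then (1 + d) * a m k else a m' k')"
  proof (cases "m' \<le> m")
    case True
    have phi: "phi (tw m k c d) (N m' k') m' = \<phi> m' k'"
      by (rule phi_cong) (use tw_block[OF m c] True in auto)
    show ?thesis
    proof (cases "m' = m")
      case False
      then show ?thesis using True tw_block[OF m c] by (simp add: coef_def phi)
    next
      case mm: True
      have "coef (tw m k c d) N m k' = a m k' + d * a m k * (\<Sum>j<m. \<psi> m k j * \<phi> m k' j)"
        unfolding coef_def[of "tw m k c d"] coef_def[of _ _ _ k'] phi[unfolded mm]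
          sum_distrib_left[of "d * a m k"] sum.distrib[symmetric]
        by (intro sum.cong refl) (simp add: tw_row[unfolded mm] coef_def[symmetric] algebra_simps)
      then show ?thesis using psi_left[OF m(1,2), of k'] k' by (auto simp: mm algebra_simps)
    qed
  next
    case False
    have "phi (tw m k c d) (N m' k') m' = y m' k'"
    proof (rule t.phi_unique[symmetric])
      show "y m' k' i = 0" if "m' \<le> i" for i
        using phi_supp[OF m, of i] phi_supp[OF _ k', of i] m' that False by (simp add: y_def)
    qed (use yev ylast m' k' False in auto)
    then have "coef (tw m k c d) N m' k' = (\<Sum>j<m'. tw m k c d m' j * y m' k' j)"
      by (simp add: coef_def)
    also have "\<dots> = a m' k'"
      unfolding y_def using tw_apply[OF m c, of m' k' m'] phi_supp[OF m, of m'] m' k' False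
      by (simp add: coef_def)
    finally show ?thesis using False by simp
  qed
qed

text \<open>With X' the conjugate, X' P - P X' is expressed by the original X. This is the vector
  field at the twisted point, ready to be compared with the t-derivative of
  \<open>tw\<close>.\<close>

lemma tw_deriv_algebra:
  assumes m: "m \<le> n" "k < m" and c: "c + d + c * d = 0"
  shows "(\<Sum>l<m. tw m k c d i l * \<phi> m k l) * \<psi> m k j - \<phi> m k i * (\<Sum>l<m. \<psi> m k l * tw m k c d l j) =
    - (1 + c) * \<phi> m k i * (\<Sum>l<m. \<psi> m k l * X l j)
     + (1 + d) * (\<Sum>l<m. X i l * \<phi> m k l) * \<psi> m k j + (c - d) * N m k * \<phi> m k i * \<psi> m k j"
proof -
  let ?u = "\<lambda>i. \<Sum>l<m. X i l * \<phi> m k l" and ?l = "\<lambda>j. \<Sum>l<m. \<psi> m k l * X l j"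
  have lphi: "(\<Sum>l<m. ?l l * \<phi> m k l) = N m k"
  proof -
    have "(\<Sum>l<m. ?l l * \<phi> m k l) = (\<Sum>l<m. N m k * (\<psi> m k l * \<phi> m k l))"
      by (intro sum.cong refl) (use psi_col[OF m] in simp)
    then show ?thesis by (simp add: sum_distrib_left[symmetric] psi_phi_sum[OF m])
  qed
  have psiu: "(\<Sum>l<m. \<psi> m k l * ?u l) = N m k"
  proof -
    have "(\<Sum>l<m. \<psi> m k l * ?u l) = (\<Sum>l<m. N m k * (\<psi> m k l * \<phi> m k l))"
      by (intro sum.cong refl) (use phi_row[OF m] in simp)
    then show ?thesis by (simp add: sum_distrib_left[symmetric] psi_phi_sum[OF m])
  qed
  have "(\<Sum>l<m. tw m k c d i l * \<phi> m k l) = ?u i + c * \<phi> m k i * (\<Sum>l<m. ?l l * \<phi> m k l)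
     + (d * ?u i + c * d * N m k * \<phi> m k i) * (\<Sum>l<m. \<psi> m k l * \<phi> m k l)"
    unfolding sum_distrib_left[of "c * \<phi> m k i"] sum_distrib_left[of "d * ?u i + c * d * N m k * \<phi> m k i"]
      sum.distrib[symmetric]
    by (intro sum.cong refl) (simp add: tw_def algebra_simps)
  then have 1: "(\<Sum>l<m. tw m k c d i l * \<phi> m k l) = (1 + d) * ?u i + (c + c * d) * N m k * \<phi> m k i"
    unfolding lphi psi_phi_sum[OF m] by (simp add: algebra_simps)
  have "(\<Sum>l<m. \<psi> m k l * tw m k c d l j) = ?l j + (c * ?l j + c * d * N m k * \<psi> m k j) * (\<Sum>l<m. \<psi> m k l * \<phi> m k l)
     + d * \<psi> m k j * (\<Sum>l<m. \<psi> m k l * ?u l)"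
    unfolding sum_distrib_left[of "c * ?l j + c * d * N m k * \<psi> m k j"] sum_distrib_left[of "d * \<psi> m k j"]
      sum.distrib[symmetric]
    by (intro sum.cong refl) (simp add: tw_def algebra_simps)
  then have 2: "(\<Sum>l<m. \<psi> m k l * tw m k c d l j) = (1 + c) * ?l j + (d + c * d) * N m k * \<psi> m k j"
    unfolding psiu psi_phi_sum[OF m] by (simp add: algebra_simps)
  have "c + c * d = (c + d + c * d) - d" "d + c * d = (c + d + c * d) - c" by simp_all
  then have "c + c * d = - d" "d + c * d = - c" unfolding c by simp_all
  then show ?thesis unfolding 1 2 by (simp add: algebra_simps)
qed

section \<open>Reconstruction from the spectra and the coefficients\<close>

text \<open>The eigenvectors form a basis of the first m coordinates, so a row is determined by its
  values on them.\<close>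

lemma row_eqI:
  assumes m: "m \<le> n" and "\<And>k. k < m \<Longrightarrow> (\<Sum>i<m. w i * \<phi> m k i) = (\<Sum>i<m. w' i * \<phi> m k i)" and i: "i < m"
  shows "w i = w' i"
proof -
  have W: "(\<Sum>l<m. \<psi> m l i * \<phi> m l j) = (if i = j then 1 else 0)" if "i < m" "j < m" for i j
    using psi_right[OF m that(2,1)] by (cases "i = j") (auto simp: mult.commute)
  have "v i = (\<Sum>k<m. \<psi> m k i * (\<Sum>i<m. v i * \<phi> m k i))" for v
    by (rule left_inverse_solve[where A = "\<lambda>k i. \<phi> m k i" and W = "\<lambda>i k. \<psi> m k i", OF W])
      (use i in \<open>auto simp: mult.commute\<close>)
  from this[of w] this[of w'] show ?thesis using assms(2) by simp
qed

text \<open>Coordinates, in the eigenvector basis of block m, of the column that is added in block m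
  + 1.\<close>

definition ucoef :: "nat \<Rightarrow> nat \<Rightarrow> complex" where
  "ucoef m k = (\<Sum>i<m. \<psi> m k i * X i m)"

lemma col_expand:
  assumes "m < n" "i < m"
  shows "X i m = (\<Sum>k<m. \<phi> m k i * ucoef m k)"
  unfolding ucoef_def by (rule expand) (use assms in auto)

text \<open>Pairing the first m rows of the eigenvector equation of block m + 1 with
  \<open>\<psi> m k\<close> gives (N' - N_k) c_k = u_k for the coordinate c_k; the last coordinate 1
  brings in the new column.\<close>

lemma phi_Suc_expand:
  assumes m: "m < n" "j \<le> m" and i: "i < m"
  shows "\<phi> (Suc m) j i = (\<Sum>k<m. \<phi> m k i * (ucoef m k / (N (Suc m) j - N m k)))"
proof -
  have m': "m \<le> n" "Suc m \<le> n" "j < Suc m" using m by auto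
  have "(\<Sum>i<m. \<psi> m k i * \<phi> (Suc m) j i) = ucoef m k / (N (Suc m) j - N m k)" if k: "k < m" for k
  proof -
    have row: "(\<Sum>j'<m. X i j' * \<phi> (Suc m) j j') + X i m = N (Suc m) j * \<phi> (Suc m) j i" if "i < m" for i
      using phi_row[OF m'(2,3), of i] phi_last[OF m'(2,3)] that by simp
    have "N (Suc m) j * (\<Sum>i<m. \<psi> m k i * \<phi> (Suc m) j i) =
        (\<Sum>i<m. \<psi> m k i * ((\<Sum>j'<m. X i j' * \<phi> (Suc m) j j') + X i m))"
      unfolding sum_distrib_left by (intro sum.cong refl) (simp add: row)
    also have "\<dots> = (\<Sum>j'<m. (\<Sum>i<m. \<psi> m k i * X i j') * \<phi> (Suc m) j j') + ucoef m k"
      unfolding distrib_left sum.distrib ucoef_def sum_distrib_left sum_distrib_right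
      by (subst sum.swap) (simp add: mult_ac)
    also have "(\<Sum>j'<m. (\<Sum>i<m. \<psi> m k i * X i j') * \<phi> (Suc m) j j') =
        N m k * (\<Sum>i<m. \<psi> m k i * \<phi> (Suc m) j i)"
      unfolding sum_distrib_left[of "N m k"]
      by (intro sum.cong refl) (use psi_col[OF m'(1) k] in simp)
    finally show ?thesis using sep[OF m(1) k m(2)] by (simp add: field_simps)
  qed
  then show ?thesis using expand[OF m'(1) i, of "\<phi> (Suc m) j"] by simp
qed

text \<open>The last row of the same equation, with \<open>phi_Suc_expand\<close> inserted. The
  spectra being known, it is linear in the products \<open>a m k * ucoef m k\<close> and the corner,
  with a Cauchy matrix bordered by a column of ones.\<close>

lemma cauchy_system:
  assumes m: "m < n" "j \<le> m"
  shows "(\<Sum>k<m. a m k * ucoef m k / (N (Suc m) j - N m k)) + X m m = N (Suc m) j"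
proof -
  have m': "m \<le> n" "Suc m \<le> n" "j < Suc m" using m by auto
  have "N (Suc m) j = (\<Sum>i<m. X m i * \<phi> (Suc m) j i) + X m m"
    using phi_row[OF m'(2,3), of m] phi_last[OF m'(2,3)] by simp
  also have "(\<Sum>i<m. X m i * \<phi> (Suc m) j i) =
      (\<Sum>i<m. \<Sum>k<m. X m i * \<phi> m k i * (ucoef m k / (N (Suc m) j - N m k)))"
    by (intro sum.cong refl) (simp add: phi_Suc_expand[OF m] sum_distrib_left mult.assoc)
  also have "\<dots> = (\<Sum>k<m. a m k * ucoef m k / (N (Suc m) j - N m k))"
    by (subst sum.swap) (simp add: coef_def sum_distrib_right sum_divide_distrib)
  finally show ?thesis by simp
qed

end

text \<open>The polynomial \<open>p\<close> is the numerator of d + sum of b_k / (x - nu_k) over the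
  common denominator. Its degree is at most m and it vanishes at the m + 1 points mu_j, so it is
  zero; its value at nu_k is a nonzero multiple of b_k.\<close>

lemma cauchy_injective:
  fixes \<mu> \<nu> b :: "nat \<Rightarrow> complex"
  assumes \<mu>: "inj_on \<mu> {..m}" and \<nu>: "inj_on \<nu> {..<m}"
    and ne: "\<And>j k. j \<le> m \<Longrightarrow> k < m \<Longrightarrow> \<mu> j \<noteq> \<nu> k"
    and eq: "\<And>j. j \<le> m \<Longrightarrow> (\<Sum>k<m. b k / (\<mu> j - \<nu> k)) + d = 0"
  shows "d = 0" and "k < m \<Longrightarrow> b k = 0"
proof -
  define q where "q S = (\<Prod>k\<in>S. [:- \<nu> k, 1:])" for S
  define p where "p = Polynomial.smult d (q {..<m}) + (\<Sum>k<m. Polynomial.smult (b k) (q ({..<m} - {k})))"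
  have degq: "degree (q S) \<le> card S" if "finite S" for S
    using degree_prod_sum_le[OF that, of "\<lambda>k. [:- \<nu> k, 1:]"] by (simp add: q_def)
  have qpoly: "poly (q S) x = (\<Prod>k\<in>S. x - \<nu> k)" for S x
    by (simp add: q_def poly_prod)
  have degp: "degree p \<le> m"
    unfolding p_def
  proof (intro degree_add_le degree_sum_le order.trans[OF degree_smult_le] finite_lessThan)
    show "degree (q {..<m}) \<le> m" using degq[of "{..<m}"] by simp
    show "degree (q ({..<m} - {k})) \<le> m" if "k \<in> {..<m}" for k
      using degq[of "{..<m} - {k}"] that by simp
  qed
  have root: "poly p (\<mu> j) = 0" if j: "j \<le> m" for j
  proof -
    have "poly (q ({..<m} - {k})) (\<mu> j) = poly (q {..<m}) (\<mu> j) / (\<mu> j - \<nu> k)" if "k < m" for k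
      using that ne[OF j that] by (simp add: qpoly prod.remove[of "{..<m}" k])
    then have "poly p (\<mu> j) = poly (q {..<m}) (\<mu> j) * ((\<Sum>k<m. b k / (\<mu> j - \<nu> k)) + d)"
      by (simp add: p_def poly_sum distrib_left sum_distrib_left mult_ac)
    then show ?thesis using eq[OF j] by simp
  qed
  have "p = 0"
  proof (rule ccontr)
    assume p: "p \<noteq> 0"
    have "card (\<mu> ` {..m}) \<le> card {x. poly p x = 0}"
      by (rule card_mono[OF poly_roots_finite[OF p]]) (use root in auto)
    also have "\<dots> \<le> m" using card_poly_roots_bound[OF p] degp by simp
    finally show False using \<mu> by (simp add: card_image)
  qed
  have b: "b k = 0" if k: "k < m" for k
  proof -
    have q0: "poly (q S) (\<nu> k) = 0" if "k \<in> S" "finite S" for S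
      using that by (auto simp: qpoly)
    have "poly p (\<nu> k) = (\<Sum>l<m. b l * poly (q ({..<m} - {l})) (\<nu> k))"
      using k by (simp add: p_def poly_sum q0)
    also have "\<dots> = (\<Sum>l<m. if l = k then b k * poly (q ({..<m} - {k})) (\<nu> k) else 0)"
      by (intro sum.cong refl) (use k in \<open>auto intro!: q0\<close>)
    finally have "b k * poly (q ({..<m} - {k})) (\<nu> k) = 0" using \<open>p = 0\<close> k by simp
    moreover have "poly (q ({..<m} - {k})) (\<nu> k) \<noteq> 0"
      using \<nu> k by (auto simp: qpoly inj_on_def)
    ultimately show ?thesis by simp
  qed
  then show "k < m \<Longrightarrow> b k = 0" .
  show "d = 0" using eq[of 0] b by simp
qed

lemma (in gz) cauchy_injective':
  assumes m: "m < n" and eq: "\<And>j. j \<le> m \<Longrightarrow> (\<Sum>k<m. b k / (N (Suc m) j - N m k)) + d = 0"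
  shows "d = 0" "k < m \<Longrightarrow> b k = 0"
proof -
  have "inj_on (N (Suc m)) {..m}" using inj[of "Suc m"] m by (simp add: lessThan_Suc_atMost)
  note ci = cauchy_injective[OF this inj[OF less_imp_le[OF m]] _ eq]
  have ne: "N (Suc m) j \<noteq> N m k" if "j \<le> m" "k < m" for j k using sep[OF m that(2,1)] by simp
  show "d = 0" by (rule ci(1)) (rule ne)
  show "k < m \<Longrightarrow> b k = 0" by (rule ci(2)) (rule ne)
qed

text \<open>Once the blocks of size m agree, so do their eigenvectors, and \<open>row_eqI\<close>
  gives equal new rows. Subtracting the two Cauchy systems leaves a homogeneous one, which forces
  equal columns and corners because no coefficient vanishes.\<close>

lemma coef_determines:
  assumes X: "gz n X N" and Y: "gz n Y N"
    and a: "\<And>m k. m < n \<Longrightarrow> k < m \<Longrightarrow> coef X N m k = coef Y N m k"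
  shows "m \<le> n \<Longrightarrow> i < m \<Longrightarrow> j < m \<Longrightarrow> X i j = Y i j"
proof (induction m arbitrary: i j)
  case (Suc m)
  interpret x: gz n X N by (rule X)
  interpret y: gz n Y N by (rule Y)
  have m: "m < n" "m \<le> n" using Suc.prems by auto
  have IH: "X i j = Y i j" if "i < m" "j < m" for i j using Suc.IH m that by simp
  have phi: "phi X c m = phi Y c m" for c by (rule phi_cong) (rule IH)
  have psi: "psi X N m = psi Y N m" by (rule psi_cong) (auto simp: IH)
  have row: "X m i = Y m i" if "i < m" for i
    by (rule x.row_eqI[OF m(2) _ that]) (use a[OF m(1)] in \<open>simp add: coef_def phi\<close>)
  have "(\<Sum>k<m. coef X N m k * (x.ucoef m k - y.ucoef m k) / (N (Suc m) j - N m k)) + (X m m - Y m m) = 0"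
    if "j \<le> m" for j
    using x.cauchy_system[OF m(1) that] y.cauchy_system[OF m(1) that]
    by (simp add: a[OF m(1)] algebra_simps diff_divide_distrib sum_subtractf)
  note * = x.cauchy_injective'[OF m(1), of "\<lambda>k. coef X N m k * (x.ucoef m k - y.ucoef m k)", OF this]
  have "x.ucoef m k = y.ucoef m k" if "k < m" for k
    using *(2)[of k] that x.coef_nonzero[OF m(1) that] by simp
  then have col: "X i m = Y i m" if "i < m" for i
    using x.col_expand[OF m(1) that] y.col_expand[OF m(1) that] by (simp add: phi)
  show ?case using Suc.prems IH row col *(1) by (auto simp: less_Suc_eq)
qed simp

text \<open>Surjectivity: the block is enlarged one row and column at a time, reading
  \<open>phi_Suc_expand\<close> and \<open>cauchy_system\<close> backwards.\<close>

lemma coef_realize: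
  assumes inj: "\<And>m. m \<le> n \<Longrightarrow> inj_on (N m) {..<m}"
    and sep: "\<And>m k l. m < n \<Longrightarrow> k < m \<Longrightarrow> l \<le> m \<Longrightarrow> N m k \<noteq> N (Suc m) l"
    and s: "\<And>m k. m < n \<Longrightarrow> k < m \<Longrightarrow> s m k \<noteq> 0"
  shows "M \<le> n \<Longrightarrow> \<exists>X. gz M X N \<and> (\<forall>m<M. \<forall>k<m. coef X N m k = s m k)"
proof (induction M)
  case 0
  then show ?case by (auto simp: gz_def)
next
  case (Suc m)
  then obtain X where X: "gz m X N" "\<forall>m'<m. \<forall>k<m'. coef X N m' k = s m' k" by auto
  interpret gz m X N by (rule X(1))
  have m: "m < n" "m \<le> n" using Suc.prems by auto
  \<comment> \<open>A square system with trivial kernel is solvable; here b_k will be the product of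
    the coefficient and the column coordinate, and d the corner.\<close>
  obtain b d where bd: "\<And>j. j \<le> m \<Longrightarrow> (\<Sum>k<m. b k / (N (Suc m) j - N m k)) + d = N (Suc m) j"
  proof -
    define A where "A j k = (if k < m then 1 / (N (Suc m) j - N m k) else 1)" for j k
    have Ay: "(\<Sum>k<Suc m. A j k * y k) = (\<Sum>k<m. y k / (N (Suc m) j - N m k)) + y m" for j y
      by (simp add: A_def)
    have "inj_on (N (Suc m)) {..m}" using assms(1)[of "Suc m"] m by (simp add: lessThan_Suc_atMost)
    note ci = cauchy_injective[OF this assms(1)[OF m(2)]]
    have "\<forall>k<Suc m. y k = 0" if "\<forall>j<Suc m. (\<Sum>k<Suc m. A j k * y k) = 0" for y
    proof -
      have e: "(\<Sum>k<m. y k / (N (Suc m) j - N m k)) + y m = 0" if "j \<le> m" for j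
        using \<open>\<forall>j<Suc m. _\<close>[unfolded Ay] that by auto
      have n: "N (Suc m) j \<noteq> N m k" if "j \<le> m" "k < m" for j k using assms(2)[OF m(1) that(2,1)] by simp
      show ?thesis using ci(1)[OF n e] ci(2)[OF n e] by (auto simp: less_Suc_eq)
    qed
    from two_sided_inverse[of "Suc m" A, OF this] obtain W where
      W: "\<forall>i<Suc m. \<forall>j<Suc m. (\<Sum>l<Suc m. A i l * W l j) = (if i = j then 1 else 0)" by blast
    let ?y = "\<lambda>k. \<Sum>l<Suc m. W k l * N (Suc m) l"
    have "(\<Sum>k<Suc m. A j k * ?y k) = N (Suc m) j" if "j \<le> m" for j
      by (rule right_inverse_solve[of "Suc m" A W]) (use W that in auto)
    then show ?thesis unfolding Ay using that[of ?y "?y m"] by simp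
  qed
  \<comment> \<open>The column has coordinates b_k / s_k in the eigenvector basis, so that the
    products in the Cauchy system are b_k. The row is the combination of the dual basis that takes
    the value s_k on eigenvector k.\<close>
  define Y where "Y i j = (if i < m \<and> j < m then X i j
      else if i < m then (\<Sum>k<m. \<phi> m k i * (b k / s m k))
      else if j < m then (\<Sum>k<m. s m k * \<psi> m k j) else d)" for i j
  have Yblock: "Y i j = X i j" if "i < m" "j < m" for i j using that by (simp add: Y_def)
  have phiY: "phi Y c m' = phi X c m'" if "m' \<le> m" for c m'
    by (rule phi_cong) (use that in \<open>simp add: Yblock\<close>)
  have coefY: "(\<Sum>i<m. Y m i * \<phi> m k i) = s m k" if k: "k < m" for k
  proof -
    have "(\<Sum>i<m. Y m i * \<phi> m k i) = (\<Sum>i<m. \<Sum>l<m. s m l * (\<psi> m l i * \<phi> m k i))"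
      by (intro sum.cong refl) (simp add: Y_def sum_distrib_right mult.assoc)
    also have "\<dots> = (\<Sum>l<m. s m l * (if l = k then 1 else 0))"
      by (subst sum.swap, intro sum.cong refl)
        (use psi_left k in \<open>simp add: sum_distrib_left[symmetric]\<close>)
    also have "\<dots> = s m k" using k by (simp add: if_distrib cong: if_cong)
    finally show ?thesis .
  qed
  have eY: "\<exists>f. eigvec (Suc m) Y (N (Suc m) j) f \<and> (\<exists>i<Suc m. f i \<noteq> 0)" if j: "j \<le> m" for j
  proof -
    \<comment> \<open>The eigenvector predicted by \<open>phi_Suc_expand\<close>, with last
      coordinate 1.\<close>
    define f where "f i = (if i < m then \<Sum>k<m. \<phi> m k i * (b k / s m k / (N (Suc m) j - N m k)) else 1)" for i
    have "(\<Sum>j'<m. Y i j' * f j') + Y i m * f m = N (Suc m) j * f i" if i: "i < m" for i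
    proof -
      have "(\<Sum>j'<m. Y i j' * f j') = (\<Sum>j'<m. \<Sum>k<m. X i j' * \<phi> m k j' * (b k / s m k / (N (Suc m) j - N m k)))"
        using i by (intro sum.cong refl) (simp add: Yblock f_def sum_distrib_left mult.assoc)
      also have "\<dots> = (\<Sum>k<m. N m k * \<phi> m k i * (b k / s m k / (N (Suc m) j - N m k)))"
        by (subst sum.swap, intro sum.cong refl)
          (use phi_row i in \<open>simp only: sum_distrib_right[symmetric] lessThan_iff order_refl\<close>)
      finally have "(\<Sum>j'<m. Y i j' * f j') + Y i m * f m =
          (\<Sum>k<m. N m k * \<phi> m k i * (b k / s m k / (N (Suc m) j - N m k)) + \<phi> m k i * (b k / s m k))"
        using i by (simp add: Y_def f_def sum.distrib)
      also have "\<dots> = (\<Sum>k<m. N (Suc m) j * (\<phi> m k i * (b k / s m k / (N (Suc m) j - N m k))))"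
      proof (intro sum.cong refl)
        fix k assume "k \<in> {..<m}"
        then have "N (Suc m) j - N m k \<noteq> 0" using assms(2)[OF m(1), of k j] j by auto
        moreover have "x * p * (q / D) + p * q = (x + D) * (p * (q / D))" if "D \<noteq> 0" for x p q D :: complex
          using that by (simp add: field_simps)
        ultimately show "N m k * \<phi> m k i * (b k / s m k / (N (Suc m) j - N m k)) + \<phi> m k i * (b k / s m k) =
            N (Suc m) j * (\<phi> m k i * (b k / s m k / (N (Suc m) j - N m k)))"
          by (metis add_diff_cancel_left' add.commute diff_add_cancel)
      qed
      also have "\<dots> = N (Suc m) j * f i" using i by (simp add: f_def sum_distrib_left)
      finally show ?thesis .
    qed
    moreover have "(\<Sum>j'<m. Y m j' * f j') + Y m m * f m = N (Suc m) j * f m"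
    proof -
      have "(\<Sum>j'<m. Y m j' * f j') = (\<Sum>j'<m. \<Sum>k<m. Y m j' * \<phi> m k j' * (b k / s m k / (N (Suc m) j - N m k)))"
        by (intro sum.cong refl) (simp add: f_def sum_distrib_left mult.assoc)
      also have "\<dots> = (\<Sum>k<m. s m k * (b k / s m k / (N (Suc m) j - N m k)))"
        by (subst sum.swap, intro sum.cong refl)
          (use coefY in \<open>simp only: sum_distrib_right[symmetric] lessThan_iff\<close>)
      also have "\<dots> = (\<Sum>k<m. b k / (N (Suc m) j - N m k))"
        using s[OF m(1)] by (intro sum.cong refl) simp
      finally show ?thesis using bd[OF j] by (simp add: f_def Y_def)
    qed
    ultimately have "eigvec (Suc m) Y (N (Suc m) j) f" by (simp add: eigvec_Suc)
    moreover have "f m \<noteq> 0" by (simp add: f_def)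
    ultimately show ?thesis by blast
  qed
  have "gz (Suc m) Y N"
  proof
    fix m' assume m': "m' \<le> Suc m"
    then show "inj_on (N m') {..<m'}" using assms(1) m by simp
    fix k assume k: "k < m'"
    show "\<exists>f. eigvec m' Y (N m' k) f \<and> (\<exists>i<m'. f i \<noteq> 0)"
    proof (cases "m' = Suc m")
      case True
      then show ?thesis using eY[of k] k by simp
    next
      case False
      then have "m' \<le> m" using m' by simp
      then show ?thesis using ev[OF _ k] eigvec_cong[of m' Y X] Yblock by simp
    qed
  next
    fix m' k l assume "m' < Suc m" "k < m'" "l \<le> m'"
    then show "N m' k \<noteq> N (Suc m') l" using assms(2)[of m' k l] m by simp
  qed
  moreover have "coef Y N m' k = s m' k" if "m' < Suc m" "k < m'" for m' k
  proof (cases "m' = m")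
    case True
    then show ?thesis using coefY that by (simp add: coef_def phiY)
  next
    case False
    then have "coef Y N m' k = coef X N m' k"
      using that by (simp add: coef_def phiY Yblock)
    then show ?thesis using X(2) that False by simp
  qed
  ultimately show ?case by blast
qed

section \<open>Flows of the eigenvalue functions\<close>

text \<open>Restricting real and imaginary parts to the ray from 0 through q reduces this to
  functions of a real variable.\<close>

lemma zero_derivative_constant:
  fixes f :: "complex \<Rightarrow> complex"
  assumes "\<And>q. (f has_field_derivative 0) (at q)"
  shows "f q = f 0"
proof -
  have const: "L (f q) = L (f 0)" if L: "bounded_linear L" for L :: "complex \<Rightarrow> real"
  proof -
    have "((\<lambda>t. L (f (of_real t * q))) has_real_derivative 0) (at t)" for t :: real
    proof -
      have f': "(f has_derivative (\<lambda>_. 0)) (at p)" for p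
        using assms[of p] by (simp add: has_field_derivative_def lambda_zero)
      have "((\<lambda>t. of_real t * q) has_derivative (\<lambda>t. of_real t * q)) (at t)"
        by (auto intro!: derivative_eq_intros)
      from bounded_linear.has_derivative[OF L has_derivative_compose[OF this f']]
      show ?thesis
        using bounded_linear.linear[OF L] by (simp add: has_field_derivative_def linear_0 lambda_zero)
    qed
    from DERIV_isconst_all[of "\<lambda>t. L (f (of_real t * q))", of 1 0] this show ?thesis by simp
  qed
  show ?thesis
    using const[OF bounded_linear_Re] const[OF bounded_linear_Im] by (simp add: complex_eq_iff)
qed

lemma exp_ode_zero:
  fixes w :: "complex \<Rightarrow> complex"
  assumes w: "\<And>q. (w has_field_derivative s * w q) (at q)" and "w 0 = 0"
  shows "w q = 0"
proof -
  have "((\<lambda>q. exp (- s * q) * w q) has_field_derivative 0) (at q)" for q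
    by (rule derivative_eq_intros w refl | simp)+
  from zero_derivative_constant[OF this, of q] show ?thesis using assms(2) by simp
qed

lemma tri_index_Suc_ex:
  assumes "j \<in> {1..tri n}"
  shows "\<exists>m k. m \<le> n \<and> k < m \<and> j = Suc (tri (m - 1) + k)"
proof -
  from assms obtain i where "j = Suc i" "i < tri n" by (cases j) auto
  then show ?thesis using tri_index_ex[of i n] by simp
qed

lemma tri_index_Suc_in: "m \<le> n \<Longrightarrow> k < m \<Longrightarrow> Suc (tri (m - 1) + k) \<in> {1..tri n}"
  using tri_index_less[of m n k] by (simp del: One_nat_def)

lemma r_fun_level: "r_fun (Suc (tri (m - 1) + k)) = (\<lambda>z. level (fst z) m k)"
  by (simp add: fun_eq_iff r_fun_def level_def)

section \<open>Explicit integral curves and their uniqueness\<close>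

definition twist :: "nat \<Rightarrow> nat \<Rightarrow> nat \<Rightarrow> complex \<Rightarrow> complex \<Rightarrow> point \<Rightarrow> point" where
  "twist n m k c d z = (fst z, mat n n (\<lambda>(i, j). gz.tw (entry (snd z)) (level (fst z)) m k c d i j))"

lemma fst_twist [simp]: "fst (twist n m k c d z) = fst z"
  by (simp add: twist_def)

lemma entry_twist: "i < n \<Longrightarrow> j < n \<Longrightarrow>
    entry (snd (twist n m k c d z)) i j = gz.tw (entry (snd z)) (level (fst z)) m k c d i j"
  by (simp add: twist_def entry_def)

lemma coef_cong:
  assumes "\<And>i j. i \<le> m \<Longrightarrow> j \<le> m \<Longrightarrow> X i j = Y i j" "N m k = N' m k"
  shows "coef X N m k = coef Y N' m k"
  using phi_cong[of m X Y] assms by (simp add: coef_def)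

lemma twist_in:
  assumes z: "z \<in> M_Omega_e n" and "m \<le> n" "k < m" "c + d + c * d = 0"
  shows "twist n m k c d z \<in> M_Omega_e n"
proof -
  interpret gz n "entry (snd z)" "level (fst z)" by (rule M_Omega_e_gz[OF z])
  have "gz n (entry (snd (twist n m k c d z))) (level (fst z))"
    by (rule gz_cong[OF tw_gz[OF assms(2-4)]]) (auto simp: entry_twist)
  then show ?thesis
    using M_Omega_e_vec[OF z] mem_M_Omega_e[of "fst z" "snd (twist n m k c d z)" n]
    by (simp add: twist_def)
qed

lemma scoef_twist:
  assumes z: "z \<in> M_Omega_e n" and "m \<le> n" "k < m" "c + d + c * d = 0" and m': "m' < n" "k' < m'"
  shows "scoef m' k' (twist n m k c d z) =
    (if m' = m \<and> k' = k then (1 + d) * scoef m k z else scoef m' k' z)"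
proof -
  interpret gz n "entry (snd z)" "level (fst z)" by (rule M_Omega_e_gz[OF z])
  have "scoef m' k' (twist n m k c d z) = coef (tw m k c d) (level (fst z)) m' k'"
    unfolding scoef_def by (rule coef_cong) (use m' in \<open>auto simp: entry_twist\<close>)
  then show ?thesis using tw_coef[OF assms(2-6)] by (simp add: scoef_def)
qed

lemma twist_0:
  assumes z: "z \<in> M_Omega_e n"
  shows "twist n m k 0 0 z = z"
proof -
  interpret gz n "entry (snd z)" "level (fst z)" by (rule M_Omega_e_gz[OF z])
  have "mat n n (\<lambda>(i, j). tw m k 0 0 i j) = snd z"
    using M_Omega_e_mat[OF z] by (intro eq_matI) (auto simp: tw_def entry_def)
  then show ?thesis by (simp add: twist_def)
qed

text \<open>Since P is idempotent, exp(-t P) = 1 + (exp(-t) - 1) P, and likewise for the inverse;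
  this is the origin of the two parameters.\<close>

lemma integral_curve_twist:
  assumes n: "1 \<le> n" and z: "z \<in> M_Omega_e n" and m: "m \<le> n" "k < m"
  shows "integral_curve n (\<lambda>z. level (fst z) m k) (\<lambda>t. twist n m k (exp (- t) - 1) (exp t - 1) z)"
proof -
  interpret gz n "entry (snd z)" "level (fst z)" by (rule M_Omega_e_gz[OF z])
  have c: "(exp (- t) - 1) + (exp t - 1) + (exp (- t) - 1) * (exp t - 1) = 0" for t :: complex
    by (simp add: algebra_simps exp_minus_inverse exp_minus)
  let ?\<gamma> = "\<lambda>t. twist n m k (exp (- t) - 1) (exp t - 1) z"
  have in_M: "?\<gamma> q \<in> M_Omega_e n" for q by (rule twist_in[OF z m c])
  have "((\<lambda>t. co (?\<gamma> t)) has_field_derivative bracket n (\<lambda>z. level (fst z) m k) co (?\<gamma> q)) (at q)"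
    if "co \<in> point_coords n" for co q
    using that
  proof (cases rule: point_coords_cases)
    case (1 m' k')
    show ?thesis
      unfolding 1(3) bracket_level_level[OF n in_M m 1(1,2)] by simp
  next
    case (2 i j)
    let ?c = "exp (- q) - 1" and ?d = "exp q - 1"
    have blk: "entry (snd (?\<gamma> q)) i j = entry (snd z) i j" if "i < m" "j < m" for i j
      using that m tw_block[OF m c that] by (simp add: entry_twist)
    have phi: "phi (entry (snd (?\<gamma> q))) e m = phi (entry (snd z)) e m" for e
      by (rule phi_cong) (rule blk)
    have psi: "psi (entry (snd (?\<gamma> q))) (level (fst z)) m = psi (entry (snd z)) (level (fst z)) m"
      by (rule psi_cong) (rule blk, simp_all)
    have s1: "(\<Sum>l<m. entry (snd (?\<gamma> q)) i l * \<phi> m k l) = (\<Sum>l<m. tw m k ?c ?d i l * \<phi> m k l)"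
      by (intro sum.cong refl) (use 2 m in \<open>simp add: entry_twist\<close>)
    have s2: "(\<Sum>l<m. \<psi> m k l * entry (snd (?\<gamma> q)) l j) = (\<Sum>l<m. \<psi> m k l * tw m k ?c ?d l j)"
      by (intro sum.cong refl) (use 2 m in \<open>simp add: entry_twist\<close>)
    have br: "bracket n (\<lambda>z. level (fst z) m k) co (?\<gamma> q) =
      - (1 + ?c) * \<phi> m k i * (\<Sum>l<m. \<psi> m k l * entry (snd z) l j)
      + (1 + ?d) * (\<Sum>l<m. entry (snd z) i l * \<phi> m k l) * \<psi> m k j
      + (?c - ?d) * level (fst z) m k * \<phi> m k i * \<psi> m k j"
      unfolding 2(3) bracket_level_entry[OF n in_M m 2(1,2)] fst_twist phi psi s1 s2
      by (rule tw_deriv_algebra[OF m c])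
    have "((\<lambda>t. tw m k (exp (- t) - 1) (exp t - 1) i j) has_field_derivative
        - exp (- q) * \<phi> m k i * (\<Sum>l<m. \<psi> m k l * entry (snd z) l j)
        + exp q * (\<Sum>l<m. entry (snd z) i l * \<phi> m k l) * \<psi> m k j
        + (- exp (- q) * (exp q - 1) + (exp (- q) - 1) * exp q) * level (fst z) m k * \<phi> m k i * \<psi> m k j) (at q)"
      unfolding tw_def by (auto intro!: derivative_eq_intros simp: algebra_simps)
    moreover have "- exp (- q) * (exp q - 1) + (exp (- q) - 1) * exp q = ?c - ?d"
      by (simp add: algebra_simps)
    ultimately show ?thesis
      unfolding br by (simp add: 2 entry_twist)
  qed
  then show ?thesis using in_M by (simp add: integral_curve_def)
qed

text \<open>The eigenvalues are constant because they Poisson commute. The m by m block is constant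
  because it commutes with its own spectral projection. Hence phi and psi may be taken at time 0,
  and the equation for the entries has constant coefficients.\<close>

lemma integral_curve_structure:
  assumes n: "1 \<le> n" and m: "m \<le> n" "k < m"
    and \<gamma>: "integral_curve n (\<lambda>z. level (fst z) m k) \<gamma>"
  defines "X \<equiv> entry (snd (\<gamma> 0))" and "N \<equiv> level (fst (\<gamma> 0))"
  shows "fst (\<gamma> q) = fst (\<gamma> 0)"
    and "i < m \<Longrightarrow> j < m \<Longrightarrow> entry (snd (\<gamma> q)) i j = X i j"
    and "i < n \<Longrightarrow> j < n \<Longrightarrow> ((\<lambda>t. entry (snd (\<gamma> t)) i j) has_field_derivative
      (\<Sum>l<m. entry (snd (\<gamma> q)) i l * phi X (N m k) m l) * psi X N m k j -
      phi X (N m k) m i * (\<Sum>l<m. psi X N m k l * entry (snd (\<gamma> q)) l j)) (at q)"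
proof -
  have in_M: "\<gamma> q \<in> M_Omega_e n" for q using \<gamma> by (simp add: integral_curve_def)
  have D: "((\<lambda>t. c (\<gamma> t)) has_field_derivative bracket n (\<lambda>z. level (fst z) m k) c (\<gamma> q)) (at q)"
    if "c \<in> point_coords n" for c q
    using \<gamma> that by (simp add: integral_curve_def)
  show F: "fst (\<gamma> q) = fst (\<gamma> 0)" for q
  proof (rule levels_eqI[OF M_Omega_e_vec[OF in_M] M_Omega_e_vec[OF in_M]])
    fix m' k' assume mk: "m' \<le> n" "k' < m'"
    have "((\<lambda>t. level (fst (\<gamma> t)) m' k') has_field_derivative 0) (at q)" for q
      using D[OF level_coord[OF mk], of q] by (simp add: bracket_level_level[OF n in_M m mk])
    then show "level (fst (\<gamma> q)) m' k' = level (fst (\<gamma> 0)) m' k'" by (rule zero_derivative_constant)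
  qed
  have E: "((\<lambda>t. entry (snd (\<gamma> t)) i j) has_field_derivative
      (\<Sum>l<m. entry (snd (\<gamma> q)) i l * phi (entry (snd (\<gamma> q))) (N m k) m l) * psi (entry (snd (\<gamma> q))) N m k j -
      phi (entry (snd (\<gamma> q))) (N m k) m i * (\<Sum>l<m. psi (entry (snd (\<gamma> q))) N m k l * entry (snd (\<gamma> q)) l j)) (at q)"
    if "i < n" "j < n" for i j q
    using D[OF entry_coord[OF that], of q] bracket_level_entry[OF n in_M m that, of q] F[of q]
    by (simp add: N_def)
  show B: "entry (snd (\<gamma> q)) i j = X i j" if "i < m" "j < m" for i j q
  proof -
    have "((\<lambda>t. entry (snd (\<gamma> t)) i j) has_field_derivative 0) (at q)" for q
    proof -
      interpret gz n "entry (snd (\<gamma> q))" N using M_Omega_e_gz[OF in_M, of q] F[of q] by (simp add: N_def)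
      show ?thesis using E[of i j q] that m by (simp add: phi_row psi_col)
    qed
    then show ?thesis unfolding X_def by (rule zero_derivative_constant)
  qed
  have phi: "phi (entry (snd (\<gamma> q))) c m = phi X c m" for c by (rule phi_cong) (rule B)
  have psi: "psi (entry (snd (\<gamma> q))) N m = psi X N m" by (rule psi_cong) (rule B, simp_all)
  show "((\<lambda>t. entry (snd (\<gamma> t)) i j) has_field_derivative
      (\<Sum>l<m. entry (snd (\<gamma> q)) i l * phi X (N m k) m l) * psi X N m k j -
      phi X (N m k) m i * (\<Sum>l<m. psi X N m k l * entry (snd (\<gamma> q)) l j)) (at q)"
    if "i < n" "j < n"
    using E[OF that, of q] unfolding phi psi .
qed

text \<open>The two vectors \<open>x \<phi>\<close> and \<open>\<psi> x\<close> along an integral curve \<open>x\<close> satisfy uncoupled linear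
  equations, and together they determine the derivative of \<open>x\<close>.\<close>

lemma integral_curve_unique:
  assumes n: "1 \<le> n" and m: "m \<le> n" "k < m"
    and \<gamma>: "integral_curve n (\<lambda>z. level (fst z) m k) \<gamma>"
    and \<delta>: "integral_curve n (\<lambda>z. level (fst z) m k) \<delta>" and eq: "\<gamma> 0 = \<delta> 0"
  shows "\<gamma> = \<delta>"
proof
  fix q
  define X where "X = entry (snd (\<gamma> 0))"
  define N where "N = level (fst (\<gamma> 0))"
  have in_M: "\<gamma> q \<in> M_Omega_e n" "\<delta> q \<in> M_Omega_e n" for q using \<gamma> \<delta> by (simp_all add: integral_curve_def)
  interpret gz n X N unfolding X_def N_def by (rule M_Omega_e_gz[OF in_M(1)])
  note G = integral_curve_structure[OF n m \<gamma>, folded X_def N_def]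
  note D = integral_curve_structure[OF n m \<delta>, folded eq, folded X_def N_def]
  have u: "((\<lambda>t. \<Sum>l<m. entry (snd (\<eta> t)) i l * \<phi> m k l) has_field_derivative
      (\<Sum>l<m. entry (snd (\<eta> q)) i l * \<phi> m k l) - \<phi> m k i * N m k) (at q)"
    and l: "((\<lambda>t. \<Sum>l<m. \<psi> m k l * entry (snd (\<eta> t)) l i) has_field_derivative
      N m k * \<psi> m k i - (\<Sum>l<m. \<psi> m k l * entry (snd (\<eta> q)) l i)) (at q)"
    if B: "\<And>i j q. i < m \<Longrightarrow> j < m \<Longrightarrow> entry (snd (\<eta> q)) i j = X i j"
      and E: "\<And>i j q. i < n \<Longrightarrow> j < n \<Longrightarrow> ((\<lambda>t. entry (snd (\<eta> t)) i j) has_field_derivative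
      (\<Sum>l<m. entry (snd (\<eta> q)) i l * \<phi> m k l) * \<psi> m k j -
      \<phi> m k i * (\<Sum>l<m. \<psi> m k l * entry (snd (\<eta> q)) l j)) (at q)" and i: "i < n" for \<eta> :: "complex \<Rightarrow> point" and i q
  proof -
    let ?u = "\<lambda>i. \<Sum>l<m. entry (snd (\<eta> q)) i l * \<phi> m k l"
    let ?l = "\<lambda>j. \<Sum>l<m. \<psi> m k l * entry (snd (\<eta> q)) l j"
    have lb: "?l j = N m k * \<psi> m k j" "?u j = N m k * \<phi> m k j" if "j < m" for j
      using psi_col[OF m that] phi_row[OF m that] B that by simp_all
    have "((\<lambda>t. \<Sum>l<m. entry (snd (\<eta> t)) i l * \<phi> m k l) has_field_derivative
        (\<Sum>l<m. (?u i * \<psi> m k l - \<phi> m k i * ?l l) * \<phi> m k l)) (at q)"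
      by (intro DERIV_sum DERIV_cmult_right E) (use i m in auto)
    also have "(\<Sum>l<m. (?u i * \<psi> m k l - \<phi> m k i * ?l l) * \<phi> m k l) =
        (\<Sum>l<m. (?u i - \<phi> m k i * N m k) * (\<psi> m k l * \<phi> m k l))"
      by (intro sum.cong refl) (simp only: lb lessThan_iff, simp add: algebra_simps)
    also have "\<dots> = ?u i - \<phi> m k i * N m k"
      by (simp only: sum_distrib_left[symmetric] psi_phi_sum[OF m] mult_1_right)
    finally show "((\<lambda>t. \<Sum>l<m. entry (snd (\<eta> t)) i l * \<phi> m k l) has_field_derivative
      ?u i - \<phi> m k i * N m k) (at q)" .
    have "((\<lambda>t. \<Sum>l<m. \<psi> m k l * entry (snd (\<eta> t)) l i) has_field_derivative
        (\<Sum>l<m. \<psi> m k l * (?u l * \<psi> m k i - \<phi> m k l * ?l i))) (at q)"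
      by (intro DERIV_sum DERIV_cmult E) (use i m in auto)
    also have "(\<Sum>l<m. \<psi> m k l * (?u l * \<psi> m k i - \<phi> m k l * ?l i)) =
        (\<Sum>l<m. (N m k * \<psi> m k i - ?l i) * (\<psi> m k l * \<phi> m k l))"
      by (intro sum.cong refl) (simp only: lb lessThan_iff, simp add: algebra_simps)
    also have "\<dots> = N m k * \<psi> m k i - ?l i"
      by (simp only: sum_distrib_left[symmetric] psi_phi_sum[OF m] mult_1_right)
    finally show "((\<lambda>t. \<Sum>l<m. \<psi> m k l * entry (snd (\<eta> t)) l i) has_field_derivative
      N m k * \<psi> m k i - ?l i) (at q)" .
  qed
  \<comment> \<open>The inhomogeneous terms agree for both curves, so the difference w satisfies w'
    = w with w(0) = 0; for the second pair of vectors it is w' = - w.\<close>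
  have ueq: "(\<Sum>l<m. entry (snd (\<gamma> q)) i l * \<phi> m k l) - (\<Sum>l<m. entry (snd (\<delta> q)) i l * \<phi> m k l) = 0"
    if i: "i < n" for i q
    by (rule exp_ode_zero[where s = 1])
      (use DERIV_diff[OF u[OF G(2,3) i] u[OF D(2,3) i]] eq in auto)
  have leq: "(\<Sum>l<m. \<psi> m k l * entry (snd (\<gamma> q)) l i) - (\<Sum>l<m. \<psi> m k l * entry (snd (\<delta> q)) l i) = 0"
    if i: "i < n" for i q
    by (rule exp_ode_zero[where s = "- 1"])
      (use DERIV_diff[OF l[OF G(2,3) i] l[OF D(2,3) i]] eq in auto)
  have "entry (snd (\<gamma> q)) i j - entry (snd (\<delta> q)) i j = entry (snd (\<gamma> 0)) i j - entry (snd (\<delta> 0)) i j"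
    if ij: "i < n" "j < n" for i j
  proof (rule zero_derivative_constant)
    fix q
    show "((\<lambda>q. entry (snd (\<gamma> q)) i j - entry (snd (\<delta> q)) i j) has_field_derivative 0) (at q)"
      using DERIV_diff[OF G(3)[OF ij] D(3)[OF ij], of q] ueq[OF ij(1), of q] leq[OF ij(2), of q] by simp
  qed
  then have "snd (\<gamma> q) = snd (\<delta> q)"
    using M_Omega_e_mat[OF in_M(1), of q] M_Omega_e_mat[OF in_M(2), of q]
    by (intro eq_matI) (auto simp: entry_def eq)
  moreover have "fst (\<gamma> q) = fst (\<delta> q)" using G(1)[of q] D(1)[of q] by simp
  ultimately show "\<gamma> q = \<delta> q" by (rule prod_eqI[rotated])
qed

lemma flow_level:
  assumes n: "1 \<le> n" and z: "z \<in> M_Omega_e n" and m: "m \<le> n" "k < m"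
  shows "flow n (\<lambda>z. level (fst z) m k) q z = twist n m k (exp (- q) - 1) (exp q - 1) z"
proof -
  let ?\<gamma> = "\<lambda>t. twist n m k (exp (- t) - 1) (exp t - 1) z"
  have ic: "integral_curve n (\<lambda>z. level (fst z) m k) ?\<gamma>" by (rule integral_curve_twist[OF assms])
  have "(THE \<gamma>. integral_curve n (\<lambda>z. level (fst z) m k) \<gamma> \<and> \<gamma> 0 = z) = ?\<gamma>"
  proof (rule the_equality)
    show "integral_curve n (\<lambda>z. level (fst z) m k) ?\<gamma> \<and> ?\<gamma> 0 = z"
      using ic twist_0[OF z] by simp
    show "\<gamma> = ?\<gamma>" if "integral_curve n (\<lambda>z. level (fst z) m k) \<gamma> \<and> \<gamma> 0 = z" for \<gamma>
      by (rule integral_curve_unique[OF n m _ ic]) (use that twist_0[OF z] in auto)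
  qed
  then show ?thesis by (simp add: flow_def)
qed

section \<open>The torus action and the functions s\<close>

text \<open>Polar form; a negative radius is absorbed by the factor exp(pi i) = -1.\<close>

lemma exp_surj_complex:
  assumes "w \<noteq> 0"
  shows "\<exists>q::complex. exp q = w"
proof -
  obtain r a where ra: "w = rcis r a" using rcis_Ex by blast
  then have r: "r \<noteq> 0" using assms by auto
  have "exp (of_real (ln \<bar>r\<bar>) + \<i> * of_real a) = of_real \<bar>r\<bar> * cis a"
    using r by (simp add: exp_add cis_conv_exp exp_of_real)
  moreover have "w = of_real \<bar>r\<bar> * cis a \<or> w = of_real \<bar>r\<bar> * cis a * exp (of_real pi * \<i>)"
    using ra by (cases "r > 0") (auto simp: rcis_def)
  ultimately show ?thesis by (metis exp_add)
qed

lemma scoef_injective: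
  assumes z: "z \<in> M_Omega_e n" and w: "w \<in> M_Omega_e n" and "fst z = fst w"
    and "\<And>m k. m < n \<Longrightarrow> k < m \<Longrightarrow> scoef m k z = scoef m k w"
  shows "z = w"
proof (rule prod_eqI[OF assms(3)])
  have "gz n (entry (snd w)) (level (fst z))" using M_Omega_e_gz[OF w] assms(3) by simp
  from coef_determines[OF M_Omega_e_gz[OF z] this _ order_refl] assms(3,4)
  have "entry (snd z) i j = entry (snd w) i j" if "i < n" "j < n" for i j
    using that by (simp add: scoef_def)
  then show "snd z = snd w"
    using M_Omega_e_mat[OF z] M_Omega_e_mat[OF w] by (intro eq_matI) (auto simp: entry_def)
qed

text \<open>Flowing for time -q with exp q = b gives the twist with 1 + c = b and 1 + d = 1 / b,
  whichever logarithm q was chosen. This is why the coefficient is divided by b.\<close>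

lemma torus_step:
  assumes n: "1 \<le> n" and z: "z \<in> M_Omega_e n" and m: "m < n" "k < m" and b: "b \<noteq> 0"
  defines "w \<equiv> flow n (r_fun (Suc (tri (m - 1) + k))) (- (SOME q. exp q = b)) z"
  shows "w \<in> M_Omega_e n" and "fst w = fst z"
    and "m' < n \<Longrightarrow> k' < m' \<Longrightarrow>
      scoef m' k' w = (if m' = m \<and> k' = k then scoef m k z / b else scoef m' k' z)"
proof -
  have m1: "m \<le> n" using m by simp
  define q where "q = (SOME q. exp q = b)"
  have q: "exp q = b" unfolding q_def by (rule someI_ex[OF exp_surj_complex[OF b]])
  have w: "w = twist n m k (b - 1) (1 / b - 1) z"
    unfolding w_def q_def[symmetric] r_fun_level flow_level[OF n z m1 m(2)]
    by (simp add: q exp_minus inverse_eq_divide)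
  have c: "(b - 1) + (1 / b - 1) + (b - 1) * (1 / b - 1) = 0" using b by (simp add: field_simps)
  show "w \<in> M_Omega_e n" unfolding w by (rule twist_in[OF z m1 m(2) c])
  show "fst w = fst z" by (simp add: w)
  show "m' < n \<Longrightarrow> k' < m' \<Longrightarrow>
      scoef m' k' w = (if m' = m \<and> k' = k then scoef m k z / b else scoef m' k' z)"
    unfolding w by (subst scoef_twist[OF z m1 m(2) c]) auto
qed

text \<open>Distinctness of the list ensures that every coefficient is divided at most once.\<close>

lemma torus_fold:
  assumes n: "1 \<le> n" and b: "b \<in> torus n"
  defines "F \<equiv> fold (\<lambda>j w. flow n (r_fun j) (- (SOME q. exp q = b j)) w)"
  shows "distinct js \<Longrightarrow> set js \<subseteq> {1..tri (n - 1)} \<Longrightarrow> z \<in> M_Omega_e n \<Longrightarrow>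
    F js z \<in> M_Omega_e n \<and> fst (F js z) = fst z \<and>
    (\<forall>m<n. \<forall>k<m. scoef m k (F js z) =
      (if Suc (tri (m - 1) + k) \<in> set js then scoef m k z / b (Suc (tri (m - 1) + k)) else scoef m k z))"
proof (induction js arbitrary: z)
  case Nil
  then show ?case by (simp add: F_def)
next
  case (Cons j js)
  then have j: "j \<in> {1..tri (n - 1)}" by simp
  from tri_index_Suc_ex[OF this] obtain m k where mk: "m \<le> n - 1" "k < m"
    and jj: "j = Suc (tri (m - 1) + k)" by blast
  have m: "m < n" using mk n by simp
  have bj: "b j \<noteq> 0" using b j by (auto simp: torus_def)
  define w where "w = flow n (r_fun j) (- (SOME q. exp q = b j)) z"
  note st = torus_step[OF n Cons.prems(3) m mk(2) bj, folded jj, folded w_def]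
  have FF: "F (j # js) z = F js w" by (simp add: F_def w_def)
  have IH: "F js w \<in> M_Omega_e n \<and> fst (F js w) = fst w \<and> (\<forall>m<n. \<forall>k<m. scoef m k (F js w) =
      (if Suc (tri (m - 1) + k) \<in> set js then scoef m k w / b (Suc (tri (m - 1) + k)) else scoef m k w))"
    by (rule Cons.IH) (use Cons.prems st(1) in auto)
  have "scoef m' k' (F js w) = (if Suc (tri (m' - 1) + k') \<in> set (j # js)
      then scoef m' k' z / b (Suc (tri (m' - 1) + k')) else scoef m' k' z)" if "m' < n" "k' < m'" for m' k'
  proof (cases "m' = m \<and> k' = k")
    case True
    then have "Suc (tri (m' - 1) + k') = j" using jj by simp
    then show ?thesis using IH that st(3)[OF that] Cons.prems(1) True by auto
  next
    case False
    then have "Suc (tri (m' - 1) + k') \<noteq> j"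
      using tri_index_unique[OF that(2) mk(2)] jj by auto
    then show ?thesis using IH that st(3)[OF that] False by auto
  qed
  then show ?case using IH st(2) unfolding FF by simp
qed

lemma
  assumes n: "1 \<le> n" and b: "b \<in> torus n" and z: "z \<in> M_Omega_e n"
  shows torus_act_in: "torus_act n b z \<in> M_Omega_e n"
    and fst_torus_act: "fst (torus_act n b z) = fst z"
    and scoef_torus_act: "m < n \<Longrightarrow> k < m \<Longrightarrow>
      scoef m k (torus_act n b z) = scoef m k z / b (Suc (tri (m - 1) + k))"
proof -
  have "set [1..<tri (n - 1) + 1] \<subseteq> {1..tri (n - 1)}" by auto
  note F = torus_fold[OF n b distinct_upt this z, folded torus_act_def]
  show "torus_act n b z \<in> M_Omega_e n" "fst (torus_act n b z) = fst z" using F by blast+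
  assume mk: "m < n" "k < m"
  then have "Suc (tri (m - 1) + k) \<in> {1..tri (n - 1)}" by (intro tri_index_Suc_in) auto
  then have "Suc (tri (m - 1) + k) \<in> set [1..<tri (n - 1) + 1]" by auto
  then show "scoef m k (torus_act n b z) = scoef m k z / b (Suc (tri (m - 1) + k))"
    using F mk by auto
qed

text \<open>Row m of a Hessenberg matrix, left of the diagonal, is (0, ..., 0, 1), and its value on
  an eigenvector is the last coordinate 1. Conversely these values determine the row by
  \<open>row_eqI\<close>.\<close>

lemma M_Omega_e_b_iff:
  assumes z: "z \<in> M_Omega_e n"
  shows "z \<in> M_Omega_e_b n \<longleftrightarrow> (\<forall>m<n. \<forall>k<m. scoef m k z = 1)"
proof -
  interpret gz n "entry (snd z)" "level (fst z)" by (rule M_Omega_e_gz[OF z])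
  have MO: "snd z \<in> M_Omega n" using z by (auto simp: M_Omega_e_def)
  have last: "(\<Sum>i<m. (if i = m - 1 then 1 else 0) * \<phi> m k i) = 1" if "m < n" "k < m" for m k
    using that phi_last[of m k] by (simp add: if_distrib[of "\<lambda>x. x * _"] cong: if_cong)
  show ?thesis
  proof
    assume "z \<in> M_Omega_e_b n"
    then have h: "snd z \<in> hessenberg n" by (simp add: M_Omega_e_b_def)
    have e: "entry (snd z) m i = (if i = m - 1 then 1 else 0)" if "m < n" "i < m" for m i
      using h that by (auto simp: hessenberg_def entry_def)
    show "\<forall>m<n. \<forall>k<m. scoef m k z = 1"
    proof (intro allI impI)
      fix m k assume m: "m < n" "k < m"
      have "scoef m k z = (\<Sum>i<m. (if i = m - 1 then 1 else 0) * \<phi> m k i)"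
        unfolding scoef_def coef_def by (intro sum.cong refl) (use e m in simp)
      then show "scoef m k z = 1" using last[OF m] by simp
    qed
  next
    assume s: "\<forall>m<n. \<forall>k<m. scoef m k z = 1"
    have e: "entry (snd z) m i = (if i = m - 1 then 1 else 0)" if "m < n" "i < m" for m i
      by (rule row_eqI[of m]) (use that s last in \<open>auto simp: scoef_def coef_def\<close>)
    have "snd z $$ (i, i - 1) = 1" if "i \<in> {1..n - 1}" for i
      using e[of i "i - 1"] that by (auto simp: entry_def)
    moreover have "snd z $$ (i, j) = 0" if "i < n" "j < n" "i > j + 1" for i j
      using e[of i j] that by (auto simp: entry_def)
    ultimately have "snd z \<in> hessenberg n"
      using M_Omega_e_mat[OF z] by (simp add: hessenberg_def)
    then show "z \<in> M_Omega_e_b n" using z MO by (simp add: M_Omega_e_b_def)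
  qed
qed

text \<open>The torus divides the coefficients and the slice has all of them equal to 1, so z = b y
  forces every coordinate of b to be the inverse of a coefficient of z. Passing to the inverse of b
  in \<open>s_fun\<close> returns the coefficient.\<close>

lemma s_fun_scoef:
  assumes n: "1 \<le> n" and z: "z \<in> M_Omega_e n" and m: "m < n" "k < m"
  shows "s_fun n (Suc (tri (m - 1) + k)) z = scoef m k z"
proof -
  interpret gz n "entry (snd z)" "level (fst z)" by (rule M_Omega_e_gz[OF z])
  define S where "S j = of_levels (n - 1) (\<lambda>m k. scoef m k z) $ (j - 1)" for j
  have S: "S (Suc (tri (m - 1) + k)) = scoef m k z" if "m < n" "k < m" for m k
    using level_of_levels[of m "n - 1" k] that by (simp add: S_def level_def)
  have idx: "\<exists>m k. m < n \<and> k < m \<and> j = Suc (tri (m - 1) + k)" if "j \<in> {1..tri (n - 1)}" for j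
  proof -
    from tri_index_Suc_ex[OF that]
    obtain m k where mk: "m \<le> n - 1" "k < m" "j = Suc (tri (m - 1) + k)" by blast
    then have "m < n" using n by simp
    with mk show ?thesis by blast
  qed
  have Sn: "S j \<noteq> 0" if "j \<in> {1..tri (n - 1)}" for j
    using idx[OF that] S coef_nonzero by (auto simp: scoef_def)
  \<comment> \<open>The element \<open>b'\<close> moves z into the slice, and its inverse
    \<open>b\<close> moves the result back to z.\<close>
  define b where "b = (\<lambda>j\<in>{1..tri (n - 1)}. 1 / S j)"
  define b' where "b' = (\<lambda>j\<in>{1..tri (n - 1)}. S j)"
  have b: "b \<in> torus n" "b' \<in> torus n" using Sn by (auto simp: b_def b'_def torus_def)
  have inI: "Suc (tri (m - 1) + k) \<in> {1..tri (n - 1)}" if "m < n" "k < m" for m k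
    using that by (intro tri_index_Suc_in) auto
  let ?P = "\<lambda>b. b \<in> torus n \<and> (\<exists>y\<in>M_Omega_e_b n. z = torus_act n b y)"
  have "(THE b. ?P b) = b"
  proof (rule the_equality)
    define y where "y = torus_act n b' z"
    have y: "y \<in> M_Omega_e n" unfolding y_def by (rule torus_act_in[OF n b(2) z])
    have sy: "scoef m k y = 1" if "m < n" "k < m" for m k
      unfolding y_def scoef_torus_act[OF n b(2) z that]
      using inI[OF that] S[OF that] coef_nonzero[OF that] by (simp add: b'_def scoef_def)
    have "torus_act n b y = z"
    proof (rule scoef_injective[OF torus_act_in[OF n b(1) y] z])
      show "fst (torus_act n b y) = fst z"
        using fst_torus_act[OF n b(1) y] fst_torus_act[OF n b(2) z] by (simp add: y_def)
      show "scoef m k (torus_act n b y) = scoef m k z" if "m < n" "k < m" for m k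
        unfolding scoef_torus_act[OF n b(1) y that] sy[OF that]
        using inI[OF that] S[OF that] by (simp add: b_def)
    qed
    then show "?P b" using b(1) M_Omega_e_b_iff[OF y] sy by metis
  next
    fix c assume c: "?P c"
    then obtain y where y: "y \<in> M_Omega_e_b n" "z = torus_act n c y" and ct: "c \<in> torus n" by blast
    have yM: "y \<in> M_Omega_e n" using y(1) by (simp add: M_Omega_e_b_def)
    have "c j = b j" if j: "j \<in> {1..tri (n - 1)}" for j
    proof -
      obtain m k where mk: "m < n" "k < m" "j = Suc (tri (m - 1) + k)" using idx[OF j] by blast
      have "scoef m k z = 1 / c j"
        using scoef_torus_act[OF n ct yM mk(1,2)] y M_Omega_e_b_iff[OF yM] mk by auto
      then show ?thesis using S[OF mk(1,2)] mk(3) j by (simp add: b_def)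
    qed
    then show "c = b" using ct b(1) unfolding torus_def by (intro PiE_ext) auto
  qed
  then show ?thesis
    using inI[OF m] S[OF m] by (simp add: s_fun_def torus_inv_def b_def)
qed

section \<open>The isomorphism\<close>

lemma tri_square: "1 \<le> n \<Longrightarrow> n\<^sup>2 = tri n + tri (n - 1)"
proof -
  have "(Suc m)\<^sup>2 = tri (Suc m) + tri m" for m
    by (induction m) (simp_all add: tri_Suc power2_eq_square)
  then show "1 \<le> n \<Longrightarrow> n\<^sup>2 = tri n + tri (n - 1)" by (cases n) auto
qed

definition slevel :: "nat \<Rightarrow> complex vec \<Rightarrow> nat \<Rightarrow> nat \<Rightarrow> complex" where
  "slevel n p m k = p $ (tri n + (tri (m - 1) + k))"

lemma rs_map_carrier [simp]: "rs_map n z \<in> carrier_vec (n\<^sup>2)"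
  by (simp add: rs_map_def)

lemma level_rs_map:
  assumes "m \<le> n" "k < m"
  shows "level (rs_map n z) m k = level (fst z) m k"
proof -
  have "1 \<le> n" using assms by simp
  then show ?thesis
    using tri_index_less[OF assms] tri_square[of n]
    by (simp add: level_def rs_map_def r_fun_def)
qed

lemma slevel_rs_map:
  assumes n: "1 \<le> n" and z: "z \<in> M_Omega_e n" and m: "m < n" "k < m"
  shows "slevel n (rs_map n z) m k = scoef m k z"
proof -
  have "tri (m - 1) + k < tri (n - 1)" using m by (intro tri_index_less) auto
  then show ?thesis
    using tri_square[OF n] s_fun_scoef[OF assms] by (simp add: slevel_def rs_map_def)
qed

lemma coords_eqI:
  assumes n: "1 \<le> n" and "p \<in> carrier_vec (n\<^sup>2)" "q \<in> carrier_vec (n\<^sup>2)"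
    and "\<And>m k. m \<le> n \<Longrightarrow> k < m \<Longrightarrow> level p m k = level q m k"
    and "\<And>m k. m < n \<Longrightarrow> k < m \<Longrightarrow> slevel n p m k = slevel n q m k"
  shows "p = q"
proof (rule eq_vecI)
  fix i assume "i < dim_vec q"
  then have i: "i < tri n + tri (n - 1)" using assms(3) tri_square[OF n] by simp
  show "p $ i = q $ i"
  proof (cases "i < tri n")
    case True
    then obtain m k where "m \<le> n" "k < m" "i = tri (m - 1) + k" using tri_index_ex by blast
    with assms(4)[of m k] show ?thesis by (simp add: level_def)
  next
    case False
    then have "i - tri n < tri (n - 1)" using i by simp
    from tri_index_ex[OF this] obtain m k
      where mk: "m \<le> n - 1" "k < m" "i - tri n = tri (m - 1) + k" by blast
    then have "m < n" "i = tri n + (tri (m - 1) + k)" using n False by auto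
    with assms(5)[of m k] mk show ?thesis by (simp add: slevel_def)
  qed
qed (use assms in auto)

text \<open>The defining conditions of the open set Y: those of \<open>e_Omega\<close> for the
  r-coordinates, and nonvanishing of every s-coordinate.\<close>

definition admissible :: "nat \<Rightarrow> complex vec \<Rightarrow> bool" where
  "admissible n p \<longleftrightarrow> (\<forall>m\<le>n. inj_on (level p m) {..<m}) \<and>
     (\<forall>m<n. \<forall>k<m. slevel n p m k \<noteq> 0 \<and> (\<forall>l\<le>m. level p m k \<noteq> level p (Suc m) l))"

text \<open>The inclusion into the admissible set is \<open>coef_nonzero\<close> with the axioms of
  \<open>gz\<close>; the converse is the construction \<open>coef_realize\<close>.\<close>

lemma rs_map_image:
  assumes n: "1 \<le> n"
  shows "rs_map n ` M_Omega_e n = {p \<in> carrier_vec (n\<^sup>2). admissible n p}"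
proof (intro equalityI subsetI)
  fix p assume "p \<in> rs_map n ` M_Omega_e n"
  then obtain z where z: "z \<in> M_Omega_e n" "p = rs_map n z" by auto
  interpret gz n "entry (snd z)" "level (fst z)" by (rule M_Omega_e_gz[OF z(1)])
  have "inj_on (level p m) {..<m}" if "m \<le> n" for m
    using inj[OF that] level_rs_map[OF that] by (auto simp: z(2) inj_on_def)
  moreover have "slevel n p m k \<noteq> 0" if "m < n" "k < m" for m k
    using coef_nonzero[OF that] slevel_rs_map[OF n z(1) that] by (simp add: z(2) scoef_def)
  moreover have "level p m k \<noteq> level p (Suc m) l" if "m < n" "k < m" "l \<le> m" for m k l
    using sep[OF that] that by (simp add: z(2) level_rs_map)
  ultimately show "p \<in> {p \<in> carrier_vec (n\<^sup>2). admissible n p}"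
    by (simp add: admissible_def z(2))
next
  fix p assume "p \<in> {p \<in> carrier_vec (n\<^sup>2). admissible n p}"
  then have p: "p \<in> carrier_vec (n\<^sup>2)" and adm: "admissible n p" by auto
  obtain X where X: "gz n X (level p)" "\<And>m k. m < n \<Longrightarrow> k < m \<Longrightarrow> coef X (level p) m k = slevel n p m k"
    using coef_realize[of n "level p" "slevel n p" n] adm unfolding admissible_def by auto
  define z where "z = (of_levels n (level p), mat n n (\<lambda>(i, j). X i j))"
  have lev: "level (fst z) m k = level p m k" if "m \<le> n" "k < m" for m k
    using that by (simp add: z_def level_of_levels)
  have ent: "entry (snd z) i j = X i j" if "i < n" "j < n" for i j
    using that by (simp add: z_def entry_def)
  have "gz n (entry (snd z)) (level (fst z))"
    by (rule gz_cong[OF X(1)]) (use lev ent in auto)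
  then have z: "z \<in> M_Omega_e n" by (simp add: z_def mem_M_Omega_e)
  have "scoef m k z = slevel n p m k" if "m < n" "k < m" for m k
    unfolding scoef_def X(2)[OF that, symmetric] by (rule coef_cong) (use that lev ent in auto)
  then have "rs_map n z = p"
    using p lev by (intro coords_eqI[OF n]) (auto simp: level_rs_map slevel_rs_map[OF n z])
  then show "p \<in> rs_map n ` M_Omega_e n" using z by blast
qed

lemma rs_map_inj:
  assumes n: "1 \<le> n"
  shows "inj_on (rs_map n) (M_Omega_e n)"
proof (rule inj_onI)
  fix z w assume z: "z \<in> M_Omega_e n" and w: "w \<in> M_Omega_e n" and eq: "rs_map n z = rs_map n w"
  have "fst z = fst w"
    by (rule levels_eqI[OF M_Omega_e_vec[OF z] M_Omega_e_vec[OF w]]) (metis level_rs_map eq)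
  then show "z = w"
    by (rule scoef_injective[OF z w]) (metis slevel_rs_map[OF n z] slevel_rs_map[OF n w] eq)
qed

lemma poly_funs_prod:
  "(\<And>i. i \<in> I \<Longrightarrow> f i \<in> poly_funs C) \<Longrightarrow> (\<lambda>p. \<Prod>i\<in>I. f i p) \<in> poly_funs C"
  by (induction I rule: infinite_finite_induct) (auto intro: poly_funs.const poly_funs.mult)

lemma poly_funs_diff:
  assumes "f \<in> poly_funs C" "g \<in> poly_funs C"
  shows "(\<lambda>p. f p - g p) \<in> poly_funs C"
  using poly_funs.add[OF assms(1) poly_funs.mult[OF poly_funs.const[of "- 1"] assms(2)]] by simp

lemma level_vec_coord:
  assumes "m \<le> n" "k < m"
  shows "(\<lambda>p. level p m k) \<in> vec_coords (n\<^sup>2)"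
proof -
  have "tri (m - 1) + k < n\<^sup>2" using tri_index_less[OF assms] tri_square[of n] assms by simp
  then show ?thesis unfolding vec_coords_def level_def by fastforce
qed

lemma slevel_vec_coord:
  assumes "m < n" "k < m"
  shows "(\<lambda>p. slevel n p m k) \<in> vec_coords (n\<^sup>2)"
proof -
  have "tri (m - 1) + k < tri (n - 1)" using assms by (intro tri_index_less) auto
  then have "tri n + (tri (m - 1) + k) < n\<^sup>2" using tri_square[of n] assms by simp
  then show ?thesis unfolding vec_coords_def slevel_def by fastforce
qed

lemma zariski_open_image:
  assumes n: "1 \<le> n"
  shows "zariski_open_in (vec_coords (n\<^sup>2)) (carrier_vec (n\<^sup>2)) (rs_map n ` M_Omega_e n)"
proof -
  \<comment> \<open>The product of all quantities that must not vanish: the image is a principal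
    open set.\<close>
  define H where "H p = (\<Prod>m\<in>{..n}. \<Prod>k\<in>{..<m}. \<Prod>l\<in>{..<m} - {k}. level p m k - level p m l) *
    (\<Prod>m\<in>{..<n}. \<Prod>k\<in>{..<m}. slevel n p m k * (\<Prod>l\<in>{..m}. level p m k - level p (Suc m) l))" for p
  have "H \<in> poly_funs (vec_coords (n\<^sup>2))"
    unfolding H_def[abs_def]
    by (intro poly_funs.mult poly_funs_prod poly_funs_diff poly_funs.coord level_vec_coord
        slevel_vec_coord) auto
  moreover have "H p \<noteq> 0 \<longleftrightarrow> admissible n p" for p
    unfolding H_def admissible_def inj_on_def by auto
  ultimately show ?thesis
    unfolding zariski_open_in_def rs_map_image[OF n] by (intro exI[of _ "{H}"]) auto
qed

text \<open>The induction carries the eigenvectors along with the entries, because the next row is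
  found from its values on them. Each stage of the reconstruction is a uniquely solvable linear
  system, so \<open>regular_on_solve\<close> applies.\<close>

lemma regular_on_inverse_map:
  fixes C :: "('a \<Rightarrow> complex) set" and G :: "'a \<Rightarrow> point"
  assumes G: "\<And>p. p \<in> Y \<Longrightarrow> G p \<in> M_Omega_e n"
    and lev: "\<And>m k. m \<le> n \<Longrightarrow> k < m \<Longrightarrow> regular_on C Y (\<lambda>p. level (fst (G p)) m k)"
    and sco: "\<And>m k. m < n \<Longrightarrow> k < m \<Longrightarrow> regular_on C Y (\<lambda>p. scoef m k (G p))"
  shows "m \<le> n \<Longrightarrow>
    (\<forall>i<m. \<forall>j<m. regular_on C Y (\<lambda>p. entry (snd (G p)) i j)) \<and>
    (\<forall>k<m. \<forall>i<m. regular_on C Y (\<lambda>p. phi (entry (snd (G p))) (level (fst (G p)) m k) m i))"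
proof (induction m)
  case (Suc m)
  then have m: "m < n" "m \<le> n" by auto
  define X where "X p = entry (snd (G p))" for p
  define N where "N p = level (fst (G p))" for p
  have gz: "gz n (X p) (N p)" if "p \<in> Y" for p unfolding X_def N_def by (rule M_Omega_e_gz[OF G[OF that]])
  have rN: "regular_on C Y (\<lambda>p. N p m' k)" if "m' \<le> n" "k < m'" for m' k unfolding N_def by (rule lev[OF that])
  have ra: "regular_on C Y (\<lambda>p. coef (X p) (N p) m k)" if "k < m" for k
    using sco[OF m(1) that] by (simp add: X_def N_def scoef_def)
  have rX: "regular_on C Y (\<lambda>p. X p i j)" if "i < m" "j < m" for i j
    unfolding X_def by (rule conjunct1[OF Suc.IH[OF m(2)], rule_format, OF that])
  have rphi: "regular_on C Y (\<lambda>p. phi (X p) (N p m k) m i)" if "k < m" "i < m" for k i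
    unfolding X_def N_def by (rule conjunct2[OF Suc.IH[OF m(2)], rule_format, OF that])
  have row: "regular_on C Y (\<lambda>p. X p m i)" if i: "i < m" for i
  proof (rule regular_on_solve[where k = m and A = "\<lambda>p k i. phi (X p) (N p m k) m i" and
        b = "\<lambda>p k. coef (X p) (N p) m k" and y = "\<lambda>p i. X p m i", OF rphi ra _ _ i])
    fix p y assume p: "p \<in> Y" and y: "\<forall>k<m. (\<Sum>i<m. phi (X p) (N p m k) m i * y i) = 0"
    show "\<forall>j<m. y j = 0"
    proof (intro allI impI)
      fix j assume "j < m"
      then show "y j = 0"
        by (intro gz.row_eqI[OF gz[OF p] m(2), of y "\<lambda>_. 0"]) (use y in \<open>auto simp: mult.commute\<close>)
    qed
  qed (simp_all add: coef_def mult.commute)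
  \<comment> \<open>The bordered Cauchy system: unknown k < m is the product of coefficient and
    column coordinate, and unknown m is the corner entry.\<close>
  let ?A = "\<lambda>p j k. if k < m then inverse (N p (Suc m) j - N p m k) else 1"
  let ?y = "\<lambda>p k. if k < m then coef (X p) (N p) m k * gz.ucoef (X p) (N p) m k else X p m m"
  have ry: "regular_on C Y (\<lambda>p. ?y p k)" if k: "k < Suc m" for k
  proof (rule regular_on_solve[where k = "Suc m" and A = ?A and b = "\<lambda>p j. N p (Suc m) j" and y = ?y, OF _ _ _ _ k])
    show "regular_on C Y (\<lambda>p. ?A p j k)" if "j < Suc m" "k < Suc m" for j k
    proof (cases "k < m")
      case True
      have "N p (Suc m) j - N p m k \<noteq> 0" if "p \<in> Y" for p
        using gz.sep[OF gz[OF that] m(1) True, of j] \<open>j < Suc m\<close> by simp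
      then have "regular_on C Y (\<lambda>p. inverse (N p (Suc m) j - N p m k))"
        by (intro regular_on_inverse regular_on_diff rN) (use that True m in auto)
      then show ?thesis using True by simp
    qed (simp add: regular_on_const)
    show "regular_on C Y (\<lambda>p. N p (Suc m) j)" if "j < Suc m" for j
      using rN[OF Suc.prems that] .
    show "\<forall>k<Suc m. y k = 0" if p: "p \<in> Y" and y: "\<forall>j<Suc m. (\<Sum>k<Suc m. ?A p j k * y k) = 0" for p y
    proof -
      have e: "(\<Sum>k<m. y k / (N p (Suc m) j - N p m k)) + y m = 0" if "j \<le> m" for j
        using y that by (simp add: divide_inverse mult.commute)
      show ?thesis
        using gz.cauchy_injective'(1)[OF gz[OF p] m(1) e] gz.cauchy_injective'(2)[OF gz[OF p] m(1) e]
        by (auto simp: less_Suc_eq)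
    qed
    show "(\<Sum>k<Suc m. ?A p j k * ?y p k) = N p (Suc m) j" if "p \<in> Y" "j < Suc m" for p j
      using gz.cauchy_system[OF gz[OF that(1)] m(1), of j] that(2)
      by (simp add: divide_inverse mult_ac)
  qed
  \<comment> \<open>The system delivers only the products; dividing by the nonvanishing coefficients
    isolates the column coordinates.\<close>
  have ru: "regular_on C Y (\<lambda>p. gz.ucoef (X p) (N p) m k)" if k: "k < m" for k
  proof (rule regular_on_cong[OF regular_on_divide[OF _ ra[OF k]]])
    show "regular_on C Y (\<lambda>p. coef (X p) (N p) m k * gz.ucoef (X p) (N p) m k)"
      using ry[of k] k by simp
    show "coef (X p) (N p) m k \<noteq> 0" if "p \<in> Y" for p by (rule gz.coef_nonzero[OF gz[OF that] m(1) k])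
    then show "gz.ucoef (X p) (N p) m k = coef (X p) (N p) m k * gz.ucoef (X p) (N p) m k / coef (X p) (N p) m k"
      if "p \<in> Y" for p using that by simp
  qed
  have col: "regular_on C Y (\<lambda>p. X p i m)" if i: "i < m" for i
    by (rule regular_on_cong[OF _ gz.col_expand[OF gz m(1) i]])
      (intro regular_on_sum regular_on_mult rphi ru, use i in auto)
  have corner: "regular_on C Y (\<lambda>p. X p m m)" using ry[of m] by simp
  have "regular_on C Y (\<lambda>p. X p i j)" if "i < Suc m" "j < Suc m" for i j
    using that rX row col corner by (auto simp: less_Suc_eq)
  moreover have "regular_on C Y (\<lambda>p. phi (X p) (N p (Suc m) j) (Suc m) i)" if j: "j < Suc m" and i: "i < Suc m" for j i
  proof (cases "i = m")
    case True
    show ?thesis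
      by (rule regular_on_cong[OF regular_on_const[of _ _ 1]])
        (use gz.phi_last[OF gz Suc.prems j] True in simp)
  next
    case False
    then have i: "i < m" using i by simp
    have jm: "j \<le> m" using j by simp
    have "N p (Suc m) j - N p m k \<noteq> 0" if "p \<in> Y" "k < m" for p k
      using gz.sep[OF gz[OF that(1)] m(1) that(2) jm] by simp
    then show ?thesis
      by (intro regular_on_cong[OF _ gz.phi_Suc_expand[OF gz m(1) jm i]] regular_on_sum regular_on_mult
          regular_on_divide regular_on_diff rphi ru rN) (use i j m in auto)
  qed
  ultimately show ?case by (simp add: X_def N_def)
qed simp

lemma rs_map_isomorphism:
  assumes n: "1 \<le> n"
  shows "algebraic_isomorphism (point_coords n) (M_Omega_e n)
    (vec_coords (n\<^sup>2)) (rs_map n ` M_Omega_e n) (rs_map n)"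
proof -
  let ?Y = "rs_map n ` M_Omega_e n" and ?G = "inv_into (M_Omega_e n) (rs_map n)"
  have "regular_on (point_coords n) (M_Omega_e n) (c \<circ> rs_map n)" if "c \<in> vec_coords (n\<^sup>2)" for c
  proof -
    from that obtain i where i: "i < tri n + tri (n - 1)" "c = (\<lambda>v. v $ i)"
      using tri_square[OF n] by (auto simp: vec_coords_def)
    show ?thesis
    proof (cases "i < tri n")
      case True
      then obtain m k where mk: "m \<le> n" "k < m" "i = tri (m - 1) + k" using tri_index_ex by blast
      have "c \<circ> rs_map n = (\<lambda>z. level (fst z) m k)"
        using level_rs_map[OF mk(1,2)] by (auto simp: i(2) mk(3) level_def)
      then show ?thesis by (simp add: regular_on_coord level_coord mk)
    next
      case False
      then have "i - tri n < tri (n - 1)" using i(1) by simp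
      from tri_index_ex[OF this] obtain m k
        where mk: "m \<le> n - 1" "k < m" "i - tri n = tri (m - 1) + k" by blast
      then have m: "m < n" "i = tri n + (tri (m - 1) + k)" using n False by auto
      show ?thesis
        by (rule regular_on_cong[OF regular_on_scoef[OF m(1) mk(2)]])
          (use slevel_rs_map[OF n _ m(1) mk(2)] in \<open>simp add: i(2) m(2) slevel_def\<close>)
    qed
  qed
  moreover have "regular_on (vec_coords (n\<^sup>2)) ?Y (c \<circ> ?G)" if "c \<in> point_coords n" for c
  proof -
    have G: "?G p \<in> M_Omega_e n" "rs_map n (?G p) = p" if "p \<in> ?Y" for p
      using that by (auto intro: inv_into_into f_inv_into_f)
    have lev: "regular_on (vec_coords (n\<^sup>2)) ?Y (\<lambda>p. level (fst (?G p)) m k)" if "m \<le> n" "k < m" for m k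
      by (rule regular_on_cong[OF regular_on_coord[OF level_vec_coord[OF that]]])
        (use level_rs_map[OF that] G(2) in metis)
    have sco: "regular_on (vec_coords (n\<^sup>2)) ?Y (\<lambda>p. scoef m k (?G p))" if "m < n" "k < m" for m k
      by (rule regular_on_cong[OF regular_on_coord[OF slevel_vec_coord[OF that]]])
        (use slevel_rs_map[OF n G(1) that] G(2) in metis)
    show ?thesis
      using that
    proof (cases rule: point_coords_cases)
      case (1 m k)
      then show ?thesis using lev by (simp add: comp_def)
    next
      case (2 i j)
      then show ?thesis
        using regular_on_inverse_map[of ?Y ?G n "vec_coords (n\<^sup>2)", OF G(1) lev sco order_refl]
        by (simp add: comp_def)
    qed
  qed
  ultimately show ?thesis
    unfolding algebraic_isomorphism_def regular_map_def
    using rs_map_inj[OF n] by (auto simp: bij_betw_def inv_into_into)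
qed

theorem theorem0p16:
  fixes n :: nat
  assumes "n \<ge> 1"
  shows "zariski_open_in (vec_coords (n\<^sup>2)) (carrier_vec (n\<^sup>2)) (rs_map n ` M_Omega_e n)
    \<and> algebraic_isomorphism (point_coords n) (M_Omega_e n)
        (vec_coords (n\<^sup>2)) (rs_map n ` M_Omega_e n) (rs_map n)
    \<and> (\<forall>i\<in>{1..tri n}. \<forall>j\<in>{1..tri n}. \<forall>z\<in>M_Omega_e n.
        bracket n (r_fun i) (r_fun j) z = 0)
    \<and> (\<forall>i\<in>{1..tri n}. \<forall>j\<in>{1..tri (n - 1)}. \<forall>z\<in>M_Omega_e n.
        bracket n (r_fun i) (s_fun n j) z = (if i = j then 1 else 0) * s_fun n j z)
    \<and> (\<forall>i\<in>{1..tri (n - 1)}. \<forall>j\<in>{1..tri (n - 1)}. \<forall>z\<in>M_Omega_e n.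
        bracket n (s_fun n i) (s_fun n j) z = 0)"
proof -
  have s_index: "\<exists>m k. m < n \<and> k < m \<and> j = Suc (tri (m - 1) + k)" if "j \<in> {1..tri (n - 1)}" for j
  proof -
    from tri_index_Suc_ex[OF that]
    obtain m k where mk: "m \<le> n - 1" "k < m" "j = Suc (tri (m - 1) + k)" by blast
    then have "m < n" using assms by simp
    with mk show ?thesis by blast
  qed
  have rr: "bracket n (r_fun i) (r_fun j) z = 0"
    if ij: "i \<in> {1..tri n}" "j \<in> {1..tri n}" and z: "z \<in> M_Omega_e n" for i j z
  proof -
    from tri_index_Suc_ex[OF ij(1)] obtain m k where i: "m \<le> n" "k < m" "i = Suc (tri (m - 1) + k)" by blast
    from tri_index_Suc_ex[OF ij(2)] obtain m' k' where j: "m' \<le> n" "k' < m'" "j = Suc (tri (m' - 1) + k')" by blast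
    show ?thesis
      unfolding i(3) j(3) r_fun_level by (rule bracket_level_level[OF assms z i(1,2) j(1,2)])
  qed
  have rs: "bracket n (r_fun i) (s_fun n j) z = (if i = j then 1 else 0) * s_fun n j z"
    if ij: "i \<in> {1..tri n}" "j \<in> {1..tri (n - 1)}" and z: "z \<in> M_Omega_e n" for i j z
  proof -
    from tri_index_Suc_ex[OF ij(1)] obtain m k where i: "m \<le> n" "k < m" "i = Suc (tri (m - 1) + k)" by blast
    from s_index[OF ij(2)] obtain m' k' where j: "m' < n" "k' < m'" "j = Suc (tri (m' - 1) + k')" by blast
    have "i = j \<longleftrightarrow> m = m' \<and> k = k'" using tri_index_unique[OF i(2) j(2)] i(3) j(3) by auto
    moreover have "s_fun n j w = scoef m' k' w" if "w \<in> M_Omega_e n" for w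
      unfolding j(3) by (rule s_fun_scoef[OF assms that j(1,2)])
    ultimately show ?thesis
      using bracket_level_scoef[OF assms z i(1,2) j(1,2), of "s_fun n j"] z
      by (simp add: i(3) r_fun_level[symmetric])
  qed
  have ss: "bracket n (s_fun n i) (s_fun n j) z = 0"
    if ij: "i \<in> {1..tri (n - 1)}" "j \<in> {1..tri (n - 1)}" and z: "z \<in> M_Omega_e n" for i j z
  proof -
    from s_index[OF ij(1)] obtain m k where i: "m < n" "k < m" "i = Suc (tri (m - 1) + k)" by blast
    from s_index[OF ij(2)] obtain m' k' where j: "m' < n" "k' < m'" "j = Suc (tri (m' - 1) + k')" by blast
    show ?thesis
      unfolding i(3) j(3)
      by (rule bracket_scoef_scoef[OF assms z i(1,2) j(1,2)]) (rule s_fun_scoef[OF assms _ i(1,2)], assumption,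
        rule s_fun_scoef[OF assms _ j(1,2)], assumption)
  qed
  show ?thesis
    using zariski_open_image[OF assms] rs_map_isomorphism[OF assms] rr rs ss by blast
qed

end
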